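(* Let $\Phi$ be an $m\times N$ sampling matrix (real, with unit-norm columns). Suppose that it has coherence parameter $\mu=O(m^{-1/4})$ and $\theta=O(m^{-1})$, where $\theta=\bar\mu^2$ or $\theta=\bar\mu_{\max}^2$ according as $\Phi$ is coherence-invariant or not, and that $$\|\Phi\|=O(\sqrt{N/k}).$$ If $m=\Theta(k(\log(N/\epsilon))^3)$, then $\Phi$ supports sparse recovery under Basis Pursuit for all but an $\epsilon$ proportion of $k$-sparse signals chosen from the generic random signal model $\mathcal{S}_k$.
   Context: $\|\cdot\|$ on matrices is the spectral norm; $[N]=\{1,\dots,N\}$. Let $\phi_1,\dots,\phi_N$ be the columns of $\Phi$ and $\mu_{ij}=|\phi_i^T\phi_j|$. The coherence parameter is $\mu=\max_{i\ne j}\mu_{ij}$; the mean square coherence is $\bar\mu^2=\frac1{N(N-1)}\sum_{i\ne j}\mu_{ij}^2$; the maximum average square coherence is $\bar\mu^2_{\max}=\max_{1\le j\le N}\frac1{N-1}\sum_{i\ne j}\mu_{ij}^2$. $\Phi$ is coherence-invariant if the set $\{\mu_{ij}:j\in[N]\setminus\{i\}\}$ is independent of $i$. Basis Pursuit: the signal $\mathbf{x}$ is estimated from its sketch $\mathbf{y}=\Phi\mathbf{x}$ by a minimizer $\hat{\mathbf{x}}$ of $\|\tilde{\mathbf{x}}\|_1$ over $\tilde{\mathbf{x}}\in\mathbb{R}^N$ subject to $\Phi\tilde{\mathbf{x}}=\mathbf{y}$. "Supports sparse recovery under Basis Pursuit" is used informally, for recovery of the signal from its sketch by this procedure. Generic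 random signal model $\mathcal{S}_k$: a random vector $\mathbf{x}\in\mathbb{R}^N$ such that the set $I$ of locations of its $k$ coordinates of largest magnitude is uniformly distributed over all $k$-subsets of $[N]$ and, conditional on $I$, the signs of $x_i$, $i\in I$, are i.i.d. uniform on $\{1,-1\}$. A vector is $k$-sparse if it has at most $k$ nonzero coordinates.
   Formalization: It is assumed that m ≤ N, and "coherence-invariant" is read as saying that the values μ_ij, j ≠ i, counted with multiplicity, are independent of i; without either, the claim fails (padded simplex frame with k=N; direct sums of unequal unions of mutually unbiased bases). *)

theory Defs
  imports
    "HOL-Probability.Probability"
    "HOL-Library.Landau_Symbols"
    "Jordan_Normal_Form.Matrix"
begin

text \<open>
  Matrices and vectors are those of Jordan-Normal-Form, whose dimensions are values rather than
  types: the theorem concerns families of matrices of growing size. Indices start at 0, so the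
  index set of the columns of an \<open>m \<times> N\<close> matrix is \<open>{..<N}\<close>.
\<close>

definition l2_norm :: "real Matrix.vec \<Rightarrow> real" where
  "l2_norm x = sqrt (scalar_prod x x)"

definition l1_norm :: "real Matrix.vec \<Rightarrow> real" where
  "l1_norm x = (\<Sum>i<dim_vec x. \<bar>vec_index x i\<bar>)"

definition spectral_norm :: "real mat \<Rightarrow> real" where
  "spectral_norm A =
     Sup {l2_norm (A *\<^sub>v x) | x. x \<in> carrier_vec (dim_col A) \<and> l2_norm x \<le> 1}"

definition unit_norm_columns :: "real mat \<Rightarrow> bool" where
  "unit_norm_columns A \<longleftrightarrow> (\<forall>j<dim_col A. l2_norm (col A j) = 1)"

definition col_coherence :: "real mat \<Rightarrow> nat \<Rightarrow> nat \<Rightarrow> real" where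
  "col_coherence A i j = \<bar>scalar_prod (col A i) (col A j)\<bar>"

text \<open>
  The next three quantities are meaningful for at least two columns only.
\<close>

definition coherence :: "real mat \<Rightarrow> real" where
  "coherence A = Max {col_coherence A i j | i j. i < dim_col A \<and> j < dim_col A \<and> i \<noteq> j}"

definition mean_square_coherence :: "real mat \<Rightarrow> real" where
  "mean_square_coherence A =
     (\<Sum>i<dim_col A. \<Sum>j\<in>{..<dim_col A} - {i}. (col_coherence A i j)\<^sup>2)
       / (real (dim_col A) * (real (dim_col A) - 1))"

definition max_average_square_coherence :: "real mat \<Rightarrow> real" where
  "max_average_square_coherence A =
     Max ((\<lambda>j. (\<Sum>i\<in>{..<dim_col A} - {j}. (col_coherence A i j)\<^sup>2) / (real (dim_col A) - 1))
           ` {..<dim_col A})"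

text \<open>
  The collection of the \<open>\<mu>\<^sub>i\<^sub>j\<close>, \<open>j \<noteq> i\<close>, is taken with multiplicities (as a family). Only then
  do the mean square coherence and the maximum average square coherence agree for a
  coherence-invariant matrix; the bare set of values does not control the row sums.
\<close>

definition coherence_invariant :: "real mat \<Rightarrow> bool" where
  "coherence_invariant A \<longleftrightarrow>
     (\<exists>S. \<forall>i<dim_col A. image_mset (col_coherence A i) (mset_set ({..<dim_col A} - {i})) = S)"

definition theta :: "real mat \<Rightarrow> real" where
  "theta A = (if coherence_invariant A then mean_square_coherence A
              else max_average_square_coherence A)"

definition bp_minimizer :: "real mat \<Rightarrow> real Matrix.vec \<Rightarrow> real Matrix.vec \<Rightarrow> bool" where
  "bp_minimizer A y z \<longleftrightarrow>
     is_arg_min l1_norm (\<lambda>u. u \<in> carrier_vec (dim_col A) \<and> A *\<^sub>v u = y) z"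

text \<open>
  Recovery must not depend on which minimizer is returned, so the signal is required to be
  the only one.
\<close>

definition bp_recovers :: "real mat \<Rightarrow> real Matrix.vec \<Rightarrow> bool" where
  "bp_recovers A x \<longleftrightarrow> {z. bp_minimizer A (A *\<^sub>v x) z} = {x}"

definition sparse_vec :: "nat \<Rightarrow> real Matrix.vec \<Rightarrow> bool" where
  "sparse_vec k x \<longleftrightarrow> card {i. i < dim_vec x \<and> vec_index x i \<noteq> 0} \<le> k"

definition largest_coords :: "nat \<Rightarrow> real Matrix.vec \<Rightarrow> nat set \<Rightarrow> bool" where
  "largest_coords k x I \<longleftrightarrow> I \<subseteq> {..<dim_vec x} \<and> card I = k \<and>
     (\<forall>i\<in>I. \<forall>j\<in>{..<dim_vec x} - I. \<bar>vec_index x j\<bar> \<le> \<bar>vec_index x i\<bar>)"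

text \<open>
  The random set \<open>I\<close> is existentially quantified because ties in magnitude may have to be broken.
  Nothing is assumed about the magnitudes. That the signs on \<open>J\<close> are, conditionally on \<open>I = J\<close>,
  independent and uniform on \<open>{1, -1}\<close> is expressed by their joint law: each of the \<open>2 ^ k\<close> sign
  patterns has conditional probability \<open>(1/2) ^ k\<close>.
\<close>

definition generic_signal ::
    "'w measure \<Rightarrow> nat \<Rightarrow> nat \<Rightarrow> ('w \<Rightarrow> real Matrix.vec) \<Rightarrow> bool" where
  "generic_signal M N k X \<longleftrightarrow>
     prob_space M \<and>
     (\<forall>\<omega>\<in>space M. X \<omega> \<in> carrier_vec N) \<and>
     (\<forall>i<N. (\<lambda>\<omega>. vec_index (X \<omega>) i) \<in> borel_measurable M) \<and>
     (\<exists>I. I \<in> measurable M (count_space (Pow {..<N})) \<and>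
        (AE \<omega> in M. largest_coords k (X \<omega>) (I \<omega>)) \<and>
        (\<forall>J. J \<subseteq> {..<N} \<and> card J = k \<longrightarrow>
           \<P>(\<omega> in M. I \<omega> = J) = 1 / real (N choose k) \<and>
           (\<forall>\<sigma>\<in>J \<rightarrow>\<^sub>E {1, -1}.
              \<P>(\<omega> in M. (\<forall>i\<in>J. sgn (vec_index (X \<omega>) i) = \<sigma> i) \<bar> I \<omega> = J) = (1 / 2) ^ k)))"

end

theory Submission
  imports Defs "Jordan_Normal_Form.Determinant" "HOL-Real_Asymp.Real_Asymp"
begin

text \<open>
  A signal with support \<open>I\<close> and signs \<open>\<sigma>\<close> is recovered as soon as the columns in \<open>I\<close> are independent
  and some \<open>h\<close> satisfies \<open>\<Phi>\<^sup>T h = \<sigma>\<close> on \<open>I\<close> and \<open>|\<Phi>\<^sup>T h| < 1\<close> off \<open>I\<close>. Such an \<open>h\<close> is built from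
  the regularized Gram matrix \<open>K = G (1 + s G)\<^sup>-\<^sup>1\<close>, \<open>G = \<Phi>\<^sup>T \<Phi>\<close>, with \<open>s\<close> a large constant times
  \<open>k / N\<close>. Regularization makes the norm of \<open>K\<close> a small multiple of \<open>N / k\<close>, while it perturbs
  the entries only by \<open>O(k / m)\<close>.

  With \<open>L = ln (N / \<epsilon>)\<close>, three events fail with probability much smaller than \<open>exp (- L)\<close>. The rows of
  \<open>K\<close> restricted to a random \<open>I\<close> have squared norm at most a small multiple of \<open>1 / L\<close>: this is
  Bennett's inequality, whose logarithmic gain absorbs the constants in the hypotheses, unless
  \<open>k\<close> is below a small multiple of \<open>L\<close>, where the coherence bound suffices. The principal submatrix
  \<open>K\<^sub>I\<close> is coercive: after decoupling, this follows from bounds on traces of powers of random sums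
  of rank one matrices, proved by adding one rank one term at a time. Finally, given \<open>I\<close>,
  Hoeffding's inequality for the random signs bounds the certificate off \<open>I\<close>.
\<close>

section \<open>Moments of positive semidefinite operators\<close>

text \<open>As \<epsilon> = N exp (- L), every exceptional event has to be about as rare as N exp (-
  3 L), whatever constants the hypotheses carry. Trace moments of order p with L \<le> p \<le> 2 L
  achieve this: a threshold 27 times the scale z of the moments gives 27^(-p), and 27 exceeds e^3.
  The scale z has to dominate both p times the largest squared length of the vectors and a multiple
  of the norm of the averaged operator; hence the demand that squared row lengths on I be of order 1
  / L with a small constant.

  Coercivity of K on I restricts K twice, in its rows and then in its columns, and each restriction
  scales squared norms by about k / N. The regularization with s = 10^4 k / N gives norm of K at
  most 1 / s, so the squared norm is at most 10^(-8) (N / k)^2, and both restrictions together leave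
  a small absolute constant. This is the origin of 10^4.

  Log-convexity of moments plays the part of eigenvalues. Randomness is handled by counting pairs of
  a support and a sign pattern, and measures enter only when the count is finished.\<close>

definition ip :: "nat \<Rightarrow> (nat \<Rightarrow> real) \<Rightarrow> (nat \<Rightarrow> real) \<Rightarrow> real" where
  "ip N u v = (\<Sum>l<N. u l * v l)"

text \<open>The operator sum of b_i b_i^T over S. Vectors are functions of which only the first N
  values matter, so that iterates need no dimension bookkeeping.\<close>

definition frame :: "nat \<Rightarrow> ('a \<Rightarrow> nat \<Rightarrow> real) \<Rightarrow> 'a set \<Rightarrow> (nat \<Rightarrow> real) \<Rightarrow> nat \<Rightarrow> real" where
  "frame N b S v = (\<lambda>l. \<Sum>i\<in>S. ip N (b i) v * b i l)"

definition unit_fun :: "nat \<Rightarrow> nat \<Rightarrow> real" where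
  "unit_fun i = (\<lambda>l. if l = i then 1 else 0)"

definition frame_trace :: "nat \<Rightarrow> ('a \<Rightarrow> nat \<Rightarrow> real) \<Rightarrow> 'a set \<Rightarrow> nat \<Rightarrow> real" where
  "frame_trace N b S q = (\<Sum>l<N. ip N (unit_fun l) ((frame N b S ^^ q) (unit_fun l)))"

lemma ip_commute: "ip N u v = ip N v u"
  by (simp add: ip_def mult.commute)

lemma ip_nonneg [simp]: "0 \<le> ip N u u"
  by (auto simp: ip_def intro!: sum_nonneg)

lemma ip_cauchy_schwarz: "(ip N u v)\<^sup>2 \<le> ip N u u * ip N v v"
  using Cauchy_Schwarz_ineq_sum[of u v "{..<N}"] by (simp add: ip_def power2_eq_square)

lemma ip_unit_left: "l < N \<Longrightarrow> ip N (unit_fun l) v = v l"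
  by (simp add: ip_def unit_fun_def if_distrib[of "\<lambda>x. x * _"] cong: if_cong)

lemma ip_unit_right: "l < N \<Longrightarrow> ip N v (unit_fun l) = v l"
  using ip_unit_left ip_commute by metis

lemma ip_parseval: "(\<Sum>l<N. (ip N u (unit_fun l))\<^sup>2) = ip N u u"
  unfolding ip_def[of N u u] by (intro sum.cong) (auto simp: ip_unit_right power2_eq_square)

lemma ip_sum_right: "ip N u (\<lambda>l. \<Sum>i\<in>S. c i * f i l) = (\<Sum>i\<in>S. c i * ip N u (f i))"
  unfolding ip_def
  by (simp add: sum_distrib_left algebra_simps) (rule sum.swap)

lemma ip_frame: "ip N u (frame N b S v) = (\<Sum>i\<in>S. ip N (b i) u * ip N (b i) v)"
  unfolding frame_def ip_sum_right by (simp add: ip_commute[of N u] mult.commute)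

lemma ip_frame_sym: "ip N u (frame N b S v) = ip N (frame N b S u) v"
  by (simp add: ip_frame ip_commute[of N "frame N b S u"] mult.commute)

lemma ip_frame_funpow: "ip N u ((frame N b S ^^ q) v) = ip N ((frame N b S ^^ q) u) v"
proof (induction q arbitrary: u)
  case (Suc q)
  have "ip N u ((frame N b S ^^ Suc q) v) = ip N (frame N b S u) ((frame N b S ^^ q) v)"
    by (simp add: ip_frame_sym)
  also have "\<dots> = ip N ((frame N b S ^^ q) (frame N b S u)) v"
    by (rule Suc)
  finally show ?case
    by (simp add: funpow_swap1)
qed simp

lemma frame_funpow_diff:
  "r < q \<Longrightarrow> frame N b S ((frame N b S ^^ (q - Suc r)) v) = (frame N b S ^^ (q - r)) v"
  by (metis Suc_diff_Suc comp_apply funpow.simps(2))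

section \<open>Moments and traces of powers of a frame operator\<close>

lemma moment_add:
  "ip N v ((frame N b S ^^ (p + q)) v) = ip N ((frame N b S ^^ p) v) ((frame N b S ^^ q) v)"
  by (simp add: funpow_add ip_frame_funpow[of N v p b S])

lemma moment_odd:
  "ip N v ((frame N b S ^^ Suc (r + r')) v)
     = (\<Sum>i\<in>S. ip N (b i) ((frame N b S ^^ r) v) * ip N (b i) ((frame N b S ^^ r') v))"
proof -
  have "ip N v ((frame N b S ^^ (r + Suc r')) v)
      = ip N ((frame N b S ^^ r) v) (frame N b S ((frame N b S ^^ r') v))"
    unfolding moment_add by simp
  then show ?thesis
    by (simp add: ip_frame)
qed

lemma moment_nonneg: "0 \<le> ip N v ((frame N b S ^^ q) v)"
proof (cases "even q")
  case True
  then obtain r where "q = r + r"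
    by (metis evenE mult_2)
  then show ?thesis
    by (simp add: moment_add)
next
  case False
  then obtain r where "q = Suc (r + r)"
    by (metis oddE mult_2 Suc_eq_plus1)
  then show ?thesis
    unfolding \<open>q = _\<close> moment_odd by (intro sum_nonneg) simp
qed

text \<open>Cauchy-Schwarz in two guises: for even q in the inner product itself, for odd q in the
  semi-inner product <u, Y v> given by the frame operator Y. The split by parity takes the place of
  a square root of Y.\<close>

lemma moment_log_convex:
  "(ip N v ((frame N b S ^^ Suc q) v))\<^sup>2
     \<le> ip N v ((frame N b S ^^ q) v) * ip N v ((frame N b S ^^ Suc (Suc q)) v)"
proof (cases "even q")
  case True
  then obtain r where "q = r + r"
    by (metis evenE mult_2)
  then have q: "Suc q = r + Suc r" "Suc (Suc q) = Suc r + Suc r" "q = r + r"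
    by auto
  show ?thesis
    unfolding q(2) unfolding q(1) unfolding q(3) moment_add by (rule ip_cauchy_schwarz)
next
  case False
  then obtain r where "q = Suc (r + r)"
    by (metis oddE mult_2 Suc_eq_plus1)
  then have q: "Suc q = Suc (r + Suc r)" "Suc (Suc q) = Suc (Suc r + Suc r)" "q = Suc (r + r)"
    by auto
  show ?thesis
    unfolding q(2) unfolding q(1) unfolding q(3) moment_odd
    using Cauchy_Schwarz_ineq_sum[of "\<lambda>i. ip N (b i) ((frame N b S ^^ r) v)"
        "\<lambda>i. ip N (b i) ((frame N b S ^^ Suc r) v)" S]
    by (simp add: power2_eq_square)
qed

text \<open>Cyclicity of the trace: one factor, the sum of b_i b_i^T, is pulled out and becomes an
  evaluation at the b_i. This is what permits an induction on the exponent.\<close>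

lemma frame_trace_Suc:
  "frame_trace N b S (Suc q) = (\<Sum>i\<in>S. ip N (b i) ((frame N b S ^^ q) (b i)))"
proof -
  have "frame_trace N b S (Suc q)
      = (\<Sum>l<N. \<Sum>i\<in>S. b i l * (frame N b S ^^ q) (b i) l)"
    unfolding frame_trace_def
    by (intro sum.cong) (auto simp: ip_frame ip_unit_right ip_frame_funpow)
  also have "\<dots> = (\<Sum>i\<in>S. ip N (b i) ((frame N b S ^^ q) (b i)))"
    unfolding ip_def by (rule sum.swap)
  finally show ?thesis .
qed

lemma frame_trace_0: "frame_trace N b S 0 = real N"
  by (simp add: frame_trace_def ip_unit_left) (simp add: unit_fun_def)

lemma frame_trace_nonneg: "0 \<le> frame_trace N b S q"
  unfolding frame_trace_def by (intro sum_nonneg moment_nonneg)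

text \<open>The hypothesis says that C, the sum of c_i c_i^T, is at most \<Lambda> times the
  identity, and the left side is the trace of C Y^q. Writing Y^q as Y^r Y^r or Y^r Y Y^r lets the
  hypothesis act on the images under Y^r of the unit vectors or of the b_j.\<close>

lemma sum_moment_le_trace:
  assumes \<Lambda>: "\<And>v. (\<Sum>i\<in>A. (ip N (c i) v)\<^sup>2) \<le> \<Lambda> * ip N v v"
  shows "(\<Sum>i\<in>A. ip N (c i) ((frame N b S ^^ q) (c i))) \<le> \<Lambda> * frame_trace N b S q"
proof (cases "even q")
  case True
  then obtain r where q: "q = r + r"
    by (metis evenE mult_2)
  have "(\<Sum>i\<in>A. ip N (c i) ((frame N b S ^^ q) (c i)))
      = (\<Sum>i\<in>A. \<Sum>l<N. (ip N (c i) ((frame N b S ^^ r) (unit_fun l)))\<^sup>2)"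
    by (simp only: q moment_add ip_frame_funpow[of N "c i" r b S "unit_fun l" for i l] ip_parseval)
  also have "\<dots> = (\<Sum>l<N. \<Sum>i\<in>A. (ip N (c i) ((frame N b S ^^ r) (unit_fun l)))\<^sup>2)"
    by (rule sum.swap)
  also have "\<dots> \<le> (\<Sum>l<N. \<Lambda> * ip N ((frame N b S ^^ r) (unit_fun l)) ((frame N b S ^^ r) (unit_fun l)))"
    by (intro sum_mono \<Lambda>)
  also have "\<dots> = \<Lambda> * frame_trace N b S q"
    unfolding frame_trace_def q moment_add by (simp add: sum_distrib_left)
  finally show ?thesis .
next
  case False
  then obtain r where q: "q = Suc (r + r)"
    by (metis oddE mult_2 Suc_eq_plus1)
  have "(\<Sum>i\<in>A. ip N (c i) ((frame N b S ^^ q) (c i)))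
      = (\<Sum>i\<in>A. \<Sum>j\<in>S. (ip N (c i) ((frame N b S ^^ r) (b j)))\<^sup>2)"
    by (simp only: q moment_odd ip_frame_funpow[of N "b j" r b S "c i" for i j]
        ip_commute[of N _ "c i" for i] power2_eq_square)
  also have "\<dots> = (\<Sum>j\<in>S. \<Sum>i\<in>A. (ip N (c i) ((frame N b S ^^ r) (b j)))\<^sup>2)"
    by (rule sum.swap)
  also have "\<dots> \<le> (\<Sum>j\<in>S. \<Lambda> * ip N ((frame N b S ^^ r) (b j)) ((frame N b S ^^ r) (b j)))"
    by (intro sum_mono \<Lambda>)
  also have "\<dots> = \<Lambda> * frame_trace N b S q"
    unfolding q frame_trace_Suc moment_add by (simp add: sum_distrib_left)
  finally show ?thesis .
qed

lemma moment_le_trace: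
  "ip N w ((frame N b S ^^ q) w) \<le> ip N w w * frame_trace N b S q"
  using sum_moment_le_trace[where A = "{()}" and c = "\<lambda>_. w" and \<Lambda> = "ip N w w" and N = N]
    ip_cauchy_schwarz[of N w] by simp

text \<open>By log-convexity the ratios of successive moments of w do not decrease, so the initial
  ratio c persists and the p-th moment is at least c^p |w|^2. The trace dominates the normalized
  moment.\<close>

lemma moment_power_le_trace:
  assumes "0 < c" "c * ip N w w \<le> ip N w (frame N b S w)" "0 < ip N w w"
  shows "c ^ p \<le> frame_trace N b S p"
proof -
  let ?g = "\<lambda>q. ip N w ((frame N b S ^^ q) w)"
  have step: "c * ?g r \<le> ?g (Suc r)" for r
  proof (induction r)
    case 0
    then show ?case using assms by simp
  next
    case (Suc r)
    show ?case
    proof (cases "?g (Suc r) = 0")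
      case True
      then show ?thesis
        using moment_nonneg[of N w "Suc (Suc r)" b S] by simp
    next
      case False
      then have pos: "?g (Suc r) > 0"
        using moment_nonneg[of N w "Suc r" b S] by simp
      have "c * (?g (Suc r))\<^sup>2 \<le> (c * ?g r) * ?g (Suc (Suc r))"
        using mult_left_mono[OF moment_log_convex[of N w r b S], of c] \<open>0 < c\<close>
        by (simp add: mult.assoc)
      also have "\<dots> \<le> ?g (Suc r) * ?g (Suc (Suc r))"
        by (rule mult_right_mono[OF Suc moment_nonneg])
      finally have "?g (Suc r) * (c * ?g (Suc r)) \<le> ?g (Suc r) * ?g (Suc (Suc r))"
        by (simp only: power2_eq_square mult_ac)
      then show ?thesis
        by (rule mult_left_le_imp_le[OF _ pos])
    qed
  qed
  have "c ^ p * ?g 0 \<le> ?g p"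
  proof (induction p)
    case (Suc p)
    have "c ^ Suc p * ?g 0 \<le> c * ?g p"
      using mult_left_mono[OF Suc, of c] \<open>0 < c\<close> by (simp add: mult.assoc)
    then show ?case using step[of p] by linarith
  qed simp
  then have "c ^ p * ip N w w \<le> frame_trace N b S p * ip N w w"
    using moment_le_trace[of N w p b S] by (simp add: mult.commute)
  then show ?thesis
    using assms(3) mult_right_le_imp_le by blast
qed

section \<open>Adding one rank one term to a frame operator\<close>

lemma log_convex_le_max:
  fixes h :: "nat \<Rightarrow> real"
  assumes nonneg: "\<And>r. 0 \<le> h r"
    and lc: "\<And>r. (h (Suc r))\<^sup>2 \<le> h r * h (Suc (Suc r))"
    and "r \<le> q"
  shows "h r \<le> max (h 0) (h q)"
proof (rule ccontr)
  assume "\<not> ?thesis"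
  then have gt: "h 0 < h r" "h q < h r" by auto
  define x where "x = Max (h ` {..q})"
  have xge: "h s \<le> x" if "s \<le> q" for s
    using that by (auto simp: x_def)
  have "x \<in> h ` {..q}"
    unfolding x_def by (rule Max_in) auto
  then have ex: "\<exists>s. s \<le> q \<and> h s = x" by auto
  \<comment> \<open>Log-convexity at an interior maximizer makes its left neighbour a maximizer too,
    which the least one excludes.\<close>
  define s where "s = (LEAST s. s \<le> q \<and> h s = x)"
  have s: "s \<le> q" "h s = x"
    using LeastI_ex[OF ex] by (auto simp: s_def)
  have "h r \<le> x" using xge assms by auto
  then have "s \<noteq> 0" "s \<noteq> q" "x > 0"
    using gt s nonneg[of 0] by (metis not_le, metis not_le, linarith)
  then obtain s' where s': "s = Suc s'" "Suc s \<le> q"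
    using s by (cases s) auto
  have "x * x \<le> h s' * h (Suc s)"
    using lc[of s'] s s' by (simp add: power2_eq_square)
  also have "\<dots> \<le> h s' * x"
    using xge[OF s'(2)] nonneg by (intro mult_left_mono) auto
  finally have "x \<le> h s'"
    using \<open>x > 0\<close> by (rule mult_right_le_imp_le)
  then have "h s' = x" using xge[of s'] s s' by auto
  then have "s \<le> s'"
    unfolding s_def using s s' by (intro Least_le) auto
  then show False using s' by simp
qed

text \<open>Telescoping of Y'^q - Y^q, where Y' - Y = b_i b_i^T has rank one, so that every summand
  splits into two scalar moments. For u = b_i this is a renewal equation between the moments before
  and after the insertion.\<close>

lemma ip_frame_insert_funpow:
  assumes "finite S" "i \<notin> S"
  shows "ip N u ((frame N b (insert i S) ^^ q) (b i))
      = ip N u ((frame N b S ^^ q) (b i))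
        + (\<Sum>r<q. ip N (b i) ((frame N b (insert i S) ^^ r) (b i))
             * ip N u ((frame N b S ^^ (q - 1 - r)) (b i)))"
proof (induction q arbitrary: u)
  case 0
  then show ?case by simp
next
  case (Suc q)
  let ?Y = "frame N b S" and ?Y' = "frame N b (insert i S)"
  let ?x = "(?Y' ^^ q) (b i)"
  have "ip N u ((?Y' ^^ Suc q) (b i)) = ip N (b i) u * ip N (b i) ?x + ip N (?Y u) ?x"
    using assms by (simp add: ip_frame flip: ip_frame_sym)
  also have "ip N (?Y u) ?x = ip N u ((?Y ^^ Suc q) (b i))
     + (\<Sum>r<q. ip N (b i) ((?Y' ^^ r) (b i)) * ip N u ((?Y ^^ (q - r)) (b i)))"
    unfolding Suc
    by (intro arg_cong2[where f = "(+)"] sum.cong refl)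
       (auto simp: frame_funpow_diff simp flip: ip_frame_sym)
  finally show ?case
    by (simp add: ip_commute)
qed

text \<open>In generating functions the recursion reads F = G / (1 - x G). For the geometric
  majorant G = \<beta> / (1 - z x) it gives \<beta> / (1 - (z + \<beta>) x), whose coefficients are
  the bound.\<close>

lemma renewal_bound:
  fixes f g :: "nat \<Rightarrow> real"
  assumes f: "\<And>r. f r = g r + (\<Sum>s<r. f s * g (r - 1 - s))"
    and f_nonneg: "\<And>r. 0 \<le> f r"
    and g: "\<And>r. r \<le> q \<Longrightarrow> g r \<le> \<beta> * z ^ r"
    and pos: "0 \<le> \<beta>" "0 \<le> z"
    and "r \<le> q"
  shows "f r \<le> \<beta> * (z + \<beta>) ^ r"
  using \<open>r \<le> q\<close>
proof (induction r rule: less_induct)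
  case (less r)
  have "f r \<le> \<beta> * z ^ r + (\<Sum>s<r. (\<beta> * (z + \<beta>) ^ s) * (\<beta> * z ^ (r - 1 - s)))"
    unfolding f[of r]
  proof (intro add_mono g sum_mono)
    fix s assume "s \<in> {..<r}"
    then have s: "s < r" "r - 1 - s \<le> q" using less.prems by auto
    have "f s * g (r - 1 - s) \<le> f s * (\<beta> * z ^ (r - 1 - s))"
      by (intro mult_left_mono g s f_nonneg)
    also have "\<dots> \<le> (\<beta> * (z + \<beta>) ^ s) * (\<beta> * z ^ (r - 1 - s))"
      using less s pos by (intro mult_right_mono) auto
    finally show "f s * g (r - 1 - s) \<le> (\<beta> * (z + \<beta>) ^ s) * (\<beta> * z ^ (r - 1 - s))" .
  qed (use less.prems in simp)
  also have "\<dots> = \<beta> * (z ^ r + ((z + \<beta>) - z) * (\<Sum>s<r. z ^ (r - Suc s) * (z + \<beta>) ^ s))"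
    by (simp add: sum_distrib_left algebra_simps)
  also have "\<dots> = \<beta> * (z + \<beta>) ^ r"
    unfolding power_diff_sumr2[symmetric] by simp
  finally show ?case .
qed

text \<open>
  By log-convexity the moments of the unperturbed operator are dominated by a geometric sequence,
  for which the renewal identity can be solved exactly.
\<close>

lemma rank_one_moment:
  assumes "finite S" "i \<notin> S" "0 < \<beta>" "ip N (b i) (b i) \<le> \<beta>"
  shows "ip N (b i) ((frame N b (insert i S) ^^ q) (b i))
      \<le> exp 1 * (ip N (b i) ((frame N b S ^^ q) (b i)) + \<beta> * (real q * \<beta>) ^ q)"
proof -
  define f where "f = (\<lambda>q. ip N (b i) ((frame N b (insert i S) ^^ q) (b i)))"
  define g where "g = (\<lambda>q. ip N (b i) ((frame N b S ^^ q) (b i)))"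
  have f_nonneg: "0 \<le> f r" and g_nonneg: "0 \<le> g r" for r
    by (simp_all add: f_def g_def moment_nonneg)
  have ren: "f r = g r + (\<Sum>s<r. f s * g (r - 1 - s))" for r
    unfolding f_def g_def by (rule ip_frame_insert_funpow[OF assms(1,2)])
  have "f q \<le> exp 1 * (g q + \<beta> * (real q * \<beta>) ^ q)"
  proof (cases "q = 0")
    case True
    have "g 0 \<le> exp 1 * g 0"
      using g_nonneg[of 0] by (simp add: mult_le_cancel_right1)
    also have "\<dots> \<le> exp 1 * (g 0 + \<beta>)"
      using \<open>0 < \<beta>\<close> by simp
    finally show ?thesis
      using True ren[of 0] by simp
  next
    case False
    \<comment> \<open>\<open>w\<close> is the rate at which \<beta> w^q meets the moment
      \<open>g q\<close> exactly. The floor q \<beta> under \<open>z\<close> keeps the passage from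
      z to z + \<beta> within a factor 1 + 1 / q, so the q-th power loses at most a factor
      e.\<close>
    define w where "w = root q (g q / \<beta>)"
    define z where "z = max (real q * \<beta>) w"
    have "w \<ge> 0" "w ^ q = g q / \<beta>"
      using False g_nonneg[of q] \<open>0 < \<beta>\<close> by (simp_all add: w_def)
    have "z > 0" using \<open>0 < \<beta>\<close> False by (simp add: z_def less_max_iff_disj)
    have "w ^ q \<le> z ^ q"
      using \<open>w \<ge> 0\<close> by (intro power_mono) (auto simp: z_def)
    then have gq: "g q \<le> \<beta> * z ^ q"
      using \<open>w ^ q = _\<close> \<open>0 < \<beta>\<close> by (simp add: field_simps)
    \<comment> \<open>Dividing by a geometric sequence preserves log-convexity, so only the end
      points 0 and q have to be compared with \<beta>.\<close>
    have "g r / z ^ r \<le> max (g 0 / z ^ 0) (g q / z ^ q)" if "r \<le> q" for r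
    proof (rule log_convex_le_max[OF _ _ that])
      fix r
      show "0 \<le> g r / z ^ r" using g_nonneg \<open>z > 0\<close> by simp
      have "(g (Suc r))\<^sup>2 / (z ^ r * z ^ Suc (Suc r)) \<le> g r * g (Suc (Suc r)) / (z ^ r * z ^ Suc (Suc r))"
        using \<open>z > 0\<close> unfolding g_def by (intro divide_right_mono moment_log_convex) auto
      then show "(g (Suc r) / z ^ Suc r)\<^sup>2 \<le> g r / z ^ r * (g (Suc (Suc r)) / z ^ Suc (Suc r))"
        by (simp add: power_divide power2_eq_square algebra_simps)
    qed
    moreover have "max (g 0 / z ^ 0) (g q / z ^ q) \<le> \<beta>"
      using gq assms \<open>z > 0\<close> by (simp add: g_def divide_le_eq)
    ultimately have "g r / z ^ r \<le> \<beta>" if "r \<le> q" for r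
      using that by fastforce
    then have "g r \<le> \<beta> * z ^ r" if "r \<le> q" for r
      using that \<open>z > 0\<close> by (simp add: divide_le_eq)
    then have "f q \<le> \<beta> * (z + \<beta>) ^ q"
      using renewal_bound[OF ren f_nonneg, where q = q and \<beta> = \<beta> and z = z and r = q]
        \<open>0 < \<beta>\<close> \<open>z > 0\<close> by simp
    also have "\<dots> \<le> \<beta> * (z * (1 + 1 / real q)) ^ q"
    proof (intro mult_left_mono power_mono)
      show "z + \<beta> \<le> z * (1 + 1 / real q)"
        using False by (simp add: z_def field_simps le_max_iff_disj)
    qed (use \<open>0 < \<beta>\<close> \<open>z > 0\<close> in auto)
    also have "\<beta> * (z * (1 + 1 / real q)) ^ q \<le> \<beta> * (z ^ q * exp 1)"
      unfolding power_mult_distrib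
      using \<open>0 < \<beta>\<close> \<open>z > 0\<close> False exp_ge_one_plus_x_over_n_power_n[of q 1]
      by (intro mult_left_mono) auto
    also have "\<dots> \<le> exp 1 * (g q + \<beta> * (real q * \<beta>) ^ q)"
    proof -
      have "z ^ q \<le> g q / \<beta> + (real q * \<beta>) ^ q"
        using \<open>w ^ q = _\<close> g_nonneg[of q] \<open>0 < \<beta>\<close> by (auto simp: z_def max_def)
      then have "\<beta> * z ^ q \<le> g q + \<beta> * (real q * \<beta>) ^ q"
        using mult_left_mono[of "z ^ q" "g q / \<beta> + (real q * \<beta>) ^ q" \<beta>] \<open>0 < \<beta>\<close>
        by (simp add: algebra_simps)
      then have "exp 1 * (\<beta> * z ^ q) \<le> exp 1 * (g q + \<beta> * (real q * \<beta>) ^ q)"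
        by (intro mult_left_mono) auto
      then show ?thesis
        by (simp add: mult_ac)
    qed
    finally show ?thesis .
  qed
  then show ?thesis
    by (simp add: f_def g_def)
qed

section \<open>Averages of traces over all subsets of a given size\<close>

definition ksubsets :: "'a set \<Rightarrow> nat \<Rightarrow> 'a set set" where
  "ksubsets A k = {S. S \<subseteq> A \<and> card S = k}"

lemma finite_ksubsets [simp]: "finite A \<Longrightarrow> finite (ksubsets A k)"
  by (simp add: ksubsets_def)

lemma card_ksubsets: "finite A \<Longrightarrow> card (ksubsets A k) = card A choose k"
  by (simp add: ksubsets_def n_subsets)

text \<open>Pairs (S, i) with i in S correspond to pairs (J, i) with i outside J. Afterwards i runs
  over all of A - J, which brings in the bound on the full sum of b_i b_i^T.\<close>

lemma sum_ksubsets_remove: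
  fixes F :: "'a \<Rightarrow> 'a set \<Rightarrow> real"
  assumes "finite A"
  shows "(\<Sum>S\<in>ksubsets A (Suc k). \<Sum>i\<in>S. F i (S - {i})) = (\<Sum>J\<in>ksubsets A k. \<Sum>i\<in>A - J. F i J)"
proof -
  have fin: "finite S" if "S \<in> ksubsets A k'" for S k'
    using that assms finite_subset by (auto simp: ksubsets_def)
  have "(\<Sum>S\<in>ksubsets A (Suc k). \<Sum>i\<in>S. F i (S - {i}))
      = (\<Sum>(S, i)\<in>Sigma (ksubsets A (Suc k)) (\<lambda>S. S). F i (S - {i}))"
    using assms fin by (intro sum.Sigma) auto
  also have "\<dots> = (\<Sum>(J, i)\<in>Sigma (ksubsets A k) (\<lambda>J. A - J). F i J)"
    using fin
    by (intro sum.reindex_bij_witness[where i = "\<lambda>(J, i). (insert i J, i)" and j = "\<lambda>(S, i). (S - {i}, i)"])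
       (auto simp: ksubsets_def card_insert_if finite_subset[OF _ assms])
  also have "\<dots> = (\<Sum>J\<in>ksubsets A k. \<Sum>i\<in>A - J. F i J)"
    using assms by (intro sum.Sigma[symmetric]) auto
  finally show ?thesis .
qed

text \<open>Induction on the exponent, for all set sizes at once. Cyclicity turns a trace into
  moments of the b_i; taking b_i out of its own operator costs a factor e and an additive error; the
  sum over the freed i is at most \<Lambda> times a trace over sets one element smaller.
  \<open>z1\<close> absorbs e \<Lambda> and the ratio of the binomial coefficients into one factor
  z, and \<open>z2\<close> absorbs the error, with 3 \<le> P providing e \<le> P. The fixed bound P
  on the exponents keeps z the same throughout.\<close>

lemma sum_frame_trace_ksubsets:
  assumes "finite A" and "0 < \<beta>" and "0 \<le> \<Lambda>"
    and \<beta>: "\<And>i. i \<in> A \<Longrightarrow> ip N (b i) (b i) \<le> \<beta>"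
    and \<Lambda>: "\<And>v. (\<Sum>i\<in>A. (ip N (b i) v)\<^sup>2) \<le> \<Lambda> * ip N v v"
    and "a \<le> card A" and z1: "exp 1 * \<Lambda> * real a \<le> z * (real (card A) + 1 - real a)"
    and z2: "real P * \<beta> \<le> z" and "3 \<le> P" and "p \<le> P"
  shows "(\<Sum>S\<in>ksubsets A a. frame_trace N b S p)
           \<le> real (card A choose a) * (real N + real a * real p) * z ^ p"
  using \<open>a \<le> card A\<close> z1 \<open>p \<le> P\<close>
proof (induction p arbitrary: a)
  case 0
  then show ?case
    using \<open>finite A\<close> by (simp add: frame_trace_0 card_ksubsets)
next
  case (Suc p)
  have "0 < z"
    using z2 \<open>0 < \<beta>\<close> \<open>3 \<le> P\<close> by (smt (verit) mult_pos_pos of_nat_0_less_iff not_numeral_le_zero neq0_conv)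
  show ?case
  proof (cases a)
    case 0
    have "S = {}" if "S \<in> ksubsets A 0" for S
      using that finite_subset[OF _ \<open>finite A\<close>] by (auto simp: ksubsets_def)
    then have "(\<Sum>S\<in>ksubsets A a. frame_trace N b S (Suc p)) = 0"
      unfolding 0 by (intro sum.neutral) (metis frame_trace_Suc sum.empty)
    then show ?thesis
      using \<open>0 < z\<close> by simp
  next
    case (Suc a')
    let ?m = "\<lambda>i S. ip N (b i) ((frame N b S ^^ p) (b i))"
    let ?c = "real (card A choose a)"
    have fin: "finite S" if "S \<in> ksubsets A a" for S
      using that finite_subset[OF _ \<open>finite A\<close>] by (auto simp: ksubsets_def)
    have "(\<Sum>S\<in>ksubsets A a. frame_trace N b S (Suc p))
        \<le> (\<Sum>S\<in>ksubsets A a. \<Sum>i\<in>S. exp 1 * (?m i (S - {i}) + \<beta> * (real p * \<beta>) ^ p))"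
      unfolding frame_trace_Suc
    proof (intro sum_mono)
      fix S i assume *: "S \<in> ksubsets A a" "i \<in> S"
      then have "i \<in> A" by (auto simp: ksubsets_def)
      then show "?m i S \<le> exp 1 * (?m i (S - {i}) + \<beta> * (real p * \<beta>) ^ p)"
        using rank_one_moment[of "S - {i}" i \<beta> N b p] fin * \<beta> \<open>0 < \<beta>\<close>
        by (simp add: insert_absorb)
    qed
    also have "\<dots> = exp 1 * (\<Sum>S\<in>ksubsets A a. \<Sum>i\<in>S. ?m i (S - {i}))
        + ?c * real a * (exp 1 * \<beta> * (real p * \<beta>) ^ p)"
    proof -
      have "(\<Sum>S\<in>ksubsets A a. real (card S)) = ?c * real a"
        using \<open>finite A\<close> by (simp add: ksubsets_def flip: card_ksubsets)
      then show ?thesis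
        by (simp add: distrib_left sum.distrib sum_distrib_left sum_distrib_right[symmetric] mult.assoc
            del: of_nat_Suc)
    qed
    also have "(\<Sum>S\<in>ksubsets A a. \<Sum>i\<in>S. ?m i (S - {i})) = (\<Sum>J\<in>ksubsets A a'. \<Sum>i\<in>A - J. ?m i J)"
      unfolding Suc by (rule sum_ksubsets_remove[OF \<open>finite A\<close>])
    also have "\<dots> \<le> (\<Sum>J\<in>ksubsets A a'. \<Lambda> * frame_trace N b J p)"
    proof (intro sum_mono)
      fix J
      have "(\<Sum>i\<in>A - J. ?m i J) \<le> (\<Sum>i\<in>A. ?m i J)"
        using \<open>finite A\<close> by (intro sum_mono2 moment_nonneg) auto
      also have "\<dots> \<le> \<Lambda> * frame_trace N b J p"
        by (rule sum_moment_le_trace[OF \<Lambda>])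
      finally show "(\<Sum>i\<in>A - J. ?m i J) \<le> \<Lambda> * frame_trace N b J p" .
    qed
    also have "\<dots> \<le> \<Lambda> * (real (card A choose a') * (real N + real a' * real p) * z ^ p)"
    proof -
      have "z * (real (card A) + 1 - real a) \<le> z * (real (card A) + 1 - real a')"
        using \<open>0 < z\<close> Suc by simp
      moreover have "exp 1 * \<Lambda> * real a' \<le> exp 1 * \<Lambda> * real a"
        using \<open>0 \<le> \<Lambda>\<close> Suc by (intro mult_left_mono) auto
      ultimately have "exp 1 * \<Lambda> * real a' \<le> z * (real (card A) + 1 - real a')"
        using Suc.prems(2) by linarith
      then show ?thesis
        unfolding sum_distrib_left[symmetric]
        using Suc.prems Suc \<open>0 \<le> \<Lambda>\<close> by (intro mult_left_mono Suc.IH) auto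
    qed
    also have "exp 1 * (\<Lambda> * (real (card A choose a') * (real N + real a' * real p) * z ^ p))
        \<le> ?c * (real N + real a' * real p) * z ^ Suc p"
    proof -
      have pos: "real (card A) + 1 - real a > 0"
        using Suc.prems by simp
      have "?c * real a = real (card A choose a') * (real (card A) + 1 - real a)"
      proof -
        have "a * (card A choose a) = (card A - a') * (card A choose a')"
          unfolding Suc by (metis binomial_absorb_comp binomial_absorption)
        then have "real a * ?c = real (card A - a') * real (card A choose a')"
          by (metis of_nat_mult)
        then show ?thesis
          using Suc Suc.prems by (simp add: of_nat_diff mult.commute)
      qed
      then have c': "real (card A choose a') = ?c * real a / (real (card A) + 1 - real a)"
        using pos by (simp add: field_simps)
      have "exp 1 * \<Lambda> * real (card A choose a')
          = ?c * (exp 1 * \<Lambda> * real a / (real (card A) + 1 - real a))"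
        unfolding c' by simp
      also have "\<dots> \<le> ?c * z"
        using pos Suc.prems by (intro mult_left_mono) (auto simp: divide_le_eq)
      finally have "exp 1 * \<Lambda> * real (card A choose a') * ((real N + real a' * real p) * z ^ p)
          \<le> ?c * z * ((real N + real a' * real p) * z ^ p)"
        using \<open>0 < z\<close> by (intro mult_right_mono) auto
      then show ?thesis
        by (simp add: mult_ac)
    qed
    also have "?c * real a * (exp 1 * \<beta> * (real p * \<beta>) ^ p) \<le> ?c * real a * z ^ Suc p"
    proof -
      have "exp 1 * \<beta> \<le> real P * \<beta>"
        using exp_le \<open>3 \<le> P\<close> \<open>0 < \<beta>\<close> by (intro mult_right_mono) auto
      moreover have "real p * \<beta> \<le> real P * \<beta>"
        using Suc.prems \<open>0 < \<beta>\<close> by simp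
      ultimately have "exp 1 * \<beta> \<le> z" "real p * \<beta> \<le> z"
        using z2 by linarith+
      then have "exp 1 * \<beta> * (real p * \<beta>) ^ p \<le> z * z ^ p"
        using \<open>0 < \<beta>\<close> \<open>0 < z\<close> by (intro mult_mono power_mono) auto
      then show ?thesis
        by (intro mult_left_mono) auto
    qed
    finally have "(\<Sum>S\<in>ksubsets A a. frame_trace N b S (Suc p))
        \<le> ?c * (real N + real a' * real p) * z ^ Suc p + ?c * real a * z ^ Suc p"
      by simp
    also have "\<dots> = ?c * (real N + real a' * real p + real a) * z ^ Suc p"
      by (simp add: algebra_simps)
    also have "\<dots> \<le> ?c * (real N + real a * real (Suc p)) * z ^ Suc p"
      using \<open>0 < z\<close> Suc by (intro mult_right_mono mult_left_mono) (auto simp: algebra_simps)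
    finally show ?thesis .
  qed
qed

section \<open>Large deviations for random subsets and random signs\<close>

text \<open>The quotient of the two binomial coefficients is the probability that a fixed t-set lies
  in a random k-set; its factors (k - j) / (n - j) are at most k / n.\<close>

lemma binomial_diff_le:
  assumes "t \<le> k" "k \<le> n" "0 < n"
  shows "real ((n - t) choose (k - t)) \<le> real (n choose k) * (real k / real n) ^ t"
  using \<open>t \<le> k\<close>
proof (induction t)
  case 0
  then show ?case by simp
next
  case (Suc t)
  have "(n - t) * ((n - Suc t) choose (k - Suc t)) = (k - t) * ((n - t) choose (k - t))"
    using Suc.prems assms times_binomial_minus1_eq[of "k - t" "n - t"] by simp
  then have "real (n - t) * real ((n - Suc t) choose (k - Suc t))
      = real (k - t) * real ((n - t) choose (k - t))"
    by (metis of_nat_mult)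
  then have "real ((n - Suc t) choose (k - Suc t))
      = (real (k - t) / real (n - t)) * real ((n - t) choose (k - t))"
    using Suc.prems assms by (simp add: field_simps)
  also have "\<dots> \<le> (real k / real n) * (real (n choose k) * (real k / real n) ^ t)"
  proof (intro mult_mono Suc.IH)
    have "real (k - t) * real n \<le> real k * real (n - t)"
      using Suc.prems assms by (simp add: of_nat_diff algebra_simps mult_right_mono)
    then show "real (k - t) / real (n - t) \<le> real k / real n"
      using Suc.prems assms by (simp add: divide_simps mult_ac)
  qed (use Suc.prems in auto)
  finally show ?case
    by (simp add: mult_ac)
qed

lemma card_ksubsets_superset:
  assumes "finite A" "T \<subseteq> A" "card T \<le> k"
  shows "card {S \<in> ksubsets A k. T \<subseteq> S} = (card A - card T) choose (k - card T)"
proof -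
  have fT: "finite T" using assms finite_subset by auto
  have fin: "finite S" if "S \<subseteq> A" for S using that assms finite_subset by auto
  have "card (S \<union> T) = k" if "S \<in> ksubsets (A - T) (k - card T)" for S
  proof -
    have "S \<subseteq> A - T" "card S = k - card T"
      using that by (auto simp: ksubsets_def)
    then show ?thesis
      using fT fin[of S] \<open>card T \<le> k\<close> by (subst card_Un_disjoint) auto
  qed
  then have "bij_betw (\<lambda>S. S - T) {S \<in> ksubsets A k. T \<subseteq> S} (ksubsets (A - T) (k - card T))"
    using assms fT
    by (intro bij_betw_byWitness[where f' = "\<lambda>S. S \<union> T"])
       (auto simp: ksubsets_def card_Diff_subset)
  then have "card {S \<in> ksubsets A k. T \<subseteq> S} = card (ksubsets (A - T) (k - card T))"
    by (rule bij_betw_same_card)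
  then show ?thesis
    using assms fT by (simp add: card_ksubsets card_Diff_subset)
qed

text \<open>Expanding the product over subsets T gives nonnegative coefficients, so only inclusion
  probabilities have to be compared, and these are at most those of independent selection with rate
  k / n. Exponential moments of a random k-set are thus dominated by independent ones.\<close>

lemma sum_prod_ksubsets_le:
  fixes x :: "'a \<Rightarrow> real"
  assumes "finite A" "A \<noteq> {}" "k \<le> card A" and x: "\<And>j. j \<in> A \<Longrightarrow> 0 \<le> x j"
  shows "(\<Sum>I\<in>ksubsets A k. \<Prod>j\<in>I. 1 + x j)
      \<le> real (card A choose k) * (\<Prod>j\<in>A. 1 + real k / real (card A) * x j)"
proof -
  let ?n = "card A"
  have "?n > 0" using assms by auto
  have fin: "finite I" if "I \<subseteq> A" for I using that assms finite_subset by auto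
  have xT: "0 \<le> (\<Prod>j\<in>T. x j)" if "T \<subseteq> A" for T
    using that x by (intro prod_nonneg) auto
  have "(\<Sum>I\<in>ksubsets A k. \<Prod>j\<in>I. 1 + x j) = (\<Sum>I\<in>ksubsets A k. \<Sum>T\<in>Pow I. \<Prod>j\<in>T. x j)"
  proof (rule sum.cong[OF refl])
    fix I assume "I \<in> ksubsets A k"
    then have "finite I" using fin by (auto simp: ksubsets_def)
    then show "(\<Prod>j\<in>I. 1 + x j) = (\<Sum>T\<in>Pow I. \<Prod>j\<in>T. x j)"
      using prod_add[of I x "\<lambda>_. 1"] by (simp add: add.commute)
  qed
  also have "\<dots> = (\<Sum>I\<in>ksubsets A k. \<Sum>T\<in>{T \<in> Pow A. T \<subseteq> I}. \<Prod>j\<in>T. x j)"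
    by (intro sum.cong) (auto simp: ksubsets_def)
  also have "\<dots> = (\<Sum>T\<in>Pow A. \<Sum>I\<in>{I \<in> ksubsets A k. T \<subseteq> I}. \<Prod>j\<in>T. x j)"
    using assms by (intro sum.swap_restrict) auto
  also have "\<dots> \<le> (\<Sum>T\<in>Pow A. real (?n choose k) * (real k / real ?n) ^ card T * (\<Prod>j\<in>T. x j))"
  proof (intro sum_mono)
    fix T assume "T \<in> Pow A"
    then have T: "T \<subseteq> A" by simp
    have "real (card {I \<in> ksubsets A k. T \<subseteq> I}) \<le> real (?n choose k) * (real k / real ?n) ^ card T"
    proof (cases "card T \<le> k")
      case True
      then show ?thesis
        using card_ksubsets_superset[OF \<open>finite A\<close> T True] binomial_diff_le[OF True] assms \<open>?n > 0\<close>
        by simp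
    next
      case False
      have "{I \<in> ksubsets A k. T \<subseteq> I} = {}"
      proof -
        have "card T \<le> k" if "I \<subseteq> A" "card I = k" "T \<subseteq> I" for I
          using card_mono[OF fin[OF that(1)] that(3)] that(2) by simp
        then show ?thesis
          using False by (auto simp: ksubsets_def)
      qed
      then show ?thesis by (simp only: card.empty) simp
    qed
    then show "(\<Sum>I\<in>{I \<in> ksubsets A k. T \<subseteq> I}. \<Prod>j\<in>T. x j)
        \<le> real (?n choose k) * (real k / real ?n) ^ card T * (\<Prod>j\<in>T. x j)"
      using xT[OF T] by (simp add: mult_right_mono)
  qed
  also have "\<dots> = real (?n choose k) * (\<Sum>T\<in>Pow A. \<Prod>j\<in>T. real k / real ?n * x j)"
    by (simp add: sum_distrib_left prod.distrib mult.assoc del: times_divide_eq_left)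
  also have "(\<Sum>T\<in>Pow A. \<Prod>j\<in>T. real k / real ?n * x j) = (\<Prod>j\<in>A. 1 + real k / real ?n * x j)"
    using prod_add[OF \<open>finite A\<close>, of "\<lambda>j. real k / real ?n * x j" "\<lambda>_. 1"] by (simp add: add.commute)
  finally show ?thesis .
qed

text \<open>Markov's inequality for the exponential moment with parameter ln R / \<alpha>, where the
  hypothesis on R says that t is at least R times the mean. The factor ln R in the exponent is the
  gain that later outweighs fixed constants.\<close>

lemma chernoff_ksubsets:
  fixes a :: "'a \<Rightarrow> real"
  assumes "finite A" "A \<noteq> {}" "k \<le> card A" "0 < \<alpha>" "0 < t" "1 \<le> R"
    and a: "\<And>j. j \<in> A \<Longrightarrow> 0 \<le> a j \<and> a j \<le> \<alpha>"
    and R: "R * (real k * (\<Sum>j\<in>A. a j)) \<le> t * real (card A)"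
  shows "real (card {I \<in> ksubsets A k. t \<le> (\<Sum>j\<in>I. a j)})
      \<le> real (card A choose k) * exp (- (t / \<alpha> * (ln R - 1)))"
proof -
  let ?n = "card A"
  let ?B = "{I \<in> ksubsets A k. t \<le> (\<Sum>j\<in>I. a j)}"
  define l where "l = ln R / \<alpha>"
  have "l \<ge> 0" using assms by (simp add: l_def)
  have "?n > 0" using assms by auto
  define x where "x = (\<lambda>j. a j / \<alpha> * (R - 1))"
  have x0: "0 \<le> x j" if "j \<in> A" for j
    using a[OF that] assms by (simp add: x_def)
  have ex: "exp (l * a j) \<le> 1 + x j" if "j \<in> A" for j
  proof -
    \<comment> \<open>On [0, \<alpha>] the convex function exp (l y) lies below its chord, which
      rises from 1 to R.\<close>
    have "exp ((1 - a j / \<alpha>) *\<^sub>R 0 + (a j / \<alpha>) *\<^sub>R ln R) \<le> (1 - a j / \<alpha>) * exp 0 + a j / \<alpha> * exp (ln R)"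
      using a[OF that] \<open>0 < \<alpha>\<close> by (intro convex_onD[OF exp_convex]) auto
    also have "\<dots> = 1 + x j"
      using \<open>1 \<le> R\<close> \<open>0 < \<alpha>\<close> by (simp add: x_def field_simps)
    finally show ?thesis
      by (simp add: l_def mult.commute)
  qed
  have "real (card ?B) * exp (l * t) = (\<Sum>I\<in>?B. exp (l * t))"
    by simp
  also have "\<dots> \<le> (\<Sum>I\<in>?B. exp (l * (\<Sum>j\<in>I. a j)))"
    using \<open>l \<ge> 0\<close> by (intro sum_mono) (auto intro: mult_left_mono)
  also have "\<dots> \<le> (\<Sum>I\<in>ksubsets A k. exp (l * (\<Sum>j\<in>I. a j)))"
    using assms by (intro sum_mono2) auto
  also have "\<dots> \<le> (\<Sum>I\<in>ksubsets A k. \<Prod>j\<in>I. 1 + x j)"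
  proof (intro sum_mono)
    fix I assume "I \<in> ksubsets A k"
    then have I: "I \<subseteq> A" "finite I" using finite_subset[OF _ \<open>finite A\<close>] by (auto simp: ksubsets_def)
    have "exp (l * (\<Sum>j\<in>I. a j)) = (\<Prod>j\<in>I. exp (l * a j))"
      using I by (simp add: sum_distrib_left exp_sum)
    also have "\<dots> \<le> (\<Prod>j\<in>I. 1 + x j)"
      using I ex by (intro prod_mono) auto
    finally show "exp (l * (\<Sum>j\<in>I. a j)) \<le> (\<Prod>j\<in>I. 1 + x j)" .
  qed
  also have "\<dots> \<le> real (?n choose k) * (\<Prod>j\<in>A. 1 + real k / real ?n * x j)"
    using assms x0 by (intro sum_prod_ksubsets_le) auto
  also have "\<dots> \<le> real (?n choose k) * exp (t / \<alpha>)"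
  proof (intro mult_left_mono)
    have "(\<Prod>j\<in>A. 1 + real k / real ?n * x j) \<le> (\<Prod>j\<in>A. exp (real k / real ?n * x j))"
      using x0 by (intro prod_mono) (auto intro!: add_nonneg_nonneg)
    also have "\<dots> = exp ((R - 1) / \<alpha> * (real k / real ?n * (\<Sum>j\<in>A. a j)))"
      using \<open>finite A\<close> by (simp add: exp_sum[symmetric] x_def sum_distrib_left sum_divide_distrib mult_ac)
    also have "\<dots> \<le> exp (t / \<alpha>)"
    proof -
      have "(R - 1) * (real k * (\<Sum>j\<in>A. a j)) \<le> R * (real k * (\<Sum>j\<in>A. a j))"
        using a by (intro mult_right_mono mult_nonneg_nonneg sum_nonneg) auto
      then have "(R - 1) * (real k * (\<Sum>j\<in>A. a j)) / real ?n \<le> t"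
        using R \<open>?n > 0\<close> by (simp add: divide_le_eq)
      then have "(R - 1) * (real k * (\<Sum>j\<in>A. a j)) / real ?n / \<alpha> \<le> t / \<alpha>"
        using \<open>0 < \<alpha>\<close> by (intro divide_right_mono) auto
      then show ?thesis
        by (simp add: mult_ac)
    qed
    finally show "(\<Prod>j\<in>A. 1 + real k / real ?n * x j) \<le> exp (t / \<alpha>)" .
  qed simp
  finally have "real (card ?B) * exp (l * t) * exp (- (l * t))
      \<le> real (?n choose k) * exp (t / \<alpha>) * exp (- (l * t))"
    by (intro mult_right_mono) auto
  also have "\<dots> = real (?n choose k) * exp (- (t / \<alpha> * (ln R - 1)))"
    by (simp add: l_def mult.assoc mult_exp_exp right_diff_distrib mult.commute)
  finally show ?thesis
    by (simp add: mult.assoc mult_exp_exp)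
qed

section \<open>Hoeffding's inequality for sign patterns\<close>

lemma exp_sum_le: "exp y + exp (- y) \<le> 2 * exp (y\<^sup>2 / 2)" for y :: real
proof (cases "y = 0")
  case False
  have *: "exp y + exp (- y) \<le> 2 * exp (y\<^sup>2 / 2)" if "y > 0" for y :: real
  proof -
    have eq: "1 + 1 / 2 * (exp (2 * y) - 1) = (1 + exp (2 * y)) / 2"
      by (simp add: field_simps)
    \<comment> \<open>Hoeffding's lemma for the values 0 and 2 y with equal weights; multiplying by
      exp (- y) recentres them at y and - y.\<close>
    have "ln ((1 + exp (2 * y)) / 2) \<le> y + y\<^sup>2 / 2"
      using Hoeffdings_lemma_aux[of "2 * y" "1 / 2"] that unfolding eq by (simp add: power2_eq_square)
    then have "exp (ln ((1 + exp (2 * y)) / 2)) \<le> exp (y + y\<^sup>2 / 2)"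
      by (simp only: exp_le_cancel_iff)
    moreover have "0 < (1 + exp (2 * y)) / 2"
      by (simp add: add_pos_pos)
    ultimately have "(1 + exp (2 * y)) / 2 \<le> exp y * exp (y\<^sup>2 / 2)"
      by (simp only: exp_ln exp_add)
    then have "(1 + exp (2 * y)) * exp (- y) \<le> (2 * (exp y * exp (y\<^sup>2 / 2))) * exp (- y)"
      by (intro mult_right_mono) auto
    then show ?thesis
      by (simp add: mult_exp_exp algebra_simps)
  qed
  show ?thesis
    using *[of y] *[of "- y"] False by (cases "y > 0") (simp_all add: add.commute)
qed simp

abbreviation sign_patterns :: "'a set \<Rightarrow> ('a \<Rightarrow> real) set" where
  "sign_patterns J \<equiv> J \<rightarrow>\<^sub>E {1, -1}"

lemma finite_sign_patterns [simp]: "finite J \<Longrightarrow> finite (sign_patterns J)"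
  by (rule finite_PiE) auto

text \<open>The exponential moment factors over the coordinates. The parameter 1 / v is the optimal
  one for threshold 1 and variance bound v.\<close>

lemma hoeffding_signs_upper:
  fixes c :: "'a \<Rightarrow> real"
  assumes "finite J" "0 < v" and v: "(\<Sum>i\<in>J. (c i)\<^sup>2) \<le> v"
  shows "real (card {\<sigma> \<in> sign_patterns J. 1 \<le> (\<Sum>i\<in>J. c i * \<sigma> i)}) \<le> 2 ^ card J * exp (- 1 / (2 * v))"
proof -
  let ?B = "{\<sigma> \<in> sign_patterns J. 1 \<le> (\<Sum>i\<in>J. c i * \<sigma> i)}"
  have "real (card ?B) * exp (1 / v) = (\<Sum>\<sigma>\<in>?B. exp (1 / v))"
    by simp
  also have "\<dots> \<le> (\<Sum>\<sigma>\<in>?B. exp (1 / v * (\<Sum>i\<in>J. c i * \<sigma> i)))"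
    using \<open>0 < v\<close> by (intro sum_mono) (auto simp: divide_right_mono)
  also have "\<dots> \<le> (\<Sum>\<sigma>\<in>sign_patterns J. exp (1 / v * (\<Sum>i\<in>J. c i * \<sigma> i)))"
    using \<open>finite J\<close> by (intro sum_mono2) auto
  also have "\<dots> = (\<Sum>\<sigma>\<in>sign_patterns J. \<Prod>i\<in>J. exp (c i / v * \<sigma> i))"
    using \<open>finite J\<close> by (simp add: sum_distrib_left exp_sum)
  also have "\<dots> = (\<Prod>i\<in>J. \<Sum>s\<in>{1, -1}. exp (c i / v * s))"
    using \<open>finite J\<close> by (intro prod_sum_PiE[symmetric]) auto
  also have "\<dots> \<le> (\<Prod>i\<in>J. 2 * exp ((c i / v)\<^sup>2 / 2))"
    using exp_sum_le by (intro prod_mono) (auto intro!: add_nonneg_nonneg)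
  also have "\<dots> = 2 ^ card J * exp ((\<Sum>i\<in>J. (c i)\<^sup>2) / (2 * v\<^sup>2))"
    using \<open>finite J\<close> by (simp add: prod.distrib exp_sum[symmetric] power_divide sum_divide_distrib mult.commute)
  also have "\<dots> \<le> 2 ^ card J * exp (v / (2 * v\<^sup>2))"
    using v by (intro mult_left_mono) (auto intro: divide_right_mono)
  finally have "real (card ?B) * exp (1 / v) * exp (- 1 / v)
      \<le> 2 ^ card J * exp (v / (2 * v\<^sup>2)) * exp (- 1 / v)"
    by (intro mult_right_mono) auto
  also have "\<dots> = 2 ^ card J * exp (- 1 / (2 * v))"
    using \<open>0 < v\<close> by (simp add: mult.assoc mult_exp_exp power2_eq_square field_simps)
  finally show ?thesis
    by (simp add: mult.assoc mult_exp_exp)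
qed

lemma hoeffding_signs:
  fixes c :: "'a \<Rightarrow> real"
  assumes "finite J" "0 < v" and v: "(\<Sum>i\<in>J. (c i)\<^sup>2) \<le> v"
  shows "real (card {\<sigma> \<in> sign_patterns J. 1 \<le> \<bar>\<Sum>i\<in>J. c i * \<sigma> i\<bar>})
      \<le> 2 * 2 ^ card J * exp (- 1 / (2 * v))"
proof -
  let ?B = "\<lambda>c. {\<sigma> \<in> sign_patterns J. 1 \<le> (\<Sum>i\<in>J. c i * \<sigma> i)}"
  have "{\<sigma> \<in> sign_patterns J. 1 \<le> \<bar>\<Sum>i\<in>J. c i * \<sigma> i\<bar>} \<subseteq> ?B c \<union> ?B (\<lambda>i. - c i)"
    by (auto simp: sum_negf abs_if split: if_splits)
  then have "card {\<sigma> \<in> sign_patterns J. 1 \<le> \<bar>\<Sum>i\<in>J. c i * \<sigma> i\<bar>} \<le> card (?B c \<union> ?B (\<lambda>i. - c i))"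
    using \<open>finite J\<close> by (intro card_mono) auto
  also have "\<dots> \<le> card (?B c) + card (?B (\<lambda>i. - c i))"
    by (rule card_Un_le)
  finally show ?thesis
    using hoeffding_signs_upper[OF assms] hoeffding_signs_upper[of J v "\<lambda>i. - c i"] assms by simp
qed

section \<open>Random principal submatrices\<close>

definition restr :: "'a set \<Rightarrow> ('a \<Rightarrow> real) \<Rightarrow> 'a \<Rightarrow> real" where
  "restr J v = (\<lambda>l. if l \<in> J then v l else 0)"

definition row_comb :: "(nat \<Rightarrow> nat \<Rightarrow> real) \<Rightarrow> nat set \<Rightarrow> (nat \<Rightarrow> real) \<Rightarrow> nat \<Rightarrow> real" where
  "row_comb H I u = (\<lambda>l. \<Sum>i\<in>I. u i * H i l)"

text \<open>The rows of H in I form a matrix with N columns, and c bounds its squared operator norm,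
  expressed through the transpose.\<close>

definition restricted_norm_le :: "nat \<Rightarrow> (nat \<Rightarrow> nat \<Rightarrow> real) \<Rightarrow> nat set \<Rightarrow> real \<Rightarrow> bool" where
  "restricted_norm_le N H I c \<longleftrightarrow>
     (\<forall>u. ip N (row_comb H I u) (row_comb H I u) \<le> c * (\<Sum>i\<in>I. (u i)\<^sup>2))"

lemma sum_if_mem:
  fixes f :: "'a \<Rightarrow> real"
  assumes "finite A" "J \<subseteq> A"
  shows "(\<Sum>l\<in>A. if l \<in> J then f l else 0) = (\<Sum>l\<in>J. f l)"
  using assms by (simp add: Int_absorb1 flip: sum.inter_restrict)

text \<open>The trial vector is the combination v of the rows itself: expanding one v in <v, v> and
  applying Cauchy-Schwarz bounds |v|^4 by |u|^2 times the form of the frame operator at v, so v has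
  a Rayleigh quotient of at least c.\<close>

lemma power_le_trace_if_large_comb:
  assumes "0 < c" and large: "c * (\<Sum>i\<in>I. (u i)\<^sup>2) < ip N (row_comb H I u) (row_comb H I u)"
  shows "c ^ p \<le> frame_trace N H I p"
proof -
  let ?v = "row_comb H I u" and ?U = "\<Sum>i\<in>I. (u i)\<^sup>2"
  let ?F = "ip N ?v (frame N H I ?v)"
  have "0 \<le> c * ?U" using \<open>0 < c\<close> by (simp add: sum_nonneg)
  then have pos: "0 < ip N ?v ?v" using large by linarith
  have F: "?F = (\<Sum>i\<in>I. (ip N (H i) ?v)\<^sup>2)"
    by (simp add: ip_frame power2_eq_square)
  have "ip N w ?v = (\<Sum>i\<in>I. u i * ip N w (H i))" for w
    unfolding row_comb_def by (rule ip_sum_right)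
  then have "ip N ?v ?v = (\<Sum>i\<in>I. u i * ip N (H i) ?v)"
    by (simp add: ip_commute[of N ?v])
  then have "(ip N ?v ?v)\<^sup>2 \<le> ?U * ?F"
    unfolding F using Cauchy_Schwarz_ineq_sum[of u "\<lambda>i. ip N (H i) ?v" I] by simp
  then have "c * (ip N ?v ?v)\<^sup>2 \<le> (c * ?U) * ?F"
    using \<open>0 < c\<close> by simp
  also have "\<dots> \<le> ip N ?v ?v * ?F"
    using large by (intro mult_right_mono) (auto simp: F sum_nonneg)
  finally have "ip N ?v ?v * (c * ip N ?v ?v) \<le> ip N ?v ?v * ?F"
    by (simp add: power2_eq_square mult_ac)
  then have "c * ip N ?v ?v \<le> ?F"
    by (rule mult_left_le_imp_le[OF _ pos])
  then show ?thesis
    using moment_power_le_trace[OF \<open>0 < c\<close> _ pos] by blast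
qed

text \<open>Markov's inequality for the trace moment: each exceptional I contributes at least c^p to
  the sum of traces.\<close>

lemma card_not_restricted_norm_le:
  assumes "0 < \<beta>" "0 \<le> \<Lambda>" "k \<le> N" "0 < c" "3 \<le> p"
    and \<beta>: "\<And>i. i < N \<Longrightarrow> ip N (H i) (H i) \<le> \<beta>"
    and \<Lambda>: "\<And>v. (\<Sum>i<N. (ip N (H i) v)\<^sup>2) \<le> \<Lambda> * ip N v v"
    and z1: "exp 1 * \<Lambda> * real k \<le> z * (real N + 1 - real k)"
    and z2: "real p * \<beta> \<le> z"
  shows "real (card {I \<in> ksubsets {..<N} k. \<not> restricted_norm_le N H I c}) * c ^ p
      \<le> real (N choose k) * (real N + real k * real p) * z ^ p"
proof -
  let ?B = "{I \<in> ksubsets {..<N} k. \<not> restricted_norm_le N H I c}"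
  have "real (card ?B) * c ^ p = (\<Sum>I\<in>?B. c ^ p)"
    by simp
  also have "\<dots> \<le> (\<Sum>I\<in>?B. frame_trace N H I p)"
    using \<open>0 < c\<close>
    by (intro sum_mono) (auto simp: restricted_norm_le_def not_le intro: power_le_trace_if_large_comb)
  also have "\<dots> \<le> (\<Sum>I\<in>ksubsets {..<N} k. frame_trace N H I p)"
    by (intro sum_mono2) (auto simp: frame_trace_nonneg)
  also have "\<dots> \<le> real (N choose k) * (real N + real k * real p) * z ^ p"
    using sum_frame_trace_ksubsets[of "{..<N}" \<beta> \<Lambda> N H k z p p] assms by simp
  finally show ?thesis .
qed

section \<open>Decoupling of quadratic forms\<close>

lemma sum_split_pairs:
  fixes x :: "'a \<Rightarrow> 'a \<Rightarrow> real"
  assumes "finite I" and diag: "\<And>i. i \<in> I \<Longrightarrow> x i i = 0"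
  shows "(\<Sum>S\<in>Pow I. \<Sum>i\<in>S. \<Sum>j\<in>I - S. x i j) = 2 ^ card I / 4 * (\<Sum>i\<in>I. \<Sum>j\<in>I. x i j)"
proof -
  \<comment> \<open>Exactly a quarter of the subsets of I contain i and avoid j; this is the origin
    of the factor 4 in the decoupling.\<close>
  have count: "4 * real (card {S \<in> Pow I. i \<in> S \<and> j \<notin> S}) = 2 ^ card I"
    if ij: "i \<in> I" "j \<in> I" "i \<noteq> j" for i j
  proof -
    have "bij_betw (insert i) (Pow (I - {i, j})) {S \<in> Pow I. i \<in> S \<and> j \<notin> S}"
      using ij by (intro bij_betw_byWitness[where f' = "\<lambda>S. S - {i}"]) auto
    then have "card {S \<in> Pow I. i \<in> S \<and> j \<notin> S} = 2 ^ card (I - {i, j})"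
      using bij_betw_same_card[of "insert i"] \<open>finite I\<close> by (fastforce simp: card_Pow)
    moreover have "card {i, j} \<le> card I"
      using ij \<open>finite I\<close> by (intro card_mono) auto
    then have "card I = Suc (Suc (card (I - {i, j})))"
      using ij card_Diff_subset[of "{i, j}" I] by simp
    ultimately show ?thesis by simp
  qed
  have "(\<Sum>S\<in>Pow I. \<Sum>i\<in>S. \<Sum>j\<in>I - S. x i j)
      = (\<Sum>S\<in>Pow I. \<Sum>(i, j)\<in>{(i, j) \<in> I \<times> I. i \<in> S \<and> j \<notin> S}. x i j)"
  proof (rule sum.cong[OF refl])
    fix S assume "S \<in> Pow I"
    then have "{(i, j) \<in> I \<times> I. i \<in> S \<and> j \<notin> S} = S \<times> (I - S)" "finite S"
      using \<open>finite I\<close> finite_subset by auto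
    then show "(\<Sum>i\<in>S. \<Sum>j\<in>I - S. x i j) = (\<Sum>(i, j)\<in>{(i, j) \<in> I \<times> I. i \<in> S \<and> j \<notin> S}. x i j)"
      using \<open>finite I\<close> by (simp add: sum.cartesian_product)
  qed
  also have "\<dots> = (\<Sum>S\<in>Pow I. \<Sum>q\<in>{q \<in> I \<times> I. fst q \<in> S \<and> snd q \<notin> S}. x (fst q) (snd q))"
    by (intro sum.cong) (auto simp: case_prod_unfold)
  also have "\<dots> = (\<Sum>q\<in>I \<times> I. \<Sum>S\<in>{S \<in> Pow I. fst q \<in> S \<and> snd q \<notin> S}. x (fst q) (snd q))"
    using \<open>finite I\<close> by (intro sum.swap_restrict) auto
  also have "\<dots> = (\<Sum>q\<in>I \<times> I. 2 ^ card I / 4 * x (fst q) (snd q))"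
  proof (rule sum.cong[OF refl])
    fix q assume "q \<in> I \<times> I"
    then obtain i j where q: "q = (i, j)" "i \<in> I" "j \<in> I" by auto
    show "(\<Sum>S\<in>{S \<in> Pow I. fst q \<in> S \<and> snd q \<notin> S}. x (fst q) (snd q))
        = 2 ^ card I / 4 * x (fst q) (snd q)"
      using count[OF q(2,3)] diag q by (cases "i = j") auto
  qed
  also have "\<dots> = 2 ^ card I / 4 * (\<Sum>i\<in>I. \<Sum>j\<in>I. x i j)"
    by (simp add: sum.cartesian_product case_prod_unfold sum_distrib_left)
  finally show ?thesis .
qed

text \<open>For the bilinear form a, Cauchy-Schwarz gives a^2 \<le> |u|^2 F, where F is the form at
  \<open>restr (I - S) u\<close> of the frame operator of the rows in S cut to the columns I - S. So
  its Rayleigh quotient there is at least (a / |u|^2)^2, and the p-th trace controls the power 2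
  p.\<close>

lemma bilinear_power_le_trace:
  assumes "finite I" "S \<subseteq> I" "I \<subseteq> {..<N}" "0 < p" and U: "0 < (\<Sum>i\<in>I. (u i)\<^sup>2)"
  shows "((\<Sum>i\<in>S. \<Sum>j\<in>I - S. u i * H i j * u j) / (\<Sum>i\<in>I. (u i)\<^sup>2)) ^ (2 * p)
      \<le> frame_trace N (\<lambda>i. restr (I - S) (H i)) S p"
proof -
  let ?J = "I - S" and ?U = "\<Sum>i\<in>I. (u i)\<^sup>2"
  let ?b = "\<lambda>i. restr ?J (H i)"
  let ?w = "restr ?J u"
  let ?F = "ip N ?w (frame N ?b S ?w)"
  define a where "a = (\<Sum>i\<in>S. \<Sum>j\<in>?J. u i * H i j * u j)"
  have J: "?J \<subseteq> {..<N}" "finite ?J" using assms by auto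
  have F: "?F = (\<Sum>i\<in>S. (ip N (?b i) ?w)\<^sup>2)"
    by (simp add: ip_frame power2_eq_square)
  have restr_sum: "(\<Sum>l<N. if l \<in> ?J then f l else 0) = (\<Sum>l\<in>?J. f l)" for f :: "nat \<Rightarrow> real"
    by (rule sum_if_mem[OF finite_lessThan J(1)])
  have ipb: "ip N (?b i) ?w = (\<Sum>j\<in>?J. H i j * u j)" for i
    unfolding restr_sum[symmetric] by (auto simp: ip_def restr_def intro!: sum.cong)
  have "ip N ?w ?w = (\<Sum>j\<in>?J. (u j)\<^sup>2)"
    unfolding restr_sum[symmetric] by (auto simp: ip_def restr_def power2_eq_square intro!: sum.cong)
  also have "\<dots> \<le> ?U"
    using assms by (intro sum_mono2) auto
  finally have wU: "ip N ?w ?w \<le> ?U" .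
  have "a = (\<Sum>i\<in>S. u i * ip N (?b i) ?w)"
    by (simp add: a_def ipb sum_distrib_left mult.assoc)
  then have "a\<^sup>2 \<le> (\<Sum>i\<in>S. (u i)\<^sup>2) * ?F"
    unfolding F using Cauchy_Schwarz_ineq_sum[of u "\<lambda>i. ip N (?b i) ?w" S] by simp
  also have "\<dots> \<le> ?U * ?F"
    unfolding F using assms by (intro mult_right_mono sum_mono2) (auto simp: sum_nonneg)
  finally have a2: "a\<^sup>2 \<le> ?U * ?F" .
  have "((a / ?U)\<^sup>2) ^ p \<le> frame_trace N ?b S p"
  proof (cases "a = 0")
    case True
    then show ?thesis using \<open>0 < p\<close> by (simp add: frame_trace_nonneg zero_power)
  next
    case False
    have "ip N ?w ?w \<noteq> 0"
    proof
      assume "ip N ?w ?w = 0"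
      then have "ip N (?b i) ?w = 0" for i
        using ip_cauchy_schwarz[of N "?b i" ?w] by simp
      then show False
        using a2 False by (simp add: F)
    qed
    then have "0 < ip N ?w ?w"
      using ip_nonneg[of N ?w] by linarith
    moreover have "(a / ?U)\<^sup>2 * ip N ?w ?w \<le> ?F"
    proof -
      have "(a / ?U)\<^sup>2 * ip N ?w ?w \<le> (a / ?U)\<^sup>2 * ?U"
        using wU by (intro mult_left_mono) auto
      also have "\<dots> = a\<^sup>2 / ?U"
        using U by (simp add: power2_eq_square)
      also have "\<dots> \<le> ?F"
        using a2 U by (simp add: divide_le_eq mult.commute)
      finally show ?thesis .
    qed
    ultimately show ?thesis
      using False U by (intro moment_power_le_trace) auto
  qed
  then show ?thesis
    by (simp add: a_def power_mult)
qed

text \<open>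
  A quadratic form is four times the average of its bilinear pieces over all splittings of the
  index set, so Jensen's inequality passes from a large negative value to large traces.
\<close>

lemma decoupled_trace_lower:
  assumes "finite I" "I \<subseteq> {..<N}" "0 < p" "0 < \<theta>"
    and diag: "\<And>i. i \<in> I \<Longrightarrow> H i i = 0"
    and neg: "(\<Sum>i\<in>I. \<Sum>j\<in>I. u i * H i j * u j) < - \<theta> * (\<Sum>i\<in>I. (u i)\<^sup>2)"
  shows "2 ^ card I * (\<theta> / 4) ^ (2 * p)
      \<le> (\<Sum>S\<in>Pow I. frame_trace N (\<lambda>i. restr (I - S) (H i)) S p)"
proof -
  let ?U = "\<Sum>i\<in>I. (u i)\<^sup>2"
  \<comment> \<open>The sign is reversed so that the average of \<open>a S\<close> over all S is at
    least \<theta> / 4.\<close>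
  define a where "a = (\<lambda>S. - 1 / ?U * (\<Sum>i\<in>S. \<Sum>j\<in>I - S. u i * H i j * u j))"
  have "?U \<noteq> 0"
  proof
    assume "?U = 0"
    then have "\<forall>i\<in>I. u i = 0"
      using \<open>finite I\<close> by (simp add: sum_nonneg_eq_0_iff)
    then show False using neg by simp
  qed
  then have U: "0 < ?U"
    by (simp add: order.not_eq_order_implies_strict sum_nonneg)
  have fin: "finite (Pow I)" using assms by simp
  have "(\<Sum>S\<in>Pow I. a S) = - 1 / ?U * (2 ^ card I / 4 * (\<Sum>i\<in>I. \<Sum>j\<in>I. u i * H i j * u j))"
    unfolding a_def sum_distrib_left[symmetric] using assms by (subst sum_split_pairs) auto
  also have "\<dots> = 2 ^ card I / 4 * (- (\<Sum>i\<in>I. \<Sum>j\<in>I. u i * H i j * u j) / ?U)"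
    by simp
  also have "\<dots> \<ge> 2 ^ card I / 4 * \<theta>"
  proof (rule mult_left_mono)
    show "\<theta> \<le> - (\<Sum>i\<in>I. \<Sum>j\<in>I. u i * H i j * u j) / ?U"
      using neg by (subst pos_le_divide_eq[OF U]) simp
  qed simp
  finally have avg: "2 ^ card I * (\<theta> / 4) \<le> (\<Sum>S\<in>Pow I. a S)"
    by simp
  let ?t = "\<theta> / 4"
  \<comment> \<open>The tangent line of x^(2 p) at \<theta> / 4. The even exponent makes Bernoulli's
    inequality valid also where \<open>a S\<close> is negative.\<close>
  have "?t ^ (2 * p) * (1 + real (2 * p) * (a S / ?t - 1)) \<le> a S ^ (2 * p)" for S
  proof -
    have "1 + real (2 * p) * (a S / ?t - 1) \<le> (1 + (a S / ?t - 1)) ^ (2 * p)"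
      by (rule Bernoulli_inequality_even) simp
    then have "?t ^ (2 * p) * (1 + real (2 * p) * (a S / ?t - 1)) \<le> ?t ^ (2 * p) * (a S / ?t) ^ (2 * p)"
      by (intro mult_left_mono) auto
    also have "\<dots> = a S ^ (2 * p)"
      using \<open>0 < \<theta>\<close> by (simp flip: power_mult_distrib)
    finally show ?thesis .
  qed
  then have "(\<Sum>S\<in>Pow I. ?t ^ (2 * p) * (1 + real (2 * p) * (a S / ?t - 1))) \<le> (\<Sum>S\<in>Pow I. a S ^ (2 * p))"
    by (intro sum_mono)
  also have "\<dots> \<le> (\<Sum>S\<in>Pow I. frame_trace N (\<lambda>i. restr (I - S) (H i)) S p)"
    using bilinear_power_le_trace[of I _ N p u H] assms U
    by (intro sum_mono) (auto simp: a_def power_minus_even)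
  finally have "(\<Sum>S\<in>Pow I. ?t ^ (2 * p) * (1 + real (2 * p) * (a S / ?t - 1)))
      \<le> (\<Sum>S\<in>Pow I. frame_trace N (\<lambda>i. restr (I - S) (H i)) S p)" .
  moreover have "(\<Sum>S\<in>Pow I. ?t ^ (2 * p) * (1 + real (2 * p) * (a S / ?t - 1)))
      = ?t ^ (2 * p) * (2 ^ card I + real (2 * p) * ((\<Sum>S\<in>Pow I. a S) / ?t - 2 ^ card I))"
  proof -
    have "(\<Sum>S\<in>Pow I. a S / t - 1) = (\<Sum>S\<in>Pow I. a S) / t - 2 ^ card I" for t
      using \<open>finite I\<close> by (simp add: sum_subtractf card_Pow sum_divide_distrib)
    moreover have "(\<Sum>S\<in>Pow I. (1::real)) = 2 ^ card I"
      using \<open>finite I\<close> by (simp add: card_Pow)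
    ultimately show ?thesis
      by (simp only: sum_distrib_left[symmetric] sum.distrib)
  qed
  moreover have "2 ^ card I + real (2 * p) * ((\<Sum>S\<in>Pow I. a S) / ?t - 2 ^ card I) \<ge> 2 ^ card I"
    using avg \<open>0 < \<theta>\<close> by (simp add: le_divide_eq)
  then have "?t ^ (2 * p) * (2 ^ card I + real (2 * p) * ((\<Sum>S\<in>Pow I. a S) / ?t - 2 ^ card I))
      \<ge> ?t ^ (2 * p) * 2 ^ card I"
    by (intro mult_left_mono) auto
  ultimately show ?thesis
    by (simp add: mult.commute)
qed

text \<open>A k-set I with a marked part S is a set J = I - S together with an S of the
  complementary size outside J. With J fixed, S runs over all sets of its size disjoint from J: this
  is the independence that decoupling gains.\<close>

lemma sum_ksubsets_split:
  fixes F :: "'a set \<Rightarrow> 'a set \<Rightarrow> real"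
  assumes "finite A"
  shows "(\<Sum>I\<in>ksubsets A k. \<Sum>S\<in>Pow I. F S (I - S))
      = (\<Sum>J\<in>{J \<in> Pow A. card J \<le> k}. \<Sum>S\<in>ksubsets (A - J) (k - card J). F S J)"
proof -
  have fin: "finite S" if "S \<subseteq> A" for S
    using that assms finite_subset by auto
  have c1: "card (S \<union> J) = k" if "J \<subseteq> A" "S \<subseteq> A - J" "card J \<le> k" "card S = k - card J" for S J
    using that fin[of J] fin[of S] by (subst card_Un_disjoint) auto
  have c2: "card (I - S) \<le> card I" "card S = card I - card (I - S)" if "I \<subseteq> A" "S \<subseteq> I" for I S
    using that fin[of I] fin[of S] card_mono[of I S] by (auto simp: card_Diff_subset card_mono)
  have "(\<Sum>I\<in>ksubsets A k. \<Sum>S\<in>Pow I. F S (I - S))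
      = (\<Sum>(I, S)\<in>Sigma (ksubsets A k) Pow. F S (I - S))"
    using assms fin by (intro sum.Sigma) (auto simp: ksubsets_def)
  also have "\<dots> = (\<Sum>(J, S)\<in>(SIGMA J:{J \<in> Pow A. card J \<le> k}. ksubsets (A - J) (k - card J)). F S J)"
    by (intro sum.reindex_bij_witness[where i = "\<lambda>(J, S). (S \<union> J, S)" and j = "\<lambda>(I, S). (I - S, S)"])
       (auto simp: ksubsets_def intro: c1 c2)
  also have "\<dots> = (\<Sum>J\<in>{J \<in> Pow A. card J \<le> k}. \<Sum>S\<in>ksubsets (A - J) (k - card J). F S J)"
    using assms by (intro sum.Sigma[symmetric]) auto
  finally show ?thesis .
qed

text \<open>All N rows are included, not only those in I: rows outside I enter the certificate, and
  in the decoupled sum the vectors are rows outside J cut to J.\<close>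

definition rows_small :: "nat \<Rightarrow> (nat \<Rightarrow> nat \<Rightarrow> real) \<Rightarrow> nat set \<Rightarrow> real \<Rightarrow> bool" where
  "rows_small N H I \<beta> \<longleftrightarrow> (\<forall>i<N. (\<Sum>l\<in>I. (H i l)\<^sup>2) \<le> \<beta>)"

lemma rows_small_subset:
  assumes "rows_small N H I \<beta>" "J \<subseteq> I" "finite I"
  shows "rows_small N H J \<beta>"
  using assms sum_mono2[OF \<open>finite I\<close> \<open>J \<subseteq> I\<close>] unfolding rows_small_def
  by (meson order_trans zero_le_power2)

lemma restricted_norm_le_subset:
  assumes "restricted_norm_le N H I c" "J \<subseteq> I" "finite I"
  shows "restricted_norm_le N H J c"
  unfolding restricted_norm_le_def
proof
  fix u
  have "(\<Sum>i\<in>I. restr J u i * H i l) = (\<Sum>i\<in>J. u i * H i l)" for l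
    unfolding sum_if_mem[OF assms(3,2), symmetric] by (intro sum.cong) (auto simp: restr_def)
  then have "row_comb H I (restr J u) = row_comb H J u"
    by (simp add: row_comb_def)
  moreover have "(\<Sum>i\<in>I. (restr J u i)\<^sup>2) = (\<Sum>i\<in>J. (u i)\<^sup>2)"
    unfolding sum_if_mem[OF assms(3,2), symmetric] by (intro sum.cong) (auto simp: restr_def)
  ultimately show "ip N (row_comb H J u) (row_comb H J u) \<le> c * (\<Sum>i\<in>J. (u i)\<^sup>2)"
    using assms(1) unfolding restricted_norm_le_def by metis
qed

text \<open>With J fixed, the vectors b_i are the rows of H cut to J. \<open>rows_small\<close>
  bounds their lengths. By symmetry of H the numbers <b_i, v> are the entries of the row combination
  over J with coefficients v, so \<open>restricted_norm_le\<close> bounds the sum of the b_i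
  b_i^T.\<close>

lemma sum_trace_complement:
  assumes sym: "\<And>i j. i < N \<Longrightarrow> j < N \<Longrightarrow> H i j = H j i"
    and J: "J \<subseteq> {..<N}" "card J \<le> k" "k \<le> N"
    and good: "rows_small N H J \<beta>" "restricted_norm_le N H J \<Lambda>"
    and "0 < \<beta>" "0 \<le> \<Lambda>" "3 \<le> p"
    and z1: "exp 1 * \<Lambda> * real k \<le> z * (real N + 1 - real k)"
    and z2: "real p * \<beta> \<le> z"
  shows "(\<Sum>S\<in>ksubsets ({..<N} - J) (k - card J). frame_trace N (\<lambda>i. restr J (H i)) S p)
      \<le> real (card (ksubsets ({..<N} - J) (k - card J))) * ((real N + real k * real p) * z ^ p)"
proof -
  let ?A = "{..<N} - J" and ?a = "k - card J" and ?b = "\<lambda>i. restr J (H i)"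
  have fJ: "finite J" using J finite_subset by auto
  have cA: "card ?A = N - card J"
    using J fJ by (simp add: card_Diff_subset)
  have restr_sum: "(\<Sum>l<N. if l \<in> J then f l else 0) = (\<Sum>l\<in>J. f l)" for f :: "nat \<Rightarrow> real"
    by (rule sum_if_mem[OF finite_lessThan J(1)])
  have "0 < z"
    using z2 \<open>0 < \<beta>\<close> \<open>3 \<le> p\<close> by (smt (verit) mult_pos_pos of_nat_0_less_iff not_numeral_le_zero neq0_conv)
  have "(\<Sum>S\<in>ksubsets ?A ?a. frame_trace N ?b S p)
      \<le> real (card ?A choose ?a) * (real N + real ?a * real p) * z ^ p"
  proof (rule sum_frame_trace_ksubsets[where \<beta> = \<beta> and \<Lambda> = \<Lambda> and P = p])
    fix i assume "i \<in> ?A"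
    have "ip N (?b i) (?b i) = (\<Sum>l\<in>J. (H i l)\<^sup>2)"
      unfolding restr_sum[symmetric] by (auto simp: ip_def restr_def power2_eq_square intro!: sum.cong)
    then show "ip N (?b i) (?b i) \<le> \<beta>"
      using good \<open>i \<in> ?A\<close> by (simp add: rows_small_def)
  next
    fix v
    have eq: "ip N (?b i) v = row_comb H J v i" if "i < N" for i
      unfolding row_comb_def restr_sum[symmetric] using sym[OF _ that]
      by (auto simp: ip_def restr_def intro!: sum.cong)
    have "(\<Sum>i\<in>?A. (ip N (?b i) v)\<^sup>2) \<le> (\<Sum>i<N. (ip N (?b i) v)\<^sup>2)"
      by (intro sum_mono2) auto
    also have "\<dots> = ip N (row_comb H J v) (row_comb H J v)"
      unfolding ip_def[of N "row_comb H J v"] by (intro sum.cong) (auto simp: eq power2_eq_square)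
    also have "\<dots> \<le> \<Lambda> * (\<Sum>i\<in>J. (v i)\<^sup>2)"
      using good by (simp add: restricted_norm_le_def)
    also have "\<dots> \<le> \<Lambda> * ip N v v"
      using J \<open>0 \<le> \<Lambda>\<close> by (auto simp: ip_def power2_eq_square intro!: mult_left_mono sum_mono2)
    finally show "(\<Sum>i\<in>?A. (ip N (?b i) v)\<^sup>2) \<le> \<Lambda> * ip N v v" .
  next
    have "exp 1 * \<Lambda> * real ?a \<le> exp 1 * \<Lambda> * real k"
      using \<open>0 \<le> \<Lambda>\<close> by (intro mult_left_mono) auto
    also note z1
    also have "real N + 1 - real k = real (card ?A) + 1 - real ?a"
      using J cA by (simp add: of_nat_diff)
    finally show "exp 1 * \<Lambda> * real ?a \<le> z * (real (card ?A) + 1 - real ?a)" .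
  qed (use assms cA in auto)
  also have "\<dots> \<le> real (card ?A choose ?a) * (real N + real k * real p) * z ^ p"
    using \<open>0 < z\<close> by (intro mult_right_mono mult_left_mono add_left_mono) auto
  finally show ?thesis
    by (simp add: card_ksubsets mult.assoc)
qed

lemma card_not_coercive:
  assumes sym: "\<And>i j. i < N \<Longrightarrow> j < N \<Longrightarrow> H i j = H j i"
    and diag: "\<And>i. i < N \<Longrightarrow> H i i = 0"
    and "k \<le> N" "0 < \<beta>" "0 \<le> \<Lambda>" "3 \<le> p" "0 < \<theta>"
    and z1: "exp 1 * \<Lambda> * real k \<le> z * (real N + 1 - real k)"
    and z2: "real p * \<beta> \<le> z"
  shows "real (card {I \<in> ksubsets {..<N} k. rows_small N H I \<beta> \<and> restricted_norm_le N H I \<Lambda> \<and>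
             (\<exists>u. (\<Sum>i\<in>I. \<Sum>j\<in>I. u i * H i j * u j) < - \<theta> * (\<Sum>i\<in>I. (u i)\<^sup>2))})
         * (\<theta> / 4) ^ (2 * p)
      \<le> real (N choose k) * (real N + real k * real p) * z ^ p"
proof -
  let ?good = "\<lambda>J. rows_small N H J \<beta> \<and> restricted_norm_le N H J \<Lambda>"
  let ?B = "{I \<in> ksubsets {..<N} k. rows_small N H I \<beta> \<and> restricted_norm_le N H I \<Lambda> \<and>
             (\<exists>u. (\<Sum>i\<in>I. \<Sum>j\<in>I. u i * H i j * u j) < - \<theta> * (\<Sum>i\<in>I. (u i)\<^sup>2))}"
  \<comment> \<open>Traces over a bad J count as 0. Both properties in \<open>?good\<close> pass
    from I to J = I - S, so nothing is lost on the supports to be counted; afterwards the sum may be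
    extended to all I, and every remaining J admits the trace bound.\<close>
  define tr where "tr = (\<lambda>S J. if ?good J then frame_trace N (\<lambda>i. restr J (H i)) S p else 0)"
  let ?C = "(real N + real k * real p) * z ^ p"
  have "0 < z"
    using z2 \<open>0 < \<beta>\<close> \<open>3 \<le> p\<close> by (smt (verit) mult_pos_pos of_nat_0_less_iff not_numeral_le_zero neq0_conv)
  have "real (card ?B) * (2 ^ k * (\<theta> / 4) ^ (2 * p)) = (\<Sum>I\<in>?B. 2 ^ k * (\<theta> / 4) ^ (2 * p))"
    by simp
  also have "\<dots> \<le> (\<Sum>I\<in>?B. \<Sum>S\<in>Pow I. tr S (I - S))"
  proof (rule sum_mono)
    fix I assume I: "I \<in> ?B"
    then have "I \<subseteq> {..<N}" "card I = k" "finite I"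
      using finite_subset by (auto simp: ksubsets_def)
    moreover obtain u where "(\<Sum>i\<in>I. \<Sum>j\<in>I. u i * H i j * u j) < - \<theta> * (\<Sum>i\<in>I. (u i)\<^sup>2)"
      using I by auto
    ultimately have "2 ^ k * (\<theta> / 4) ^ (2 * p) \<le> (\<Sum>S\<in>Pow I. frame_trace N (\<lambda>i. restr (I - S) (H i)) S p)"
      using decoupled_trace_lower[of I N p \<theta> H u] diag assms by auto
    also have "\<dots> = (\<Sum>S\<in>Pow I. tr S (I - S))"
      using I \<open>finite I\<close> rows_small_subset[of N H I \<beta>] restricted_norm_le_subset[of N H I \<Lambda>]
      by (intro sum.cong) (auto simp: tr_def)
    finally show "2 ^ k * (\<theta> / 4) ^ (2 * p) \<le> (\<Sum>S\<in>Pow I. tr S (I - S))" .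
  qed
  also have "\<dots> \<le> (\<Sum>I\<in>ksubsets {..<N} k. \<Sum>S\<in>Pow I. tr S (I - S))"
    by (intro sum_mono2) (auto simp: tr_def frame_trace_nonneg intro!: sum_nonneg)
  also have "\<dots> = (\<Sum>J\<in>{J \<in> Pow {..<N}. card J \<le> k}. \<Sum>S\<in>ksubsets ({..<N} - J) (k - card J). tr S J)"
    by (rule sum_ksubsets_split) simp
  also have "\<dots> \<le> (\<Sum>J\<in>{J \<in> Pow {..<N}. card J \<le> k}. \<Sum>S\<in>ksubsets ({..<N} - J) (k - card J). ?C)"
  proof (rule sum_mono)
    fix J assume J: "J \<in> {J \<in> Pow {..<N}. card J \<le> k}"
    show "(\<Sum>S\<in>ksubsets ({..<N} - J) (k - card J). tr S J) \<le> (\<Sum>S\<in>ksubsets ({..<N} - J) (k - card J). ?C)"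
    proof (cases "?good J")
      case True
      then show ?thesis
        using sum_trace_complement[of N H J k \<beta> \<Lambda> p z] sym J assms by (simp add: tr_def)
    next
      case False
      then have "tr S J = 0" for S
        by (auto simp: tr_def)
      then show ?thesis
        using \<open>0 < z\<close> by simp
    qed
  qed
  \<comment> \<open>The same reindexing read backwards, now only to count the pairs (J, S).\<close>
  also have "\<dots> = (\<Sum>I\<in>ksubsets {..<N} k. \<Sum>S\<in>Pow I. ?C)"
    by (rule sum_ksubsets_split[symmetric]) simp
  also have "\<dots> = 2 ^ k * (real (N choose k) * ?C)"
  proof -
    have "(\<Sum>I\<in>ksubsets {..<N} k. \<Sum>S\<in>Pow I. ?C) = (\<Sum>I\<in>ksubsets {..<N} k. 2 ^ k * ?C)"
      by (intro sum.cong) (auto simp: ksubsets_def card_Pow finite_subset[OF _ finite_lessThan])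
    then show ?thesis
      by (simp add: card_ksubsets)
  qed
  finally have "2 ^ k * (real (card ?B) * (\<theta> / 4) ^ (2 * p)) \<le> 2 ^ k * (real (N choose k) * ?C)"
    by (simp only: mult_ac)
  then show ?thesis
    by (simp add: mult.assoc)
qed

section \<open>The regularized Gram matrix\<close>

text \<open>An enumeration of I turns A into an actual matrix. Coercivity makes its kernel trivial,
  hence its determinant nonzero.\<close>

lemma coercive_solve:
  fixes A :: "'a \<Rightarrow> 'a \<Rightarrow> real"
  assumes "finite I" "0 < c"
    and coercive: "\<And>u. c * (\<Sum>i\<in>I. (u i)\<^sup>2) \<le> (\<Sum>i\<in>I. \<Sum>j\<in>I. u i * A i j * u j)"
  shows "\<exists>x. \<forall>i\<in>I. (\<Sum>j\<in>I. A i j * x j) = r i"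
proof -
  obtain h where h: "bij_betw h {0..<card I} I"
    using ex_bij_betw_nat_finite[OF \<open>finite I\<close>] by blast
  define g where "g = the_inv_into {0..<card I} h"
  have gh: "g (h a) = a" if "a < card I" for a
    using that h by (simp add: g_def bij_betw_def the_inv_into_f_f)
  define n where "n = card I"
  define M where "M = mat n n (\<lambda>(a, b). A (h a) (h b))"
  have M: "M \<in> carrier_mat n n" by (simp add: M_def)
  have reindex: "(\<Sum>j\<in>I. f j) = (\<Sum>b<n. f (h b))" for f :: "'a \<Rightarrow> real"
    using sum.reindex_bij_betw[OF h, of f] by (simp add: n_def lessThan_atLeast0)
  have Mv: "vec_index (M *\<^sub>v v) a = (\<Sum>b<n. A (h a) (h b) * vec_index v b)" if "v \<in> carrier_vec n" "a < n" for v a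
    using that by (simp add: M_def scalar_prod_def lessThan_atLeast0)
  have "det M \<noteq> 0"
  proof
    assume "det M = 0"
    then obtain v where v: "v \<in> carrier_vec n" "v \<noteq> 0\<^sub>v n" "M *\<^sub>v v = 0\<^sub>v n"
      using det_0_iff_vec_prod_zero_field[OF M] by auto
    define u where "u = (\<lambda>i. vec_index v (g i))"
    have u: "u (h b) = vec_index v b" if "b < n" for b
      using gh that by (simp add: u_def n_def)
    have "(\<Sum>j\<in>I. A (h a) j * u j) = 0" if "a < n" for a
      using Mv[OF v(1) that] v(3) that by (simp add: reindex u)
    then have "(\<Sum>i\<in>I. u i * (\<Sum>j\<in>I. A i j * u j)) = 0"
      unfolding reindex[of "\<lambda>i. u i * _ i"] by simp
    then have "c * (\<Sum>i\<in>I. (u i)\<^sup>2) \<le> 0"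
      using coercive[of u] by (simp add: sum_distrib_left mult.assoc)
    then have "(\<Sum>i\<in>I. (u i)\<^sup>2) = 0"
      using \<open>0 < c\<close> by (intro antisym) (auto simp: mult_le_0_iff sum_nonneg)
    then have "\<forall>i\<in>I. u i = 0"
      using \<open>finite I\<close> by (simp add: sum_nonneg_eq_0_iff)
    then have "vec_index v b = 0" if "b < n" for b
      using u[OF that] bij_betwE[OF h] that by (force simp: n_def)
    then have "v = 0\<^sub>v n" using v(1) by auto
    then show False using v(2) by simp
  qed
  then have "M \<in> Units (ring_mat TYPE(real) n ())"
    by (rule det_non_zero_imp_unit[OF M])
  then obtain B where B: "B \<in> carrier_mat n n" "M * B = 1\<^sub>m n"
    by (auto simp: Units_def ring_mat_def)
  define w where "w = B *\<^sub>v vec n (\<lambda>a. r (h a))"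
  have w: "w \<in> carrier_vec n" using B by (simp add: w_def)
  have "M *\<^sub>v w = vec n (\<lambda>a. r (h a))"
    using assoc_mult_mat_vec[OF M B(1), of "vec n (\<lambda>a. r (h a))"] B by (simp add: w_def)
  then have *: "(\<Sum>b<n. A (h a) (h b) * vec_index w b) = r (h a)" if "a < n" for a
    using Mv[OF w that] that by simp
  show ?thesis
  proof (intro exI[of _ "\<lambda>i. vec_index w (g i)"] ballI)
    fix i assume "i \<in> I"
    then have "i \<in> h ` {0..<card I}"
      using h by (simp add: bij_betw_def)
    then obtain a where a: "a < n" "i = h a"
      by (auto simp: n_def)
    show "(\<Sum>j\<in>I. A i j * vec_index w (g j)) = r i"
      unfolding reindex a(2) using *[OF a(1)] gh by (simp add: n_def)
  qed
qed

section \<open>The Gram operator and its regularization\<close>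

definition gram :: "nat \<Rightarrow> (nat \<Rightarrow> nat \<Rightarrow> real) \<Rightarrow> nat \<Rightarrow> nat \<Rightarrow> real" where
  "gram m \<phi> i j = (\<Sum>r<m. \<phi> r i * \<phi> r j)"

lemma gram_commute: "gram m \<phi> i j = gram m \<phi> j i"
  by (simp add: gram_def mult.commute)

lemma le_if_mult_self_le:
  fixes c q v :: real
  assumes "q * (c * q) \<le> q * v" "0 \<le> q" "0 \<le> v"
  shows "c * q \<le> v"
proof (cases "q = 0")
  case False
  then show ?thesis
    using assms by (intro mult_left_le_imp_le[OF assms(1)]) simp
qed (use assms in simp)

lemma ip_cong: "(\<And>l. l < N \<Longrightarrow> u l = u' l) \<Longrightarrow> (\<And>l. l < N \<Longrightarrow> v l = v' l) \<Longrightarrow> ip N u v = ip N u' v'"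
  unfolding ip_def by (intro sum.cong) auto

lemma ip_add_right: "ip N u (\<lambda>l. v l + c * w l) = ip N u v + c * ip N u w"
  by (simp add: ip_def algebra_simps sum.distrib sum_distrib_left)

definition gram_op :: "nat \<Rightarrow> nat \<Rightarrow> (nat \<Rightarrow> nat \<Rightarrow> real) \<Rightarrow> (nat \<Rightarrow> real) \<Rightarrow> nat \<Rightarrow> real" where
  "gram_op m N \<phi> v i = ip N (gram m \<phi> i) v"

lemma gram_op_eq: "gram_op m N \<phi> v i = (\<Sum>r<m. \<phi> r i * ip N (\<phi> r) v)"
  unfolding gram_op_def gram_def ip_def sum_distrib_left sum_distrib_right
  by (subst sum.swap) (simp add: mult_ac)

lemma ip_gram_op: "ip N u (gram_op m N \<phi> v) = (\<Sum>r<m. ip N (\<phi> r) u * ip N (\<phi> r) v)"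
proof -
  have "ip N u (gram_op m N \<phi> v) = (\<Sum>r<m. ip N (\<phi> r) v * ip N u (\<phi> r))"
    unfolding gram_op_eq ip_sum_right[symmetric] by (simp add: mult.commute)
  then show ?thesis
    by (simp add: ip_commute mult.commute)
qed

lemma ip_gram_op_sym: "ip N u (gram_op m N \<phi> v) = ip N (gram_op m N \<phi> u) v"
  by (simp add: ip_gram_op ip_commute[of N "gram_op m N \<phi> u"] mult.commute)

lemma ip_gram_op_nonneg: "0 \<le> ip N v (gram_op m N \<phi> v)"
  by (simp add: ip_gram_op sum_nonneg)

text \<open>The witness is \<open>K = G (1 + s G)\<^sup>-\<^sup>1\<close> for the Gram matrix \<open>G\<close>.\<close>

lemma regularized_gram:
  fixes \<phi> :: "nat \<Rightarrow> nat \<Rightarrow> real"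
  assumes "0 < s" and row: "\<And>i. i < N \<Longrightarrow> ip N (gram m \<phi> i) (gram m \<phi> i) \<le> \<rho>"
  obtains K where
    "\<And>i j. i < N \<Longrightarrow> j < N \<Longrightarrow> K i j = K j i"
    "\<And>i j. i < N \<Longrightarrow> j < N \<Longrightarrow> \<bar>gram m \<phi> i j - K i j\<bar> \<le> s * \<rho>"
    "\<And>i. i < N \<Longrightarrow> ip N (K i) (K i) \<le> \<rho>"
    "\<And>v. (\<Sum>i<N. (ip N (K i) v)\<^sup>2) \<le> 1 / s\<^sup>2 * ip N v v"
    "\<And>w. \<exists>h. \<forall>i<N. ip N (K i) w = (\<Sum>r<m. \<phi> r i * h r)"
    "\<And>u i. (\<And>r. r < m \<Longrightarrow> ip N (\<phi> r) u = 0) \<Longrightarrow> i < N \<Longrightarrow> ip N (K i) u = 0"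
proof -
  let ?G = "gram_op m N \<phi>"
  \<comment> \<open>\<open>t\<close> is column j of the inverse of 1 + s G, which exists because the
    form of 1 + s G is at least that of the identity.\<close>
  have "\<exists>t. \<forall>i<N. t i + s * ?G t i = unit_fun j i" for j
  proof -
    have co: "1 * (\<Sum>i<N. (u i)\<^sup>2) \<le> (\<Sum>i<N. \<Sum>l<N. u i * (unit_fun i l + s * gram m \<phi> i l) * u l)" for u
    proof -
      have "(\<Sum>i<N. \<Sum>l<N. u i * (unit_fun i l + s * gram m \<phi> i l) * u l)
          = (\<Sum>i<N. u i * (ip N (unit_fun i) u + s * ?G u i))"
        unfolding gram_op_def ip_def by (simp add: sum_distrib_left sum.distrib algebra_simps)
      also have "\<dots> = ip N u u + s * ip N u (?G u)"
        unfolding ip_add_right[symmetric] unfolding ip_def[of N u] by (simp add: ip_unit_left)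
      finally show ?thesis
        using \<open>0 < s\<close> ip_gram_op_nonneg[of N u m \<phi>] by (simp add: ip_def power2_eq_square)
    qed
    have "\<exists>x. \<forall>i\<in>{..<N}. (\<Sum>l<N. (unit_fun i l + s * gram m \<phi> i l) * x l) = unit_fun j i"
      by (rule coercive_solve[where c = 1]) (simp, simp, rule co)
    then obtain x where x: "\<And>i. i < N \<Longrightarrow>
        (\<Sum>l<N. (unit_fun i l + s * gram m \<phi> i l) * x l) = unit_fun j i"
      by auto
    have "x i + s * ?G x i = unit_fun j i" if "i < N" for i
    proof -
      have "(\<Sum>l<N. (unit_fun i l + s * gram m \<phi> i l) * x l) = ip N (unit_fun i) x + s * ?G x i"
        unfolding gram_op_def ip_def by (simp add: sum_distrib_left sum.distrib algebra_simps)
      then show ?thesis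
        using x[of i] that by (simp add: ip_unit_left)
    qed
    then show ?thesis by blast
  qed
  then obtain t where t: "\<And>j i. i < N \<Longrightarrow> t j i + s * ?G (t j) i = unit_fun j i"
    by metis
  \<comment> \<open>\<open>t j\<close> being column j of the inverse of 1 + s G, this is entry (i,
    j) of G times that inverse, and \<open>y v\<close> below is the inverse applied to v.\<close>
  define K where "K = (\<lambda>i j. ?G (t j) i)"
  define y where "y = (\<lambda>v l. \<Sum>j<N. v j * t j l)"
  have Gy: "?G (y v) i = ip N (K i) v" for v i
  proof -
    have "?G (y v) i = (\<Sum>j<N. v j * ip N (gram m \<phi> i) (t j))"
      unfolding gram_op_def y_def by (rule ip_sum_right)
    then show ?thesis
      by (simp add: K_def gram_op_def ip_def mult.commute)
  qed
  have y: "y v i + s * ?G (y v) i = v i" if "i < N" for v i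
  proof -
    have "y v i + s * ?G (y v) i = (\<Sum>j<N. v j * (t j i + s * ?G (t j) i))"
      unfolding Gy by (simp add: y_def K_def ip_def sum_distrib_left sum.distrib algebra_simps)
    also have "\<dots> = ip N v (\<lambda>j. unit_fun j i)"
      using that by (simp add: t ip_def)
    also have "\<dots> = ip N v (unit_fun i)"
      by (simp add: ip_def unit_fun_def eq_commute)
    finally show ?thesis
      using that by (simp add: ip_unit_right)
  qed
  have split: "ip N u v = ip N u (y v) + s * ip N u (?G (y v))" for u v
    unfolding ip_add_right[symmetric] by (rule ip_cong) (auto simp: y)
  have split_t: "ip N u (unit_fun j) = ip N u (t j) + s * ip N u (?G (t j))" for u j
    unfolding ip_add_right[symmetric] by (rule ip_cong) (auto simp: t)
  have sym: "K i j = K j i" if "i < N" "j < N" for i j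
  proof -
    \<comment> \<open>The right side is symmetric in a and b, because the Gram form is. So the
      inverse of 1 + s G is symmetric, and K inherits this, since the inverse plus s K is the
      identity.\<close>
    have tij: "t b a = ip N (t b) (t a) + s * ip N (t b) (?G (t a))" if "a < N" "b < N" for a b
      using split_t[of "t b" a] that by (simp add: ip_unit_right)
    have "t i j = t j i"
      using tij[OF that] tij[OF that(2,1)] ip_gram_op_sym[of N "t i" m \<phi> "t j"]
      by (simp add: ip_commute)
    moreover have "unit_fun i j = unit_fun j i"
      by (simp add: unit_fun_def)
    ultimately have "s * K i j = s * K j i"
      using t[OF that(1), of j] t[OF that(2), of i] unfolding K_def by linarith
    then show ?thesis
      using \<open>0 < s\<close> by simp
  qed
  have G_unit: "?G (t j) i + s * ?G (?G (t j)) i = gram m \<phi> i j" if "j < N" for i j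
    using split_t[of "gram m \<phi> i" j] that by (simp add: ip_unit_right gram_op_def)
  \<comment> \<open>With k and g the j-th columns of K and G, k + s G k = g. Pairing with k gives
    <k, k> \<le> <k, g>, hence |k| \<le> |g|.\<close>
  have row_K: "ip N (?G (t j)) (?G (t j)) \<le> \<rho>" if "j < N" for j
  proof -
    let ?k = "?G (t j)" and ?g = "gram m \<phi> j"
    have "ip N ?k ?g = ip N ?k (\<lambda>i. ?k i + s * ?G ?k i)"
      by (rule ip_cong) (auto simp: G_unit[OF that] gram_commute)
    then have "ip N ?k ?k \<le> ip N ?k ?g"
      using ip_gram_op_nonneg[of N ?k m \<phi>] \<open>0 < s\<close> by (simp add: ip_add_right)
    then have "(ip N ?k ?k)\<^sup>2 \<le> (ip N ?k ?g)\<^sup>2"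
      by (intro power_mono) auto
    also have "\<dots> \<le> ip N ?k ?k * ip N ?g ?g"
      by (rule ip_cauchy_schwarz)
    finally have "ip N ?k ?k * ip N ?k ?k \<le> ip N ?k ?k * ip N ?g ?g"
      by (simp add: power2_eq_square)
    then have "ip N ?k ?k * (1 * ip N ?k ?k) \<le> ip N ?k ?k * ip N ?g ?g"
      by simp
    then have "1 * ip N ?k ?k \<le> ip N ?g ?g"
      by (rule le_if_mult_self_le) simp_all
    then show ?thesis
      using row[OF that] by linarith
  qed
  show ?thesis
  proof (rule that[of K])
    fix i j assume ij: "i < N" "j < N"
    show "K i j = K j i" by (rule sym[OF ij])
    \<comment> \<open>G - K = s G K, so an entry of the difference is s times the inner product of
      two vectors of squared norm at most \<rho>.\<close>
    have "(gram m \<phi> i j - K i j)\<^sup>2 = s\<^sup>2 * (ip N (gram m \<phi> i) (?G (t j)))\<^sup>2"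
    proof -
      have "gram m \<phi> i j - K i j = s * ip N (gram m \<phi> i) (?G (t j))"
        using G_unit[OF ij(2), of i] unfolding K_def gram_op_def[of m N \<phi> "?G (t j)"] by linarith
      then show ?thesis
        by (simp add: power_mult_distrib)
    qed
    also have "\<dots> \<le> s\<^sup>2 * (ip N (gram m \<phi> i) (gram m \<phi> i) * ip N (?G (t j)) (?G (t j)))"
      by (intro mult_left_mono ip_cauchy_schwarz) auto
    also have "\<dots> \<le> s\<^sup>2 * (\<rho> * \<rho>)"
      using row[OF ij(1)] row_K[OF ij(2)] by (intro mult_left_mono mult_mono) (auto intro: order_trans[OF ip_nonneg])
    also have "\<dots> = (s * \<rho>)\<^sup>2"
      by (simp add: power2_eq_square)
    finally have "\<bar>gram m \<phi> i j - K i j\<bar> \<le> \<bar>s * \<rho>\<bar>"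
      by (simp add: abs_le_square_iff)
    then show "\<bar>gram m \<phi> i j - K i j\<bar> \<le> s * \<rho>"
      using \<open>0 < s\<close> order_trans[OF ip_nonneg row[OF ij(1)]] by simp
  next
    fix i assume i: "i < N"
    have "ip N (K i) (K i) = ip N (?G (t i)) (?G (t i))"
      using sym[OF i] by (intro ip_cong) (auto simp: K_def)
    then show "ip N (K i) (K i) \<le> \<rho>"
      using row_K[OF i] by simp
  next
    fix v
    let ?q = "ip N (?G (y v)) (?G (y v))"
    \<comment> \<open>Pairing v = y + s G y with G y and dropping <y, G y> \<ge> 0 leaves s |G y|^2
      \<le> <v, G y>. As G y = K v, Cauchy-Schwarz gives |K v| \<le> |v| / s.\<close>
    have "s * ?q \<le> ip N v (?G (y v))"
      using split[of "?G (y v)" v] ip_gram_op_nonneg[of N "y v" m \<phi>] by (simp add: ip_commute)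
    then have "(s * ?q)\<^sup>2 \<le> (ip N v (?G (y v)))\<^sup>2"
      using \<open>0 < s\<close> by (intro power_mono) auto
    also have "\<dots> \<le> ip N v v * ?q"
      by (rule ip_cauchy_schwarz)
    finally have "?q * (s\<^sup>2 * ?q) \<le> ?q * ip N v v"
      by (simp add: power2_eq_square mult_ac)
    then have "s\<^sup>2 * ?q \<le> ip N v v"
      by (rule le_if_mult_self_le) simp_all
    then have "?q \<le> 1 / s\<^sup>2 * ip N v v"
      using \<open>0 < s\<close> by (simp add: field_simps)
    then show "(\<Sum>i<N. (ip N (K i) v)\<^sup>2) \<le> 1 / s\<^sup>2 * ip N v v"
      by (simp add: ip_def[of N "?G (y v)"] Gy power2_eq_square)
  next
    fix w
    show "\<exists>h. \<forall>i<N. ip N (K i) w = (\<Sum>r<m. \<phi> r i * h r)"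
      unfolding Gy[symmetric] gram_op_eq by (rule exI[of _ "\<lambda>r. ip N (\<phi> r) (y w)"]) simp
  next
    fix u i assume u: "\<And>r. r < m \<Longrightarrow> ip N (\<phi> r) u = 0" and i: "i < N"
    have "ip N (K i) u = ip N (?G (t i)) u"
      using sym[OF i] by (intro ip_cong) (auto simp: K_def)
    also have "\<dots> = 0"
      by (simp add: ip_commute[of N "?G (t i)"] ip_gram_op u)
    finally show "ip N (K i) u = 0" .
  qed
qed

section \<open>Dual certificates for most supports and signs\<close>

definition certified :: "nat \<Rightarrow> nat \<Rightarrow> (nat \<Rightarrow> nat \<Rightarrow> real) \<Rightarrow> nat set \<Rightarrow> (nat \<Rightarrow> real) \<Rightarrow> bool" where
  "certified m N \<phi> I \<sigma> \<longleftrightarrow>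
     (\<exists>h. (\<forall>i\<in>I. (\<Sum>r<m. \<phi> r i * h r) = \<sigma> i) \<and> (\<forall>j<N. j \<notin> I \<longrightarrow> \<bar>\<Sum>r<m. \<phi> r j * h r\<bar> < 1))"

definition injective_on :: "nat \<Rightarrow> nat \<Rightarrow> (nat \<Rightarrow> nat \<Rightarrow> real) \<Rightarrow> nat set \<Rightarrow> bool" where
  "injective_on m N \<phi> I \<longleftrightarrow>
     (\<forall>u. (\<forall>i. i \<notin> I \<longrightarrow> u i = 0) \<and> (\<forall>r<m. ip N (\<phi> r) u = 0) \<longrightarrow> (\<forall>i\<in>I. u i = 0))"

lemma ip_supported:
  assumes "I \<subseteq> {..<N}" "\<And>i. i \<notin> I \<Longrightarrow> u i = 0"
  shows "ip N v u = (\<Sum>i\<in>I. v i * u i)"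
  unfolding ip_def using assms by (intro sum.mono_neutral_right) auto

text \<open>The certificate is K w, where w solves K_I w = \<sigma> and is extended by zero;
  \<open>range\<close> writes it in the form required of a certificate. By symmetry its entry at j
  outside I is <z_j, \<sigma>>, where K_I z_j is column j of K on I. The vector z_j does not depend
  on the signs, and coercivity with constant 1/2 gives |z_j|^2 \<le> 4 \<beta>, so Hoeffding's
  inequality yields the exponent 1 / (8 \<beta>) for each j.\<close>

lemma card_uncertified:
  assumes sym: "\<And>i j. i < N \<Longrightarrow> j < N \<Longrightarrow> K i j = K j i"
    and range: "\<And>w. \<exists>h. \<forall>i<N. ip N (K i) w = (\<Sum>r<m. \<phi> r i * h r)"
    and ker: "\<And>u i. (\<And>r. r < m \<Longrightarrow> ip N (\<phi> r) u = 0) \<Longrightarrow> i < N \<Longrightarrow> ip N (K i) u = 0"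
    and I: "I \<subseteq> {..<N}"
    and coercive: "\<And>u. 1 / 2 * (\<Sum>i\<in>I. (u i)\<^sup>2) \<le> (\<Sum>i\<in>I. \<Sum>j\<in>I. u i * K i j * u j)"
    and rows: "\<And>j. j < N \<Longrightarrow> j \<notin> I \<Longrightarrow> (\<Sum>i\<in>I. (K j i)\<^sup>2) \<le> \<beta>" and "0 < \<beta>"
  shows "injective_on m N \<phi> I"
    and "real (card {\<sigma> \<in> sign_patterns I. \<not> certified m N \<phi> I \<sigma>})
      \<le> real N * (2 * 2 ^ card I * exp (- 1 / (8 * \<beta>)))"
proof -
  have fI: "finite I" using I finite_subset by auto
  show "injective_on m N \<phi> I"
    unfolding injective_on_def
  proof (intro allI impI)
    fix u assume u: "(\<forall>i. i \<notin> I \<longrightarrow> u i = 0) \<and> (\<forall>r<m. ip N (\<phi> r) u = 0)"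
    have "(\<Sum>j\<in>I. K i j * u j) = 0" if "i \<in> I" for i
      using ker[of u i] u that I ip_supported[OF I, of u "K i"] by auto
    then have "(\<Sum>i\<in>I. u i * (\<Sum>j\<in>I. K i j * u j)) = 0"
      by simp
    then have "(\<Sum>i\<in>I. \<Sum>j\<in>I. u i * K i j * u j) = 0"
      by (simp add: sum_distrib_left mult.assoc)
    then have "(\<Sum>i\<in>I. (u i)\<^sup>2) \<le> 0"
      using coercive[of u] by linarith
    then have "(\<Sum>i\<in>I. (u i)\<^sup>2) = 0"
      by (intro antisym) (auto simp: sum_nonneg)
    then show "\<forall>i\<in>I. u i = 0"
      using fI by (simp add: sum_nonneg_eq_0_iff)
  qed
  have solve: "\<exists>x. \<forall>i\<in>I. (\<Sum>j\<in>I. K i j * x j) = r i" for r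
    by (rule coercive_solve[OF fI _ coercive]) simp
  have "\<exists>z. \<forall>i\<in>I. (\<Sum>i'\<in>I. K i i' * z i') = K i j" for j
    by (rule solve)
  then obtain z where z: "\<And>j i. i \<in> I \<Longrightarrow> (\<Sum>i'\<in>I. K i i' * z j i') = K i j"
    by metis
  have z_small: "(\<Sum>i\<in>I. (z j i)\<^sup>2) \<le> 4 * \<beta>" if j: "j < N" "j \<notin> I" for j
  proof -
    let ?Q = "\<Sum>i\<in>I. (z j i)\<^sup>2"
    have "1 / 2 * ?Q \<le> (\<Sum>i\<in>I. z j i * K i j)"
      using coercive[of "z j"] by (simp add: z mult.assoc flip: sum_distrib_left)
    then have "(1 / 2 * ?Q)\<^sup>2 \<le> (\<Sum>i\<in>I. z j i * K i j)\<^sup>2"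
      by (intro power_mono) (auto simp: sum_nonneg)
    also have "\<dots> \<le> ?Q * (\<Sum>i\<in>I. (K i j)\<^sup>2)"
      by (rule Cauchy_Schwarz_ineq_sum)
    also have "(\<Sum>i\<in>I. (K i j)\<^sup>2) = (\<Sum>i\<in>I. (K j i)\<^sup>2)"
      using sym j I by (intro sum.cong) auto
    also have "?Q * \<dots> \<le> ?Q * \<beta>"
      using rows[OF j] by (intro mult_left_mono) (auto simp: sum_nonneg)
    finally have "?Q * (1 / 4 * ?Q) \<le> ?Q * \<beta>"
      by (simp add: power2_eq_square)
    then have "1 / 4 * ?Q \<le> \<beta>"
      using \<open>0 < \<beta>\<close> by (intro le_if_mult_self_le[of ?Q "1 / 4" \<beta>]) (auto simp: sum_nonneg)
    then show ?thesis by simp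
  qed
  let ?bad = "\<lambda>j. {\<sigma> \<in> sign_patterns I. 1 \<le> \<bar>\<Sum>i\<in>I. z j i * \<sigma> i\<bar>}"
  have "{\<sigma> \<in> sign_patterns I. \<not> certified m N \<phi> I \<sigma>} \<subseteq> (\<Union>j\<in>{..<N} - I. ?bad j)"
  proof (intro subsetI, rule ccontr)
    fix \<sigma>
    assume \<sigma>_in: "\<sigma> \<in> {\<sigma> \<in> sign_patterns I. \<not> certified m N \<phi> I \<sigma>}" "\<sigma> \<notin> (\<Union>j\<in>{..<N} - I. ?bad j)"
    then have \<sigma>: "\<not> certified m N \<phi> I \<sigma>"
      by simp
    have small: "\<bar>\<Sum>i\<in>I. z j i * \<sigma> i\<bar> < 1" if "j < N" "j \<notin> I" for j
      using \<sigma>_in that by (simp add: not_le[symmetric])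
    obtain w where w: "\<And>i. i \<in> I \<Longrightarrow> (\<Sum>i'\<in>I. K i i' * w i') = \<sigma> i"
      using solve[of \<sigma>] by auto
    obtain h where h: "\<And>i. i < N \<Longrightarrow> ip N (K i) (restr I w) = (\<Sum>r<m. \<phi> r i * h r)"
      using range[of "restr I w"] by auto
    have ipw: "ip N (K i) (restr I w) = (\<Sum>i'\<in>I. K i i' * w i')" for i
      using ip_supported[OF I, of "restr I w" "K i"] by (simp add: restr_def)
    have "(\<Sum>r<m. \<phi> r i * h r) = \<sigma> i" if "i \<in> I" for i
      using h[of i] ipw[of i] w that I by auto
    moreover have "\<bar>\<Sum>r<m. \<phi> r j * h r\<bar> < 1" if j: "j < N" "j \<notin> I" for j
    proof -
      have "(\<Sum>r<m. \<phi> r j * h r) = (\<Sum>i\<in>I. K j i * w i)"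
        using h[OF j(1)] ipw by simp
      also have "\<dots> = (\<Sum>i\<in>I. (\<Sum>i'\<in>I. K i i' * z j i') * w i)"
        using sym j I by (intro sum.cong) (auto simp: z)
      also have "\<dots> = (\<Sum>i'\<in>I. \<Sum>i\<in>I. z j i' * (K i i' * w i))"
        unfolding sum_distrib_right by (subst sum.swap) (simp add: mult_ac)
      also have "\<dots> = (\<Sum>i'\<in>I. z j i' * (\<Sum>i\<in>I. K i' i * w i))"
        unfolding sum_distrib_left using sym I by (intro sum.cong refl) (metis lessThan_iff subsetD)
      also have "\<dots> = (\<Sum>i'\<in>I. z j i' * \<sigma> i')"
        by (simp add: w)
      finally show ?thesis
        using small[OF j] by simp
    qed
    ultimately show False
      using \<sigma> unfolding certified_def by blast
  qed
  then have "card {\<sigma> \<in> sign_patterns I. \<not> certified m N \<phi> I \<sigma>} \<le> card (\<Union>j\<in>{..<N} - I. ?bad j)"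
    using fI by (intro card_mono) auto
  also have "\<dots> \<le> (\<Sum>j\<in>{..<N} - I. card (?bad j))"
    by (rule card_UN_le) simp
  finally have "real (card {\<sigma> \<in> sign_patterns I. \<not> certified m N \<phi> I \<sigma>})
      \<le> (\<Sum>j\<in>{..<N} - I. real (card (?bad j)))"
    unfolding of_nat_sum[symmetric] by (rule of_nat_mono)
  also have "\<dots> \<le> (\<Sum>j\<in>{..<N} - I. 2 * 2 ^ card I * exp (- 1 / (8 * \<beta>)))"
  proof (rule sum_mono)
    fix j assume "j \<in> {..<N} - I"
    then show "real (card (?bad j)) \<le> 2 * 2 ^ card I * exp (- 1 / (8 * \<beta>))"
      using hoeffding_signs[OF fI, of "4 * \<beta>" "z j"] z_small[of j] \<open>0 < \<beta>\<close> by simp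
  qed
  also have "\<dots> \<le> real N * (2 * 2 ^ card I * exp (- 1 / (8 * \<beta>)))"
  proof -
    have "real (card ({..<N} - I)) \<le> real N"
      using card_mono[of "{..<N}" "{..<N} - I"] by simp
    then show ?thesis
      by (simp add: mult_right_mono)
  qed
  finally show "real (card {\<sigma> \<in> sign_patterns I. \<not> certified m N \<phi> I \<sigma>})
      \<le> real N * (2 * 2 ^ card I * exp (- 1 / (8 * \<beta>)))" .
qed

text \<open>Two regimes: if k entries of the maximal size fit below \<beta>, there is no exceptional
  set at all; otherwise the tail bound for random subsets is applied to each of the N rows, with E
  the exponent to be reached.\<close>

lemma card_not_rows_small:
  assumes "0 < k" "k \<le> N" "0 < \<alpha>" "0 < \<beta>"
    and entries: "\<And>i j. i < N \<Longrightarrow> j < N \<Longrightarrow> (H i j)\<^sup>2 \<le> \<alpha>"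
    and row: "\<And>i. i < N \<Longrightarrow> (\<Sum>j<N. (H i j)\<^sup>2) \<le> \<rho>"
    and R: "real k * \<alpha> \<le> \<beta> \<or> (1 \<le> R \<and> R * (real k * \<rho>) \<le> \<beta> * real N \<and> E \<le> \<beta> / \<alpha> * (ln R - 1))"
  shows "real (card {I \<in> ksubsets {..<N} k. \<not> rows_small N H I \<beta>}) \<le> real (N choose k) * (real N * exp (- E))"
proof (cases "real k * \<alpha> \<le> \<beta>")
  case True
  have "rows_small N H I \<beta>" if "I \<in> ksubsets {..<N} k" for I
    unfolding rows_small_def
  proof (intro allI impI)
    fix i assume "i < N"
    have "(\<Sum>l\<in>I. (H i l)\<^sup>2) \<le> (\<Sum>l\<in>I. \<alpha>)"
      using that entries[OF \<open>i < N\<close>] by (intro sum_mono) (auto simp: ksubsets_def)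
    then show "(\<Sum>l\<in>I. (H i l)\<^sup>2) \<le> \<beta>"
      using that True by (simp add: ksubsets_def)
  qed
  then have "{I \<in> ksubsets {..<N} k. \<not> rows_small N H I \<beta>} = {}"
    by auto
  then show ?thesis
    by (simp only: card.empty) simp
next
  case False
  then have R: "1 \<le> R" "R * (real k * \<rho>) \<le> \<beta> * real N" "E \<le> \<beta> / \<alpha> * (ln R - 1)"
    using R by auto
  let ?B = "\<lambda>i. {I \<in> ksubsets {..<N} k. \<beta> \<le> (\<Sum>l\<in>I. (H i l)\<^sup>2)}"
  have "{I \<in> ksubsets {..<N} k. \<not> rows_small N H I \<beta>} \<subseteq> (\<Union>i<N. ?B i)"
    by (auto simp: rows_small_def not_le intro: less_imp_le)
  then have "card {I \<in> ksubsets {..<N} k. \<not> rows_small N H I \<beta>} \<le> card (\<Union>i<N. ?B i)"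
    by (intro card_mono) auto
  also have "\<dots> \<le> (\<Sum>i<N. card (?B i))"
    by (rule card_UN_le) simp
  finally have "real (card {I \<in> ksubsets {..<N} k. \<not> rows_small N H I \<beta>}) \<le> (\<Sum>i<N. real (card (?B i)))"
    unfolding of_nat_sum[symmetric] by (rule of_nat_mono)
  also have "\<dots> \<le> (\<Sum>i<N. real (N choose k) * exp (- E))"
  proof (rule sum_mono)
    fix i assume "i \<in> {..<N}"
    then have i: "i < N" by simp
    have "R * (real k * (\<Sum>j<N. (H i j)\<^sup>2)) \<le> R * (real k * \<rho>)"
      using R(1) row[OF i] by (intro mult_left_mono) auto
    also note R(2)
    finally have "real (card (?B i)) \<le> real (N choose k) * exp (- (\<beta> / \<alpha> * (ln R - 1)))"
      using chernoff_ksubsets[of "{..<N}" k \<alpha> \<beta> R "\<lambda>j. (H i j)\<^sup>2"] assms(1-4) R(1) entries[OF i]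
      by (auto simp: lessThan_empty_iff)
    also have "\<dots> \<le> real (N choose k) * exp (- E)"
      using R(3) by (intro mult_left_mono) auto
    finally show "real (card (?B i)) \<le> real (N choose k) * exp (- E)" .
  qed
  also have "\<dots> = real (N choose k) * (real N * exp (- E))"
    by simp
  finally show ?thesis .
qed

section \<open>Counting exceptional supports and sign patterns together\<close>

definition fails :: "nat \<Rightarrow> nat \<Rightarrow> (nat \<Rightarrow> nat \<Rightarrow> real) \<Rightarrow> nat set \<Rightarrow> (nat \<Rightarrow> real) \<Rightarrow> bool" where
  "fails m N \<phi> I \<sigma> \<longleftrightarrow> \<not> (injective_on m N \<phi> I \<and> certified m N \<phi> I \<sigma>)"

lemma ip_diagonal_removed:
  assumes "i < N"
  shows "ip N (\<lambda>j. if j = i then 0 else K i j) v = ip N (K i) v - K i i * v i"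
proof -
  have "ip N (K i) v = K i i * v i + (\<Sum>l\<in>{..<N} - {i}. K i l * v l)"
    unfolding ip_def using assms by (subst sum.remove[of _ i]) auto
  moreover have "ip N (\<lambda>j. if j = i then 0 else K i j) v = (\<Sum>l\<in>{..<N} - {i}. K i l * v l)"
    unfolding ip_def using assms by (subst sum.remove[of _ i]) auto
  ultimately show ?thesis by simp
qed

text \<open>Supports in one of the three exceptional families are charged with all 2^k sign
  patterns; on the other supports only the signs can fail. The constants are tuned so that both
  moment bounds yield the same 27^(-p).\<close>

lemma card_failures:
  fixes \<phi> :: "nat \<Rightarrow> nat \<Rightarrow> real" and k N p :: nat
  defines "s \<equiv> 10 ^ 4 * real k / real N"
  assumes unit: "\<And>i. i < N \<Longrightarrow> gram m \<phi> i i = 1"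
    and off: "\<And>i j. i < N \<Longrightarrow> j < N \<Longrightarrow> i \<noteq> j \<Longrightarrow> \<bar>gram m \<phi> i j\<bar> \<le> \<mu>"
    and row: "\<And>i. i < N \<Longrightarrow> (\<Sum>j\<in>{..<N} - {i}. (gram m \<phi> i j)\<^sup>2) \<le> \<rho>"
    and k: "1 \<le> k" "2 * k \<le> N" and "0 \<le> \<mu>" "0 \<le> \<rho>" "3 \<le> p" "0 < \<beta>"
    and h1: "s * (1 + \<rho>) \<le> 1 / 4"
    and h2: "real p * (1 + \<rho>) * real k \<le> 1 / 10 ^ 7 * real N"
    and h3: "real p * \<beta> \<le> 1 / 6912"
    and h4: "real k * (\<mu> + s * (1 + \<rho>))\<^sup>2 \<le> \<beta> \<or>
        (1 \<le> R \<and> R * (real k * (1 + \<rho>)) \<le> \<beta> * real N \<and> E \<le> \<beta> / (\<mu> + s * (1 + \<rho>))\<^sup>2 * (ln R - 1))"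
  shows "real (card (SIGMA I:ksubsets {..<N} k. {\<sigma> \<in> sign_patterns I. fails m N \<phi> I \<sigma>}))
      \<le> real (N choose k) * 2 ^ k *
        (real N * exp (- E) + 2 * (real N + real k * real p) / 27 ^ p + 2 * real N * exp (- 1 / (8 * \<beta>)))"
proof -
  have "0 < N" using k by simp
  have "0 < s" using k \<open>0 < N\<close> by (simp add: s_def)
  have s_small: "s \<le> 1 / 4"
  proof -
    have "s * 1 \<le> s * (1 + \<rho>)"
      using \<open>0 < s\<close> \<open>0 \<le> \<rho>\<close> by (intro mult_left_mono) auto
    then show ?thesis using h1 by simp
  qed
  have row_G: "ip N (gram m \<phi> i) (gram m \<phi> i) \<le> 1 + \<rho>" if i: "i < N" for i
  proof -
    have "ip N (gram m \<phi> i) (gram m \<phi> i) = (gram m \<phi> i i)\<^sup>2 + (\<Sum>j\<in>{..<N} - {i}. (gram m \<phi> i j)\<^sup>2)"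
      unfolding ip_def using i by (subst sum.remove[of _ i]) (auto simp: power2_eq_square)
    then show ?thesis using unit[OF i] row[OF i] by simp
  qed
  obtain K where K_sym: "\<And>i j. i < N \<Longrightarrow> j < N \<Longrightarrow> K i j = K j i"
    and K_diff: "\<And>i j. i < N \<Longrightarrow> j < N \<Longrightarrow> \<bar>gram m \<phi> i j - K i j\<bar> \<le> s * (1 + \<rho>)"
    and K_row: "\<And>i. i < N \<Longrightarrow> ip N (K i) (K i) \<le> 1 + \<rho>"
    and K_norm: "\<And>v. (\<Sum>i<N. (ip N (K i) v)\<^sup>2) \<le> 1 / s\<^sup>2 * ip N v v"
    and K_range: "\<And>w. \<exists>h. \<forall>i<N. ip N (K i) w = (\<Sum>r<m. \<phi> r i * h r)"
    and K_ker: "\<And>u i. (\<And>r. r < m \<Longrightarrow> ip N (\<phi> r) u = 0) \<Longrightarrow> i < N \<Longrightarrow> ip N (K i) u = 0"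
    using regularized_gram[OF \<open>0 < s\<close> row_G] by blast
  have K_diag: "3 / 4 \<le> K i i" "K i i \<le> 5 / 4" if "i < N" for i
    using K_diff[OF that that] unit[OF that] h1 by linarith+
  \<comment> \<open>Decoupling needs a zero diagonal. The diagonal of K is at least 3/4, and H will
    lose at most 1/4, which leaves the coercivity constant 1/2.\<close>
  define H where "H = (\<lambda>i j. if j = i then 0 else K i j)"
  define \<alpha> where "\<alpha> = (\<mu> + s * (1 + \<rho>))\<^sup>2"
  have "0 < s * (1 + \<rho>)" using \<open>0 < s\<close> \<open>0 \<le> \<rho>\<close> by simp
  then have "0 < \<alpha>" using \<open>0 \<le> \<mu>\<close> by (simp add: \<alpha>_def)
  have H_sym: "H i j = H j i" if "i < N" "j < N" for i j
    using K_sym[OF that] by (simp add: H_def)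
  have H_diag: "H i i = 0" for i
    by (simp add: H_def)
  have H_entry: "(H i j)\<^sup>2 \<le> \<alpha>" if "i < N" "j < N" for i j
  proof (cases "i = j")
    case True
    then show ?thesis using \<open>0 < \<alpha>\<close> by (simp add: H_def)
  next
    case False
    then have "\<bar>H i j\<bar> \<le> \<mu> + s * (1 + \<rho>)"
      using K_diff[OF that] off[OF that False] by (auto simp: H_def)
    then show ?thesis
      unfolding \<alpha>_def by (rule abs_le_square_iff[THEN iffD1, OF order_trans]) simp
  qed
  have H_row: "(\<Sum>j<N. (H i j)\<^sup>2) \<le> 1 + \<rho>" if "i < N" for i
  proof -
    have "(\<Sum>j<N. (H i j)\<^sup>2) \<le> (\<Sum>j<N. (K i j)\<^sup>2)"
      by (intro sum_mono) (simp add: H_def)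
    then show ?thesis
      using K_row[OF that] by (simp add: ip_def power2_eq_square)
  qed
  \<comment> \<open>K contributes 2 / s^2, and the removed diagonal twice (5/4)^2, that is 25/8,
    which is below 1 / s^2 because s \<le> 1/4.\<close>
  have H_norm: "(\<Sum>i<N. (ip N (H i) v)\<^sup>2) \<le> 3 / s\<^sup>2 * ip N v v" for v
  proof -
    have "(ip N (H i) v)\<^sup>2 \<le> 2 * (ip N (K i) v)\<^sup>2 + 25 / 8 * (v i * v i)" if "i < N" for i
    proof -
      have "(ip N (K i) v - K i i * v i)\<^sup>2 \<le> 2 * (ip N (K i) v)\<^sup>2 + 2 * (K i i * v i)\<^sup>2"
        using zero_le_power2[of "ip N (K i) v + K i i * v i"] by (simp add: power2_eq_square algebra_simps)
      also have "(K i i * v i)\<^sup>2 \<le> (5 / 4)\<^sup>2 * (v i)\<^sup>2"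
        unfolding power_mult_distrib using K_diag[OF that] by (intro mult_right_mono power_mono) auto
      finally show ?thesis
        unfolding H_def ip_diagonal_removed[OF that] by (simp add: power2_eq_square)
    qed
    then have "(\<Sum>i<N. (ip N (H i) v)\<^sup>2) \<le> (\<Sum>i<N. 2 * (ip N (K i) v)\<^sup>2 + 25 / 8 * (v i * v i))"
      by (intro sum_mono) auto
    also have "\<dots> = 2 * (\<Sum>i<N. (ip N (K i) v)\<^sup>2) + 25 / 8 * ip N v v"
      by (simp only: sum.distrib sum_distrib_left[symmetric] ip_def)
    also have "\<dots> \<le> 2 * (1 / s\<^sup>2 * ip N v v) + 1 / s\<^sup>2 * ip N v v"
    proof (intro add_mono mult_left_mono mult_right_mono K_norm)
      have "s\<^sup>2 \<le> (1 / 4)\<^sup>2"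
        using \<open>0 < s\<close> s_small by (intro power_mono) auto
      then show "25 / 8 \<le> 1 / s\<^sup>2"
        using \<open>0 < s\<close> by (simp add: le_divide_eq power2_eq_square)
    qed auto
    finally show ?thesis by (simp add: field_simps)
  qed
  \<comment> \<open>With e replaced by 3 and N + 1 - k by N / 2, this z solves the condition e (3 /
    s^2) k \<le> z (N + 1 - k) with equality. The factor 27 in \<open>c\<close> produces
    27^(-p).\<close>
  define z where "z = 18 / 10 ^ 8 * (real N / real k)"
  define c where "c = 27 * z"
  have "0 < z" using k \<open>0 < N\<close> by (simp add: z_def)
  then have "0 < c" by (simp add: c_def)
  have half: "real N / 2 \<le> real N + 1 - real k"
    using k by simp
  let ?C = "real (N choose k)" and ?T = "real N + real k * real p"
  define B1 where "B1 = {I \<in> ksubsets {..<N} k. \<not> rows_small N H I \<beta>}"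
  define B2 where "B2 = {I \<in> ksubsets {..<N} k. \<not> restricted_norm_le N H I c}"
  define B3 where "B3 = {I \<in> ksubsets {..<N} k. rows_small N H I \<beta> \<and> restricted_norm_le N H I c \<and>
      (\<exists>u. (\<Sum>i\<in>I. \<Sum>j\<in>I. u i * H i j * u j) < - (1 / 4) * (\<Sum>i\<in>I. (u i)\<^sup>2))}"
  have B1: "real (card B1) \<le> ?C * (real N * exp (- E))"
    unfolding B1_def
    by (rule card_not_rows_small[where \<rho> = "1 + \<rho>" and R = R and \<alpha> = \<alpha>])
       (use k \<open>0 < \<alpha>\<close> \<open>0 < \<beta>\<close> H_entry H_row h4 in \<open>auto simp: \<alpha>_def\<close>)
  have B2: "real (card B2) \<le> ?C * (?T / 27 ^ p)"
  proof -
    have "real (card B2) * c ^ p \<le> ?C * ?T * z ^ p"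
      unfolding B2_def
    proof (rule card_not_restricted_norm_le[where \<beta> = "1 + \<rho>" and \<Lambda> = "3 / s\<^sup>2"])
      have "exp 1 * (3 / s\<^sup>2) * real k \<le> 3 * (3 / s\<^sup>2) * real k"
        using exp_le by (intro mult_right_mono) auto
      also have "\<dots> = z * (real N / 2)"
        using k \<open>0 < N\<close> by (simp add: s_def z_def field_simps power2_eq_square)
      also have "\<dots> \<le> z * (real N + 1 - real k)"
        using half \<open>0 < z\<close> by (intro mult_left_mono) auto
      finally show "exp 1 * (3 / s\<^sup>2) * real k \<le> z * (real N + 1 - real k)" .
      have "real p * (1 + \<rho>) \<le> 1 / 10 ^ 7 * real N / real k"
        using h2 k by (simp add: le_divide_eq)
      also have "\<dots> \<le> z"
        using k by (simp add: z_def field_simps)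
      finally show "real p * (1 + \<rho>) \<le> z" .
      show "ip N (H i) (H i) \<le> 1 + \<rho>" if "i < N" for i
        using H_row[OF that] by (simp add: ip_def power2_eq_square)
    qed (use k \<open>0 < c\<close> \<open>0 \<le> \<rho>\<close> \<open>3 \<le> p\<close> H_norm in auto)
    then have "(real (card B2) * 27 ^ p) * z ^ p \<le> (?C * ?T) * z ^ p"
      by (simp add: c_def power_mult_distrib mult_ac)
    then have "real (card B2) * 27 ^ p \<le> ?C * ?T"
      by (rule mult_right_le_imp_le) (simp add: \<open>0 < z\<close>)
    then show ?thesis
      by (simp add: le_divide_eq)
  qed
  have B3: "real (card B3) \<le> ?C * (?T / 27 ^ p)"
  proof -
    \<comment> \<open>The level 1/4 becomes (1/16)^(2 p) = 256^(-p) after decoupling. The scale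
      1/6912 = 1 / (27 * 256) again leaves 27^(-p), and \<open>c\<close> is small enough for it
      because of the factor 10^4 in \<open>s\<close>.\<close>
    have "real (card B3) * (1 / 4 / 4) ^ (2 * p) \<le> ?C * ?T * (1 / 6912) ^ p"
      unfolding B3_def
    proof (rule card_not_coercive[where \<beta> = \<beta> and \<Lambda> = c])
      have "exp 1 * c * real k \<le> 3 * c * real k"
        using exp_le \<open>0 < c\<close> by (intro mult_right_mono) auto
      also have "\<dots> \<le> 1 / 6912 * (real N / 2)"
        using k by (simp add: c_def z_def field_simps)
      also have "\<dots> \<le> 1 / 6912 * (real N + 1 - real k)"
        using half by (intro mult_left_mono) auto
      finally show "exp 1 * c * real k \<le> 1 / 6912 * (real N + 1 - real k)" .
    qed (use H_sym H_diag k \<open>0 < \<beta>\<close> \<open>0 < c\<close> \<open>3 \<le> p\<close> h3 in auto)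
    also have "(1 / 4 / 4 :: real) ^ (2 * p) = (1 / 256) ^ p"
      by (simp add: power_mult power2_eq_square)
    also have "(1 / 6912 :: real) ^ p = (1 / 27) ^ p * (1 / 256) ^ p"
      by (simp flip: power_mult_distrib)
    finally have "real (card B3) * (1 / 256) ^ p \<le> (?C * ?T * (1 / 27) ^ p) * (1 / 256) ^ p"
      by (simp only: mult.assoc)
    then have "real (card B3) \<le> ?C * ?T * (1 / 27) ^ p"
      by (rule mult_right_le_imp_le) simp
    then show ?thesis
      by (simp add: power_divide)
  qed
  let ?U = "real N * (2 * 2 ^ k * exp (- 1 / (8 * \<beta>)))"
  have fin: "finite I" if "I \<in> ksubsets {..<N} k" for I
    using that finite_subset[OF _ finite_lessThan] by (auto simp: ksubsets_def)
  have good: "real (card {\<sigma> \<in> sign_patterns I. fails m N \<phi> I \<sigma>}) \<le> ?U"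
    if I: "I \<in> ksubsets {..<N} k" and "I \<notin> B1" "I \<notin> B2" "I \<notin> B3" for I
  proof -
    have I': "I \<subseteq> {..<N}" "card I = k" using I by (auto simp: ksubsets_def)
    have rs: "rows_small N H I \<beta>" and rn: "restricted_norm_le N H I c"
      using that by (auto simp: B1_def B2_def)
    then have lower: "- (1 / 4) * (\<Sum>i\<in>I. (u i)\<^sup>2) \<le> (\<Sum>i\<in>I. \<Sum>j\<in>I. u i * H i j * u j)" for u
      using that by (auto simp: B3_def not_less)
    have "1 / 2 * (\<Sum>i\<in>I. (u i)\<^sup>2) \<le> (\<Sum>i\<in>I. \<Sum>j\<in>I. u i * K i j * u j)" for u
    proof -
      have "(\<Sum>j\<in>I. u i * K i j * u j) = K i i * (u i)\<^sup>2 + (\<Sum>j\<in>I. u i * H i j * u j)" if "i \<in> I" for i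
        using that fin[OF I] by (simp add: sum.remove[of I i] H_def power2_eq_square)
      then have "(\<Sum>i\<in>I. \<Sum>j\<in>I. u i * K i j * u j)
          = (\<Sum>i\<in>I. K i i * (u i)\<^sup>2) + (\<Sum>i\<in>I. \<Sum>j\<in>I. u i * H i j * u j)"
        by (simp add: sum.distrib)
      moreover have "(\<Sum>i\<in>I. 3 / 4 * (u i)\<^sup>2) \<le> (\<Sum>i\<in>I. K i i * (u i)\<^sup>2)"
        using K_diag I' by (intro sum_mono mult_right_mono) auto
      ultimately show ?thesis
        using lower[of u] unfolding sum_distrib_left[symmetric] by linarith
    qed
    moreover have "(\<Sum>i\<in>I. (K j i)\<^sup>2) \<le> \<beta>" if "j < N" "j \<notin> I" for j
    proof -
      have "(\<Sum>i\<in>I. (K j i)\<^sup>2) = (\<Sum>i\<in>I. (H j i)\<^sup>2)"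
        using that by (intro sum.cong) (auto simp: H_def)
      then show ?thesis
        using rs that by (simp add: rows_small_def)
    qed
    ultimately have "injective_on m N \<phi> I"
      "real (card {\<sigma> \<in> sign_patterns I. \<not> certified m N \<phi> I \<sigma>})
        \<le> real N * (2 * 2 ^ card I * exp (- 1 / (8 * \<beta>)))"
      using card_uncertified[where N = N and K = K and m = m and \<phi> = \<phi> and I = I and \<beta> = \<beta>] K_sym K_range K_ker I' \<open>0 < \<beta>\<close> by blast+
    then show ?thesis
      by (simp add: fails_def I')
  qed
  have "real (card (SIGMA I:ksubsets {..<N} k. {\<sigma> \<in> sign_patterns I. fails m N \<phi> I \<sigma>}))
      = (\<Sum>I\<in>ksubsets {..<N} k. real (card {\<sigma> \<in> sign_patterns I. fails m N \<phi> I \<sigma>}))"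
    using fin by (subst card_SigmaI) auto
  also have "\<dots> \<le> (\<Sum>I\<in>ksubsets {..<N} k. ?U + (if I \<in> B1 then 2 ^ k else 0)
      + (if I \<in> B2 then 2 ^ k else 0) + (if I \<in> B3 then 2 ^ k else 0))"
  proof (rule sum_mono)
    fix I assume I: "I \<in> ksubsets {..<N} k"
    have "card {\<sigma> \<in> sign_patterns I. fails m N \<phi> I \<sigma>} \<le> card (sign_patterns I)"
      using fin[OF I] by (intro card_mono) auto
    also have "card (sign_patterns I) = 2 ^ k"
      using fin[OF I] I by (simp add: card_PiE ksubsets_def numeral_2_eq_2)
    finally have "real (card {\<sigma> \<in> sign_patterns I. fails m N \<phi> I \<sigma>}) \<le> real (2 ^ k)"
      by (rule of_nat_mono)
    then have "real (card {\<sigma> \<in> sign_patterns I. fails m N \<phi> I \<sigma>}) \<le> 2 ^ k"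
      by simp
    moreover have "0 \<le> ?U" by simp
    ultimately show "real (card {\<sigma> \<in> sign_patterns I. fails m N \<phi> I \<sigma>})
        \<le> ?U + (if I \<in> B1 then 2 ^ k else 0) + (if I \<in> B2 then 2 ^ k else 0) + (if I \<in> B3 then 2 ^ k else 0)"
      using good[OF I] by (auto simp: add_increasing add_increasing2)
  qed
  also have "\<dots> = ?C * ?U + 2 ^ k * (real (card B1) + real (card B2) + real (card B3))"
  proof -
    have "(\<Sum>I\<in>ksubsets {..<N} k. if I \<in> B then 2 ^ k else 0) = 2 ^ k * real (card B)"
      if "B \<subseteq> ksubsets {..<N} k" for B
      using sum_if_mem[OF finite_ksubsets[OF finite_lessThan] that, of "\<lambda>_. 2 ^ k"] by simp
    moreover have "B1 \<subseteq> ksubsets {..<N} k" "B2 \<subseteq> ksubsets {..<N} k" "B3 \<subseteq> ksubsets {..<N} k"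
      by (auto simp: B1_def B2_def B3_def)
    ultimately show ?thesis
      by (simp add: sum.distrib card_ksubsets algebra_simps)
  qed
  also have "\<dots> \<le> ?C * ?U + 2 ^ k * (?C * (real N * exp (- E)) + ?C * (?T / 27 ^ p) + ?C * (?T / 27 ^ p))"
    by (intro add_left_mono mult_left_mono add_mono B1 B2 B3) auto
  also have "\<dots> = ?C * 2 ^ k * (real N * exp (- E) + 2 * ?T / 27 ^ p + 2 * real N * exp (- 1 / (8 * \<beta>)))"
    by (simp add: algebra_simps)
  finally show ?thesis .
qed

section \<open>Basis pursuit\<close>

lemma bp_recovers_iff:
  assumes A: "A \<in> carrier_mat m N" and x: "x \<in> carrier_vec N"
  shows "bp_recovers A x \<longleftrightarrow>
    (\<forall>z\<in>carrier_vec N. A *\<^sub>v z = A *\<^sub>v x \<longrightarrow> z \<noteq> x \<longrightarrow> l1_norm x < l1_norm z)"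
proof
  assume rec: "bp_recovers A x"
  then have "bp_minimizer A (A *\<^sub>v x) x"
    by (auto simp: bp_recovers_def)
  then have min: "\<not> l1_norm z < l1_norm x" if "z \<in> carrier_vec N" "A *\<^sub>v z = A *\<^sub>v x" for z
    using A that by (auto simp: bp_minimizer_def is_arg_min_def)
  show "\<forall>z\<in>carrier_vec N. A *\<^sub>v z = A *\<^sub>v x \<longrightarrow> z \<noteq> x \<longrightarrow> l1_norm x < l1_norm z"
  proof (intro ballI impI, rule ccontr)
    fix z assume z: "z \<in> carrier_vec N" "A *\<^sub>v z = A *\<^sub>v x" "z \<noteq> x" "\<not> l1_norm x < l1_norm z"
    then have "\<not> l1_norm w < l1_norm z" if "w \<in> carrier_vec N" "A *\<^sub>v w = A *\<^sub>v x" for w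
      using min[OF that] by linarith
    then have "bp_minimizer A (A *\<^sub>v x) z"
      using z A by (auto simp: bp_minimizer_def is_arg_min_def)
    then show False
      using rec z(3) by (auto simp: bp_recovers_def)
  qed
next
  assume less: "\<forall>z\<in>carrier_vec N. A *\<^sub>v z = A *\<^sub>v x \<longrightarrow> z \<noteq> x \<longrightarrow> l1_norm x < l1_norm z"
  have "bp_minimizer A (A *\<^sub>v x) x"
    using less x A by (fastforce simp: bp_minimizer_def is_arg_min_def)
  moreover have "z = x" if "bp_minimizer A (A *\<^sub>v x) z" for z
    using that less x A by (auto simp: bp_minimizer_def is_arg_min_def)
  ultimately show "bp_recovers A x"
    by (auto simp: bp_recovers_def)
qed

lemma mult_mat_vec_index:
  assumes "A \<in> carrier_mat m N" "u \<in> carrier_vec N" "r < m"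
  shows "vec_index (A *\<^sub>v u) r = ip N (\<lambda>i. A $$ (r, i)) (vec_index u)"
  using assms by (simp add: scalar_prod_def ip_def lessThan_atLeast0)

text \<open>The certificate c obtained from h pairs equally with all feasible vectors. A competitor
  z with norm at most that of x has |z|_1 \<le> |x|_1 = <c, x> = <c, z>, while |c| \<le> 1 in every
  entry. So equality holds entrywise, z vanishes off I where |c| < 1, and injectivity on I gives z =
  x.\<close>

lemma bp_recovers_if_certified:
  assumes A: "A \<in> carrier_mat m N" and x: "x \<in> carrier_vec N" and I: "I \<subseteq> {..<N}"
    and off: "\<And>i. i < N \<Longrightarrow> i \<notin> I \<Longrightarrow> vec_index x i = 0"
    and sgn: "\<And>i. i \<in> I \<Longrightarrow> sgn (vec_index x i) = \<sigma> i"
    and inj: "injective_on m N (\<lambda>r i. A $$ (r, i)) I"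
    and cert: "certified m N (\<lambda>r i. A $$ (r, i)) I \<sigma>"
  shows "bp_recovers A x"
  unfolding bp_recovers_iff[OF A x]
proof (intro ballI impI, rule ccontr)
  fix z assume z: "z \<in> carrier_vec N" "A *\<^sub>v z = A *\<^sub>v x" "z \<noteq> x" "\<not> l1_norm x < l1_norm z"
  let ?\<phi> = "\<lambda>r i. A $$ (r, i)"
  obtain h where h: "\<And>i. i \<in> I \<Longrightarrow> (\<Sum>r<m. ?\<phi> r i * h r) = \<sigma> i"
    and h_off: "\<And>j. j < N \<Longrightarrow> j \<notin> I \<Longrightarrow> \<bar>\<Sum>r<m. ?\<phi> r j * h r\<bar> < 1"
    using cert by (auto simp: certified_def)
  define c where "c = (\<lambda>j. \<Sum>r<m. ?\<phi> r j * h r)"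
  have pair: "(\<Sum>j<N. c j * vec_index u j) = (\<Sum>r<m. h r * vec_index (A *\<^sub>v u) r)" if "u \<in> carrier_vec N" for u
  proof -
    have "(\<Sum>r<m. h r * vec_index (A *\<^sub>v u) r) = (\<Sum>r<m. \<Sum>j<N. ?\<phi> r j * h r * vec_index u j)"
      using mult_mat_vec_index[OF A that] by (simp add: ip_def sum_distrib_left mult_ac)
    then show ?thesis
      by (simp add: c_def sum_distrib_right sum.swap[of _ "{..<m}"])
  qed
  have xs: "\<bar>vec_index x j\<bar> = c j * vec_index x j" if "j < N" for j
    using off[OF that] sgn[of j] h[of j] by (cases "j \<in> I") (auto simp: c_def abs_sgn mult.commute)
  have c_le: "\<bar>c j\<bar> \<le> 1" if "j < N" for j
  proof (cases "j \<in> I")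
    case True
    then show ?thesis
      using sgn[OF True] h[OF True] by (auto simp: c_def sgn_if abs_if split: if_splits)
  next
    case False
    then show ?thesis using h_off[OF that] by (simp add: c_def)
  qed
  have cz: "c j * vec_index z j \<le> \<bar>vec_index z j\<bar>" if "j < N" for j
  proof -
    have "c j * vec_index z j \<le> \<bar>c j\<bar> * \<bar>vec_index z j\<bar>"
      by (simp flip: abs_mult)
    also have "\<dots> \<le> 1 * \<bar>vec_index z j\<bar>"
      using c_le[OF that] by (intro mult_right_mono) auto
    finally show ?thesis by simp
  qed
  have "(\<Sum>j<N. \<bar>vec_index z j\<bar> - c j * vec_index z j) \<le> 0"
  proof -
    have "(\<Sum>j<N. \<bar>vec_index z j\<bar>) \<le> (\<Sum>j<N. \<bar>vec_index x j\<bar>)"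
      using z x by (simp add: l1_norm_def)
    also have "\<dots> = (\<Sum>j<N. c j * vec_index x j)"
      by (intro sum.cong) (auto simp: xs)
    also have "\<dots> = (\<Sum>j<N. c j * vec_index z j)"
      using pair[OF x] pair[OF z(1)] z(2) by simp
    finally show ?thesis by (simp add: sum_subtractf)
  qed
  moreover have "0 \<le> (\<Sum>j<N. \<bar>vec_index z j\<bar> - c j * vec_index z j)"
    by (intro sum_nonneg) (simp add: cz)
  ultimately have "(\<Sum>j<N. \<bar>vec_index z j\<bar> - c j * vec_index z j) = 0"
    by linarith
  then have eq: "\<bar>vec_index z j\<bar> = c j * vec_index z j" if "j < N" for j
    using cz that by (subst (asm) sum_nonneg_eq_0_iff) auto
  have z_off: "vec_index z j = 0" if j: "j < N" "j \<notin> I" for j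
  proof (rule ccontr)
    assume "vec_index z j \<noteq> 0"
    then have "\<bar>c j\<bar> * \<bar>vec_index z j\<bar> < 1 * \<bar>vec_index z j\<bar>"
      using h_off[OF j] by (intro mult_strict_right_mono) (auto simp: c_def)
    moreover have "\<bar>vec_index z j\<bar> \<le> \<bar>c j\<bar> * \<bar>vec_index z j\<bar>"
      using eq[OF j(1)] abs_ge_self[of "c j * vec_index z j"] unfolding abs_mult by linarith
    ultimately show False
      by linarith
  qed
  define u where "u = (\<lambda>i. if i < N then vec_index z i - vec_index x i else 0)"
  have "ip N (?\<phi> r) u = 0" if "r < m" for r
  proof -
    have "ip N (?\<phi> r) u = ip N (?\<phi> r) (vec_index z) - ip N (?\<phi> r) (vec_index x)"
      by (simp add: ip_def u_def right_diff_distrib sum_subtractf)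
    then show ?thesis
      using mult_mat_vec_index[OF A z(1) that] mult_mat_vec_index[OF A x that] z(2) by simp
  qed
  moreover have "u i = 0" if "i \<notin> I" for i
    using z_off off that by (simp add: u_def)
  ultimately have "u i = 0" if "i \<in> I" for i
    using inj that unfolding injective_on_def by blast
  then have "u i = 0" for i
    using \<open>\<And>i. i \<notin> I \<Longrightarrow> u i = 0\<close> by blast
  then have "vec_index z i = vec_index x i" if "i < N" for i
    using that by (metis u_def eq_iff_diff_eq_0)
  then have "z = x"
    using z(1) x by (intro eq_vecI) auto
  then show False using z(3) by simp
qed

text \<open>
  Near a vector the \<open>l1\<close> norm varies by an amount that depends on the signs of its entries only,
  and by convexity unique minimality is a local property.
\<close>

lemma bp_recovers_cong_sgn:
  assumes A: "A \<in> carrier_mat m N" and x: "x \<in> carrier_vec N" and y: "y \<in> carrier_vec N"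
    and sgn: "\<And>i. i < N \<Longrightarrow> sgn (vec_index x i) = sgn (vec_index y i)"
    and rec: "bp_recovers A x"
  shows "bp_recovers A y"
  unfolding bp_recovers_iff[OF A y]
proof (intro ballI impI, rule ccontr)
  fix w assume w: "w \<in> carrier_vec N" "A *\<^sub>v w = A *\<^sub>v y" "w \<noteq> y" "\<not> l1_norm y < l1_norm w"
  define d where "d = w - y"
  have d: "d \<in> carrier_vec N" using w y by (simp add: d_def)
  have di: "vec_index d i = vec_index w i - vec_index y i" if "i < N" for i
    using w(1) y that by (simp add: d_def)
  have Ad: "A *\<^sub>v d = 0\<^sub>v m"
    using mult_minus_distrib_mat_vec[OF A w(1) y] w(2) A y by (simp add: d_def)
  let ?S = "{i. i < N \<and> vec_index x i \<noteq> 0}"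
  \<comment> \<open>The step t is so short that neither x + t d nor y + t d crosses zero on the
    common support. The + 1 guards against a zero entry of d; the inserted 1 gives t \<le> 1, also
    when the support is empty.\<close>
  define b where "b = (\<lambda>i. min \<bar>vec_index x i\<bar> \<bar>vec_index y i\<bar> / (\<bar>vec_index d i\<bar> + 1))"
  define t where "t = Min (insert 1 (b ` ?S))"
  have fin: "finite (insert 1 (b ` ?S))" by simp
  have b_pos: "0 < b i" if "i \<in> ?S" for i
    using that sgn[of i] by (auto simp: b_def sgn_zero_iff intro!: divide_pos_pos)
  have "0 < t"
    unfolding t_def using fin b_pos by (subst Min_gr_iff) auto
  have "t \<le> 1"
    unfolding t_def using fin by (intro Min_le) auto
  have t_le: "t * \<bar>vec_index d i\<bar> \<le> min \<bar>vec_index x i\<bar> \<bar>vec_index y i\<bar>" if "i \<in> ?S" for i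
  proof -
    have "t \<le> b i"
      unfolding t_def using fin that by (intro Min_le) auto
    then have "t * \<bar>vec_index d i\<bar> \<le> b i * (\<bar>vec_index d i\<bar> + 1)"
      using b_pos[OF that] \<open>0 < t\<close> by (intro mult_mono) auto
    also have "\<dots> = min \<bar>vec_index x i\<bar> \<bar>vec_index y i\<bar>"
      unfolding b_def by (simp add: add_nonneg_eq_0_iff)
    finally show ?thesis .
  qed
  define x' where "x' = x + t \<cdot>\<^sub>v d"
  have x': "x' \<in> carrier_vec N" using x d by (simp add: x'_def)
  have x'i: "vec_index x' i = vec_index x i + t * vec_index d i" if "i < N" for i
    using x d that by (simp add: x'_def)
  have "t \<cdot>\<^sub>v 0\<^sub>v m = 0\<^sub>v m"
    by (intro eq_vecI) auto
  then have "A *\<^sub>v x' = A *\<^sub>v x"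
    using mult_add_distrib_mat_vec[OF A x, of "t \<cdot>\<^sub>v d"] mult_mat_vec[OF A d] A x d Ad
    by (simp add: x'_def)
  moreover have "x' \<noteq> x"
  proof
    assume "x' = x"
    then have "vec_index d i = 0" if "i < N" for i
      using x'i[OF that] \<open>0 < t\<close> by simp
    then have "w = y"
      using w(1) y di by (intro eq_vecI) auto
    then show False using w(3) by simp
  qed
  ultimately have "l1_norm x < l1_norm x'"
    using rec x' unfolding bp_recovers_iff[OF A x] by blast
  have change: "\<bar>vec_index x' i\<bar> - \<bar>vec_index x i\<bar> = \<bar>vec_index y i + t * vec_index d i\<bar> - \<bar>vec_index y i\<bar>"
    if "i < N" for i
  proof (cases "vec_index x i = 0")
    case True
    then have "vec_index y i = 0" using sgn[OF that] by (simp add: sgn_zero_iff)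
    then show ?thesis using True x'i[OF that] by simp
  next
    case False
    then have "\<bar>t * vec_index d i\<bar> \<le> \<bar>vec_index x i\<bar>" "\<bar>t * vec_index d i\<bar> \<le> \<bar>vec_index y i\<bar>"
      using t_le[of i] that \<open>0 < t\<close> by (auto simp: abs_mult)
    then show ?thesis
      using sgn[OF that] False x'i[OF that] by (auto simp: sgn_if abs_if split: if_splits)
  qed
  have conv: "\<bar>vec_index y i + t * vec_index d i\<bar> - \<bar>vec_index y i\<bar> \<le> t * (\<bar>vec_index w i\<bar> - \<bar>vec_index y i\<bar>)"
    if "i < N" for i
  proof -
    have "vec_index y i + t * vec_index d i = (1 - t) * vec_index y i + t * vec_index w i"
      by (simp add: di[OF that] algebra_simps)
    also have "\<bar>\<dots>\<bar> \<le> \<bar>(1 - t) * vec_index y i\<bar> + \<bar>t * vec_index w i\<bar>"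
      by (rule abs_triangle_ineq)
    also have "\<dots> = (1 - t) * \<bar>vec_index y i\<bar> + t * \<bar>vec_index w i\<bar>"
      using \<open>0 < t\<close> \<open>t \<le> 1\<close> by (simp add: abs_mult)
    finally show ?thesis by (simp add: algebra_simps)
  qed
  have "l1_norm x' - l1_norm x = (\<Sum>i<N. \<bar>vec_index x' i\<bar> - \<bar>vec_index x i\<bar>)"
    using x x' by (simp add: l1_norm_def sum_subtractf)
  also have "\<dots> \<le> (\<Sum>i<N. t * (\<bar>vec_index w i\<bar> - \<bar>vec_index y i\<bar>))"
    using change conv by (intro sum_mono) auto
  also have "\<dots> = t * (l1_norm w - l1_norm y)"
    using w(1) y by (simp add: l1_norm_def sum_subtractf flip: sum_distrib_left)
  also have "\<dots> \<le> 0"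
    using w(4) \<open>0 < t\<close> by (simp add: mult_le_0_iff)
  finally show False
    using \<open>l1_norm x < l1_norm x'\<close> by simp
qed

section \<open>From counting to probability\<close>

lemma sgn_event_measurable:
  fixes f :: "'w \<Rightarrow> real"
  assumes [measurable]: "f \<in> borel_measurable M"
  shows "{\<omega> \<in> space M. sgn (f \<omega>) = c} \<in> sets M"
  unfolding sgn_if by measurable

text \<open>Recovery depends only on the sign vector, which takes finitely many values, so the event
  is a finite union of sign events. Measurability is essential for a lower bound, since a
  nonmeasurable set is assigned measure 0.\<close>

lemma bp_recovers_measurable:
  assumes A: "A \<in> carrier_mat m N"
    and X: "\<And>\<omega>. \<omega> \<in> space M \<Longrightarrow> X \<omega> \<in> carrier_vec N"
    and meas: "\<And>i. i < N \<Longrightarrow> (\<lambda>\<omega>. vec_index (X \<omega>) i) \<in> borel_measurable M"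
  shows "{\<omega> \<in> space M. bp_recovers A (X \<omega>)} \<in> sets M"
proof -
  define S where "S = (\<lambda>\<omega>. \<lambda>i\<in>{..<N}. sgn (vec_index (X \<omega>) i))"
  let ?T = "{\<tau> \<in> {..<N} \<rightarrow>\<^sub>E {-1, 0, 1 :: real}. \<exists>\<omega>\<in>space M. S \<omega> = \<tau> \<and> bp_recovers A (X \<omega>)}"
  have "{\<omega> \<in> space M. bp_recovers A (X \<omega>)}
      = (\<Union>\<tau>\<in>?T. {\<omega> \<in> space M. \<forall>i\<in>{..<N}. sgn (vec_index (X \<omega>) i) = \<tau> i})"
    (is "?L = ?R")
  proof (intro equalityI subsetI)
    fix \<omega> assume \<omega>: "\<omega> \<in> ?L"
    have "S \<omega> \<in> ?T"
      using \<omega> by (auto simp: S_def sgn_if)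
    moreover have "\<forall>i\<in>{..<N}. sgn (vec_index (X \<omega>) i) = S \<omega> i"
      by (simp add: S_def)
    ultimately show "\<omega> \<in> ?R"
      using \<omega> by blast
  next
    fix \<omega> assume "\<omega> \<in> ?R"
    then obtain \<omega>' where "\<omega> \<in> space M" "\<omega>' \<in> space M" "bp_recovers A (X \<omega>')"
      and "\<forall>i\<in>{..<N}. sgn (vec_index (X \<omega>) i) = S \<omega>' i"
      by auto
    then show "\<omega> \<in> ?L"
      using bp_recovers_cong_sgn[OF A X X, of \<omega>' \<omega>] by (simp add: S_def)
  qed
  also have "\<dots> \<in> sets M"
  proof (rule sets.finite_UN)
    have "finite ({..<N} \<rightarrow>\<^sub>E {-1, 0, 1 :: real})"
      by (intro finite_PiE) auto
    then show "finite ?T" by simp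
    show "{\<omega> \<in> space M. \<forall>i\<in>{..<N}. sgn (vec_index (X \<omega>) i) = \<tau> i} \<in> sets M" for \<tau>
      using sgn_event_measurable[OF meas] by (intro sets.sets_Collect_finite_All) auto
  qed
  finally show ?thesis .
qed

text \<open>Pairs (J, \<sigma>) index disjoint events of equal probability, so the proportion of
  failing pairs bounds the probability of failure. On the event of a pair all k coordinates in J are
  nonzero, and k-sparsity makes J the whole support.\<close>

lemma prob_bp_recovers_ge:
  assumes A: "A \<in> carrier_mat m N" and "k \<le> N"
    and signal: "generic_signal M N k X" and sparse: "AE \<omega> in M. sparse_vec k (X \<omega>)"
    and count: "real (card (SIGMA J:ksubsets {..<N} k. {\<sigma> \<in> sign_patterns J. fails m N (\<lambda>r i. A $$ (r, i)) J \<sigma>}))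
      \<le> real (N choose k) * 2 ^ k * \<epsilon>"
  shows "\<P>(\<omega> in M. bp_recovers A (X \<omega>)) \<ge> 1 - \<epsilon>"
proof -
  interpret prob_space M
    using signal by (simp add: generic_signal_def)
  have X: "X \<omega> \<in> carrier_vec N" if "\<omega> \<in> space M" for \<omega>
    using signal that by (simp add: generic_signal_def)
  have meas: "(\<lambda>\<omega>. vec_index (X \<omega>) i) \<in> borel_measurable M" if "i < N" for i
    using signal that by (simp add: generic_signal_def)
  obtain I where I: "I \<in> measurable M (count_space (Pow {..<N}))"
    and law: "\<forall>J. J \<subseteq> {..<N} \<and> card J = k \<longrightarrow>
           \<P>(\<omega> in M. I \<omega> = J) = 1 / real (N choose k) \<and>
           (\<forall>\<sigma>\<in>sign_patterns J.
              \<P>(\<omega> in M. (\<forall>i\<in>J. sgn (vec_index (X \<omega>) i) = \<sigma> i) \<bar> I \<omega> = J) = (1 / 2) ^ k)"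
    using signal unfolding generic_signal_def by (elim conjE exE)
  have uniform: "\<P>(\<omega> in M. I \<omega> = J) = 1 / real (N choose k)" if "J \<subseteq> {..<N}" "card J = k" for J
    using law that by blast
  have signs: "\<P>(\<omega> in M. (\<forall>i\<in>J. sgn (vec_index (X \<omega>) i) = \<sigma> i) \<bar> I \<omega> = J) = (1 / 2) ^ k"
    if "J \<subseteq> {..<N}" "card J = k" "\<sigma> \<in> sign_patterns J" for J \<sigma>
    using law that by blast
  define E where "E = (\<lambda>(J, \<sigma>). {\<omega> \<in> space M. (\<forall>i\<in>J. sgn (vec_index (X \<omega>) i) = \<sigma> i) \<and> I \<omega> = J})"
  define P where "P = (SIGMA J:ksubsets {..<N} k. sign_patterns J)"
  define F where "F = (SIGMA J:ksubsets {..<N} k. {\<sigma> \<in> sign_patterns J. fails m N (\<lambda>r i. A $$ (r, i)) J \<sigma>})"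
  have fin: "finite J" if "J \<in> ksubsets {..<N} k" for J
    using that finite_subset[OF _ finite_lessThan] by (auto simp: ksubsets_def)
  have finP: "finite P"
    unfolding P_def using fin by (intro finite_SigmaI) auto
  have FP: "F \<subseteq> P" by (auto simp: F_def P_def)
  have "card (sign_patterns J) = 2 ^ k" if "J \<in> ksubsets {..<N} k" for J
    using fin[OF that] that by (simp add: card_PiE ksubsets_def numeral_2_eq_2)
  then have cardP: "card P = (N choose k) * 2 ^ k"
    unfolding P_def using fin by (subst card_SigmaI) (auto simp: card_ksubsets)
  have C: "0 < real (N choose k)" using \<open>k \<le> N\<close> by simp
  have E_sets: "E q \<in> sets M" if "q \<in> P" for q
  proof -
    obtain J \<sigma> where "q = (J, \<sigma>)" and J: "J \<in> ksubsets {..<N} k"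
      using \<open>q \<in> P\<close> by (auto simp: P_def)
    then have q: "q = (J, \<sigma>)" "J \<subseteq> {..<N}" "finite J"
      using fin[OF J] by (auto simp: ksubsets_def)
    have "{\<omega> \<in> space M. I \<omega> = J} = I -` {J} \<inter> space M" by auto
    also have "\<dots> \<in> sets M"
      using q by (intro measurable_sets[OF I]) simp
    finally have "{\<omega> \<in> space M. I \<omega> = J} \<in> sets M" .
    moreover have "{\<omega> \<in> space M. \<forall>i\<in>J. sgn (vec_index (X \<omega>) i) = \<sigma> i} \<in> sets M"
      using q by (intro sets.sets_Collect_finite_All sgn_event_measurable meas) auto
    ultimately show ?thesis
      unfolding q E_def prod.case by (intro sets.sets_Collect_conj)
  qed
  have E_prob: "prob (E q) = (1 / 2) ^ k / real (N choose k)" if "q \<in> P" for q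
  proof -
    obtain J \<sigma> where q: "q = (J, \<sigma>)" "J \<subseteq> {..<N}" "card J = k" "\<sigma> \<in> sign_patterns J"
      using \<open>q \<in> P\<close> by (auto simp: P_def ksubsets_def)
    show ?thesis
      using signs[OF q(2-4)] uniform[OF q(2,3)] C by (simp add: cond_prob_def q(1) E_def field_simps)
  qed
  have disj: "disjoint_family_on E (P - F)"
    unfolding disjoint_family_on_def
  proof (intro ballI impI)
    fix q q' assume q: "q \<in> P - F" "q' \<in> P - F" "q \<noteq> q'"
    obtain J \<sigma> J' \<sigma>' where [simp]: "q = (J, \<sigma>)" "q' = (J', \<sigma>')"
      by (metis surj_pair)
    show "E q \<inter> E q' = {}"
    proof (rule ccontr)
      assume "E q \<inter> E q' \<noteq> {}"
      then have "J = J'" "\<forall>i\<in>J. \<sigma> i = \<sigma>' i"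
        by (auto simp: E_def)
      then have "\<sigma> = \<sigma>'"
        using q by (intro PiE_ext[of \<sigma> J "\<lambda>_. {1, -1}" \<sigma>']) (auto simp: P_def)
      then show False using q(3) \<open>J = J'\<close> by simp
    qed
  qed
  have "prob (\<Union>q\<in>P - F. E q) = (\<Sum>q\<in>P - F. prob (E q))"
    using finP E_sets disj by (intro finite_measure_finite_Union) auto
  also have "\<dots> = real (card (P - F)) * ((1 / 2) ^ k / real (N choose k))"
    by (simp add: E_prob)
  also have "real (card (P - F)) = real (N choose k) * 2 ^ k - real (card F)"
    using FP finP finite_subset[OF FP finP] card_mono[OF finP FP]
    by (simp add: card_Diff_subset of_nat_diff cardP)
  also have "\<dots> * ((1 / 2) ^ k / real (N choose k)) = 1 - real (card F) / (real (N choose k) * 2 ^ k)"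
    using C by (simp add: field_simps power_divide)
  also have "\<dots> \<ge> 1 - \<epsilon>"
    using count C by (simp add: F_def divide_le_eq mult_ac)
  finally have lower: "1 - \<epsilon> \<le> prob (\<Union>q\<in>P - F. E q)" .
  have "prob (\<Union>q\<in>P - F. E q) \<le> prob {\<omega> \<in> space M. bp_recovers A (X \<omega>)}"
  proof (rule finite_measure_mono_AE)
    show "{\<omega> \<in> space M. bp_recovers A (X \<omega>)} \<in> sets M"
      by (rule bp_recovers_measurable[OF A X meas])
    show "AE \<omega> in M. \<omega> \<in> (\<Union>q\<in>P - F. E q) \<longrightarrow> \<omega> \<in> {\<omega> \<in> space M. bp_recovers A (X \<omega>)}"
      using sparse
    proof eventually_elim
      case (elim \<omega>)
      show ?case
      proof
        assume "\<omega> \<in> (\<Union>q\<in>P - F. E q)"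
        then obtain J \<sigma> where q: "(J, \<sigma>) \<in> P" "(J, \<sigma>) \<notin> F"
          and \<omega>: "\<omega> \<in> space M" "\<forall>i\<in>J. sgn (vec_index (X \<omega>) i) = \<sigma> i"
          by (auto simp: E_def)
        have J: "J \<subseteq> {..<N}" "card J = k" and \<sigma>: "\<sigma> \<in> sign_patterns J"
          using q by (auto simp: P_def ksubsets_def)
        have nf: "\<not> fails m N (\<lambda>r i. A $$ (r, i)) J \<sigma>"
          using q by (auto simp: P_def F_def)
        let ?S = "{i. i < N \<and> vec_index (X \<omega>) i \<noteq> 0}"
        have "J \<subseteq> ?S"
        proof
          fix i assume i: "i \<in> J"
          then have "\<sigma> i \<noteq> 0" using \<sigma> by (fastforce simp: PiE_iff)
          then show "i \<in> ?S" using \<omega> i J by (auto simp: sgn_zero_iff)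
        qed
        moreover have "card ?S \<le> card J"
          using elim X[OF \<omega>(1)] J by (simp add: sparse_vec_def)
        ultimately have "J = ?S"
          by (intro card_seteq) auto
        then have "vec_index (X \<omega>) i = 0" if "i < N" "i \<notin> J" for i
          using that by auto
        then have "bp_recovers A (X \<omega>)"
          using bp_recovers_if_certified[OF A X[OF \<omega>(1)] J(1)] \<omega> nf by (auto simp: fails_def)
        then show "\<omega> \<in> {\<omega> \<in> space M. bp_recovers A (X \<omega>)}"
          using \<omega> by simp
      qed
    qed
  qed
  then show ?thesis
    using lower by simp
qed

section \<open>Asymptotics\<close>

text \<open>The square of m^(-1/4) is 1 / sqrt m, and m is at least k L^3 / C3.\<close>

lemma coherence_scale_square_le:
  fixes a C3 L :: real and k m :: nat
  assumes "0 < C3" "1 \<le> L" "1 \<le> k" and kL: "real k * L ^ 3 \<le> C3 * real m"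
  shows "(a * real m powr (- 1 / 4))\<^sup>2 \<le> a\<^sup>2 * sqrt C3 / (sqrt (real k) * (L * sqrt L))"
proof -
  have "0 < real k * L ^ 3" using assms by simp
  then have "0 < real m"
    using kL \<open>0 < C3\<close> by (smt (verit) mult_nonneg_nonpos of_nat_0_le_iff zero_less_mult_iff)
  have "(real m powr (- 1 / 4))\<^sup>2 = real m powr (- 1 / 2)"
    by (simp add: power2_eq_square flip: powr_add)
  also have "\<dots> = 1 / sqrt (real m)"
    using \<open>0 < real m\<close> by (simp add: powr_minus_divide powr_half_sqrt)
  finally have m: "(real m powr (- 1 / 4))\<^sup>2 = 1 / sqrt (real m)" .
  have "sqrt (L ^ 3) = L * sqrt L"
    using \<open>1 \<le> L\<close> by (simp add: power3_eq_cube real_sqrt_mult)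
  then have "sqrt (real k) * (L * sqrt L) \<le> sqrt C3 * sqrt (real m)"
    using real_sqrt_le_mono[OF kL] by (simp add: real_sqrt_mult)
  then have "1 / sqrt (real m) \<le> sqrt C3 / (sqrt (real k) * (L * sqrt L))"
    using assms \<open>0 < real m\<close> by (simp add: field_simps)
  then have "a\<^sup>2 * (1 / sqrt (real m)) \<le> a\<^sup>2 * (sqrt C3 / (sqrt (real k) * (L * sqrt L)))"
    by (intro mult_left_mono) auto
  then show ?thesis
    by (simp only: power_mult_distrib m times_divide_eq_right)
qed

text \<open>Here \<epsilon> = N exp (- L), and each term is at most N exp (- 3 L) times a factor
  linear in L, because 27^p \<ge> exp (3 L). The spare exp (- 2 L) absorbs these factors.\<close>

lemma failure_terms_le:
  fixes L :: real and N k p :: nat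
  assumes "0 < \<epsilon>" "0 < N" and L: "L = ln (real N / \<epsilon>)" "1 \<le> L"
    and "k \<le> N" and p: "L \<le> real p" "real p \<le> 2 * L"
    and e: "(5 + 4 * L) * exp (- (2 * L)) \<le> 1"
  shows "real N * exp (- (3 * L)) + 2 * (real N + real k * real p) / 27 ^ p + 2 * real N * exp (- (2500 * L)) \<le> \<epsilon>"
proof -
  have "exp L = real N / \<epsilon>"
    using assms by simp
  then have \<epsilon>: "\<epsilon> = real N * exp (- L)"
    using \<open>0 < \<epsilon>\<close> \<open>0 < N\<close> by (simp add: exp_minus field_simps)
  have "exp (3 * L) \<le> exp (real p * 3)"
    using p by simp
  also have "\<dots> = exp 3 ^ p"
    by (rule exp_of_nat_mult)
  also have "exp (3 :: real) = exp 1 ^ 3"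
    using exp_of_nat_mult[of 3 "1 :: real"] by simp
  also have "(exp 1 ^ 3) ^ p \<le> (27 :: real) ^ p"
    using power_mono[OF exp_le, of 3] by (intro power_mono) auto
  finally have p27: "exp (3 * L) \<le> 27 ^ p" .
  have "real k * real p \<le> real N * (2 * L)"
    using \<open>k \<le> N\<close> p by (intro mult_mono) auto
  then have "2 * (real N + real k * real p) / 27 ^ p \<le> 2 * (real N + real N * (2 * L)) / exp (3 * L)"
    using p27 L(2) by (intro frac_le) (auto simp: mult_ac)
  also have "\<dots> = real N * (2 + 4 * L) * exp (- (3 * L))"
    by (simp add: exp_minus field_simps)
  finally have t2: "2 * (real N + real k * real p) / 27 ^ p \<le> real N * (2 + 4 * L) * exp (- (3 * L))" .
  have "real N * exp (- (2500 * L)) \<le> real N * exp (- (3 * L))"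
    using L(2) by (intro mult_left_mono) auto
  then have "2 * real N * exp (- (2500 * L)) \<le> real N * 2 * exp (- (3 * L))"
    by linarith
  then have "real N * exp (- (3 * L)) + 2 * (real N + real k * real p) / 27 ^ p + 2 * real N * exp (- (2500 * L))
      \<le> real N * exp (- (3 * L)) + real N * (2 + 4 * L) * exp (- (3 * L)) + real N * 2 * exp (- (3 * L))"
    using t2 by linarith
  also have "\<dots> = real N * exp (- L) * ((5 + 4 * L) * exp (- (2 * L)))"
    by (simp add: algebra_simps mult_exp_exp)
  also have "\<dots> \<le> real N * exp (- L) * 1"
    by (intro mult_left_mono e) auto
  finally show ?thesis
    by (simp add: \<epsilon>)
qed

text \<open>The unknown constants are gathered as follows: k (1 + \<rho>) \<le> (D / L^3) N, the
  squared coherence is at most M / (sqrt k L^(3/2)), and squared entries off the diagonal are at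
  most Q / L^2 once sqrt k > \<kappa> sqrt L. For fixed constants, \<open>e1\<close> to
  \<open>e9\<close> are conditions on L alone.\<close>

lemma card_failures_le:
  fixes \<phi> :: "nat \<Rightarrow> nat \<Rightarrow> real" and k N m :: nat and \<epsilon> C1 C2 C3 :: real
  defines "L \<equiv> ln (real N / \<epsilon>)"
  defines "D \<equiv> (1 + C2) * C3"
  defines "M \<equiv> C1\<^sup>2 * sqrt C3"
  defines "\<kappa> \<equiv> 1 / (80000 * (M + 1))"
  defines "Q \<equiv> 2 * M / \<kappa> + 1"
  assumes pos: "0 < C1" "0 < C2" "0 < C3" "0 < \<epsilon>" and dims: "m \<le> N" "1 \<le> k" "k \<le> N"
    and unit: "\<And>i. i < N \<Longrightarrow> gram m \<phi> i i = 1"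
    and off: "\<And>i j. i < N \<Longrightarrow> j < N \<Longrightarrow> i \<noteq> j \<Longrightarrow> \<bar>gram m \<phi> i j\<bar> \<le> C1 * real m powr (- 1 / 4)"
    and row: "\<And>i. i < N \<Longrightarrow> (\<Sum>j\<in>{..<N} - {i}. (gram m \<phi> i j)\<^sup>2) \<le> C2 * real N / real m"
    and kL: "real k * L ^ 3 \<le> C3 * real m"
    and e1: "10 ^ 4 * D / L ^ 3 \<le> 1 / 4" and e2: "2 * D / L ^ 2 \<le> 1 / 10 ^ 7" and e3: "2 * C3 / L ^ 3 \<le> 1"
    and e4: "3 \<le> L" and e5: "2 * 10 ^ 8 * D\<^sup>2 * \<kappa>\<^sup>2 / L ^ 5 \<le> 1 / (40000 * L)"
    and e6: "2 * 10 ^ 8 * D\<^sup>2 / L ^ 6 \<le> 1 / L\<^sup>2" and e7: "1 \<le> L\<^sup>2 / (20000 * D)"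
    and e8: "60000 * Q \<le> ln (L\<^sup>2 / (20000 * D)) - 1" and e9: "(5 + 4 * L) * exp (- (2 * L)) \<le> 1"
  shows "real (card (SIGMA I:ksubsets {..<N} k. {\<sigma> \<in> sign_patterns I. fails m N \<phi> I \<sigma>}))
      \<le> real (N choose k) * 2 ^ k * \<epsilon>"
proof -
  define \<mu> where "\<mu> = C1 * real m powr (- 1 / 4)"
  define \<rho> where "\<rho> = C2 * real N / real m"
  define s where "s = 10 ^ 4 * real k / real N"
  \<comment> \<open>This makes p \<beta> at most 1 / 10^4, below the required 1/6912, and turns 1 /
    (8 \<beta>) into 2500 L.\<close>
  define \<beta> where "\<beta> = 1 / (20000 * L)"
  define p where "p = nat \<lceil>L\<rceil>"
  define \<delta> where "\<delta> = s * (1 + \<rho>)"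
  \<comment> \<open>Chosen so that R times the bound (D / L^3) N equals \<beta> N.\<close>
  define R where "R = L\<^sup>2 / (20000 * D)"
  have "0 < L" using e4 by simp
  have "0 < N" using dims by simp
  have D: "0 < D" using pos by (simp add: D_def)
  have M: "0 < M" using pos by (simp add: M_def)
  then have \<kappa>: "0 < \<kappa>" by (simp add: \<kappa>_def)
  then have Q: "0 < Q" using M by (simp add: Q_def add_pos_pos)
  have "0 < real k * L ^ 3" using dims \<open>0 < L\<close> by simp
  then have m: "0 < real m"
    using kL pos by (smt (verit) mult_nonneg_nonpos of_nat_0_le_iff zero_less_mult_iff)
  have p: "L \<le> real p" "real p \<le> 2 * L"
    using e4 unfolding p_def by linarith+
  then have "3 \<le> p" using e4 by linarith
  have km: "real k / real m \<le> C3 / L ^ 3"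
    using kL m \<open>0 < L\<close> by (simp add: divide_simps mult_ac)
  \<comment> \<open>The 1 comes from the diagonal of the Gram matrix; m \<le> N merges it into the
    term N / m.\<close>
  have \<rho>1: "1 + \<rho> \<le> (1 + C2) * real N / real m"
    using dims m by (simp add: \<rho>_def field_simps)
  have "0 \<le> \<rho>" using pos by (simp add: \<rho>_def)
  have "real k * (1 + \<rho>) \<le> real k * ((1 + C2) * real N / real m)"
    using \<rho>1 by (intro mult_left_mono) auto
  also have "\<dots> = (1 + C2) * real N * (real k / real m)"
    by simp
  also have "\<dots> \<le> (1 + C2) * real N * (C3 / L ^ 3)"
    using km pos by (intro mult_left_mono) auto
  also have "\<dots> = D / L ^ 3 * real N"
    by (simp add: D_def)
  finally have k\<rho>: "real k * (1 + \<rho>) \<le> D / L ^ 3 * real N" .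
  have "\<delta> = 10 ^ 4 * (real k * (1 + \<rho>)) / real N"
    by (simp add: \<delta>_def s_def)
  also have "\<dots> \<le> 10 ^ 4 * (D / L ^ 3 * real N) / real N"
    using k\<rho> by (intro divide_right_mono mult_left_mono) auto
  finally have \<delta>: "\<delta> \<le> 10 ^ 4 * D / L ^ 3"
    using \<open>0 < N\<close> by simp
  have "0 < \<delta>"
    using \<open>0 \<le> \<rho>\<close> dims \<open>0 < N\<close> by (simp add: \<delta>_def s_def)
  have \<beta>: "0 < \<beta>" using \<open>0 < L\<close> by (simp add: \<beta>_def)
  have "(\<mu> + \<delta>)\<^sup>2 \<le> 2 * \<mu>\<^sup>2 + 2 * \<delta>\<^sup>2"
    using zero_le_power2[of "\<mu> - \<delta>"] by (simp add: power2_eq_square algebra_simps)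
  also have "\<delta>\<^sup>2 \<le> (10 ^ 4 * D / L ^ 3)\<^sup>2"
    using \<delta> \<open>0 < \<delta>\<close> by (intro power_mono) auto
  also have "\<mu>\<^sup>2 \<le> M / (sqrt (real k) * (L * sqrt L))"
    unfolding \<mu>_def M_def using pos e4 dims kL by (intro coherence_scale_square_le) auto
  finally have \<alpha>: "(\<mu> + \<delta>)\<^sup>2 \<le> 2 * (M / (sqrt (real k) * (L * sqrt L))) + 2 * 10 ^ 8 * D\<^sup>2 / L ^ 6"
    by (simp add: power_divide power_mult_distrib flip: power_mult)
  have \<alpha>_pos: "0 < (\<mu> + \<delta>)\<^sup>2"
    using \<open>0 < \<delta>\<close> pos by (intro zero_less_power add_nonneg_pos) (simp_all add: \<mu>_def)
  have h4: "real k * (\<mu> + \<delta>)\<^sup>2 \<le> \<beta> \<or>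
      (1 \<le> R \<and> R * (real k * (1 + \<rho>)) \<le> \<beta> * real N \<and> 3 * L \<le> \<beta> / (\<mu> + \<delta>)\<^sup>2 * (ln R - 1))"
  \<comment> \<open>The bounds make \<beta> / (\<mu> + \<delta>)^2 of order L only when k is at
    least of order L. Below that, k entries of maximal size already sum to at most \<beta>; \<kappa>
    is chosen so that the coherence part takes half of \<beta>, and \<open>e5\<close> grants the
    other half to the regularization error.\<close>
  proof (cases "sqrt (real k) \<le> \<kappa> * sqrt L")
    case True
    have "(sqrt (real k))\<^sup>2 \<le> (\<kappa> * sqrt L)\<^sup>2"
      using True by (intro power_mono) auto
    then have kk: "real k \<le> \<kappa>\<^sup>2 * L"
      using \<open>0 < L\<close> by (simp add: power_mult_distrib)
    have "real k * (\<mu> + \<delta>)\<^sup>2 \<le> real k * (2 * (M / (sqrt (real k) * (L * sqrt L))) + 2 * 10 ^ 8 * D\<^sup>2 / L ^ 6)"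
      using \<alpha> by (intro mult_left_mono) auto
    also have "\<dots> = 2 * M * (real k / sqrt (real k)) / (L * sqrt L) + real k * (2 * 10 ^ 8 * D\<^sup>2 / L ^ 6)"
      by (simp add: distrib_left)
    also have "real k / sqrt (real k) = sqrt (real k)"
      by (simp add: real_div_sqrt)
    also have "2 * M * sqrt (real k) / (L * sqrt L) + real k * (2 * 10 ^ 8 * D\<^sup>2 / L ^ 6)
        \<le> 2 * M * (\<kappa> * sqrt L) / (L * sqrt L) + \<kappa>\<^sup>2 * L * (2 * 10 ^ 8 * D\<^sup>2 / L ^ 6)"
      using True kk M \<open>0 < L\<close> by (intro add_mono divide_right_mono mult_left_mono mult_right_mono) auto
    also have "2 * M * (\<kappa> * sqrt L) / (L * sqrt L) = 2 * M * \<kappa> / L"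
      using \<open>0 < L\<close> by simp
    also have "\<kappa>\<^sup>2 * L * (2 * 10 ^ 8 * D\<^sup>2 / L ^ 6) = 2 * 10 ^ 8 * D\<^sup>2 * \<kappa>\<^sup>2 / L ^ 5"
      using \<open>0 < L\<close> by (simp add: field_simps eval_nat_numeral)
    also have "2 * M * \<kappa> / L + 2 * 10 ^ 8 * D\<^sup>2 * \<kappa>\<^sup>2 / L ^ 5 \<le> 1 / (40000 * L) + 1 / (40000 * L)"
    proof (intro add_mono e5)
      have "2 * M * \<kappa> \<le> 1 / 40000"
        using M by (simp add: \<kappa>_def divide_simps)
      then have "2 * M * \<kappa> / L \<le> 1 / 40000 / L"
        using \<open>0 < L\<close> by (intro divide_right_mono) auto
      then show "2 * M * \<kappa> / L \<le> 1 / (40000 * L)"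
        by simp
    qed
    also have "\<dots> = \<beta>"
      by (simp add: \<beta>_def)
    finally show ?thesis by simp
  next
    case False
    then have "\<kappa> * sqrt L * (L * sqrt L) \<le> sqrt (real k) * (L * sqrt L)"
      using \<open>0 < L\<close> by (intro mult_right_mono) auto
    moreover have "\<kappa> * sqrt L * (L * sqrt L) = \<kappa> * L\<^sup>2"
      using \<open>0 < L\<close> by (simp add: power2_eq_square)
    ultimately have "M / (sqrt (real k) * (L * sqrt L)) \<le> M / (\<kappa> * L\<^sup>2)"
      using M \<kappa> \<open>0 < L\<close> dims(2) by (intro divide_left_mono mult_pos_pos) auto
    then have "(\<mu> + \<delta>)\<^sup>2 \<le> 2 * (M / (\<kappa> * L\<^sup>2)) + 1 / L\<^sup>2"
      using \<alpha> e6 by linarith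
    also have "\<dots> = Q / L\<^sup>2"
      by (simp add: Q_def add_divide_distrib)
    finally have "\<beta> / (Q / L\<^sup>2) \<le> \<beta> / (\<mu> + \<delta>)\<^sup>2"
      using \<alpha>_pos \<beta> Q \<open>0 < L\<close> by (intro divide_left_mono mult_pos_pos divide_pos_pos) auto
    moreover have "\<beta> / (Q / L\<^sup>2) = L / (20000 * Q)"
      using \<open>0 < L\<close> by (simp add: \<beta>_def power2_eq_square)
    \<comment> \<open>The logarithm beats the constants here: \<open>e8\<close> supplies the factor
      60000 Q, which lifts the fraction L / (20000 Q) to 3 L.\<close>
    ultimately have "L / (20000 * Q) * (60000 * Q) \<le> \<beta> / (\<mu> + \<delta>)\<^sup>2 * (ln R - 1)"
      using e8 Q \<open>0 < L\<close> by (intro mult_mono) (auto simp: R_def \<beta>_def)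
    then have "3 * L \<le> \<beta> / (\<mu> + \<delta>)\<^sup>2 * (ln R - 1)"
      using Q by simp
    moreover have "1 \<le> R"
      using e7 by (simp add: R_def)
    moreover have "R * (real k * (1 + \<rho>)) \<le> R * (D / L ^ 3 * real N)"
      using k\<rho> \<open>1 \<le> R\<close> by (intro mult_left_mono) auto
    moreover have "R * (D / L ^ 3 * real N) = \<beta> * real N"
      using D \<open>0 < L\<close> by (simp add: R_def \<beta>_def eval_nat_numeral)
    ultimately show ?thesis by simp
  qed
  have "2 * real k \<le> real N"
  proof -
    have "real k \<le> C3 / L ^ 3 * real m"
      using km m by (simp add: divide_le_eq)
    also have "\<dots> \<le> C3 / L ^ 3 * real N"
      using dims pos \<open>0 < L\<close> by (intro mult_left_mono) auto
    finally have "2 * real k \<le> (2 * C3 / L ^ 3) * real N"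
      by simp
    also have "\<dots> \<le> 1 * real N"
      by (intro mult_right_mono e3) auto
    finally show ?thesis by simp
  qed
  then have k2: "2 * k \<le> N" by linarith
  have h2: "real p * (1 + \<rho>) * real k \<le> 1 / 10 ^ 7 * real N"
  proof -
    have "real p * (real k * (1 + \<rho>)) \<le> 2 * L * (D / L ^ 3 * real N)"
      using \<open>0 \<le> \<rho>\<close> \<open>0 < L\<close> by (intro mult_mono[OF p(2) k\<rho>]) auto
    also have "\<dots> = 2 * D / L ^ 2 * real N"
      using \<open>0 < L\<close> by (simp add: field_simps eval_nat_numeral)
    also have "\<dots> \<le> 1 / 10 ^ 7 * real N"
      by (intro mult_right_mono e2) auto
    finally show ?thesis by (simp add: mult_ac)
  qed
  have h3: "real p * \<beta> \<le> 1 / 6912"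
  proof -
    have "real p * \<beta> \<le> 2 * L * \<beta>"
      using p(2) \<beta> by (intro mult_right_mono) auto
    also have "\<dots> \<le> 1 / 6912"
      using \<open>0 < L\<close> by (simp add: \<beta>_def)
    finally show ?thesis .
  qed
  have "\<delta> \<le> 1 / 4" using \<delta> e1 by linarith
  have "0 \<le> \<mu>" using pos by (simp add: \<mu>_def)
  have "real (card (SIGMA I:ksubsets {..<N} k. {\<sigma> \<in> sign_patterns I. fails m N \<phi> I \<sigma>}))
      \<le> real (N choose k) * 2 ^ k * (real N * exp (- (3 * L)) + 2 * (real N + real k * real p) / 27 ^ p
        + 2 * real N * exp (- 1 / (8 * \<beta>)))"
    by (rule card_failures[OF unit off[folded \<mu>_def] row[folded \<rho>_def] dims(2) k2 \<open>0 \<le> \<mu>\<close> \<open>0 \<le> \<rho>\<close>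
          \<open>3 \<le> p\<close> \<beta> \<open>\<delta> \<le> 1 / 4\<close>[unfolded \<delta>_def s_def] h2 h3 h4[unfolded \<delta>_def s_def]])
  also have "- 1 / (8 * \<beta>) = - (2500 * L)"
    using \<open>0 < L\<close> by (simp add: \<beta>_def)
  also have "real N * exp (- (3 * L)) + 2 * (real N + real k * real p) / 27 ^ p
        + 2 * real N * exp (- (2500 * L)) \<le> \<epsilon>"
    using pos \<open>0 < N\<close> e4 dims p e9 by (intro failure_terms_le) (auto simp: L_def)
  finally show ?thesis
    by (simp add: mult_left_mono)
qed

section \<open>Coherence parameters in terms of the Gram matrix\<close>

lemma gram_eq_scalar_prod:
  assumes "A \<in> carrier_mat m N" "i < N" "j < N"
  shows "gram m (\<lambda>r i. A $$ (r, i)) i j = scalar_prod (col A i) (col A j)"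
  using assms by (simp add: gram_def scalar_prod_def lessThan_atLeast0)

lemma gram_eq_1_if_unit_norm:
  assumes "A \<in> carrier_mat m N" "unit_norm_columns A" "i < N"
  shows "gram m (\<lambda>r i. A $$ (r, i)) i i = 1"
proof -
  have "l2_norm (col A i) = 1"
    using assms by (simp add: unit_norm_columns_def)
  then show ?thesis
    using gram_eq_scalar_prod[OF assms(1,3,3)] by (simp add: l2_norm_def)
qed

lemma col_coherence_eq:
  assumes "A \<in> carrier_mat m N" "i < N" "j < N"
  shows "col_coherence A i j = \<bar>gram m (\<lambda>r i. A $$ (r, i)) i j\<bar>"
  using gram_eq_scalar_prod[OF assms] by (simp add: col_coherence_def)

lemma col_coherence_le_coherence:
  assumes "i < dim_col A" "j < dim_col A" "i \<noteq> j"
  shows "col_coherence A i j \<le> coherence A"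
proof -
  have "{col_coherence A i j | i j. i < dim_col A \<and> j < dim_col A \<and> i \<noteq> j}
      \<subseteq> (\<lambda>(i, j). col_coherence A i j) ` ({..<dim_col A} \<times> {..<dim_col A})"
    by auto
  then have "finite {col_coherence A i j | i j. i < dim_col A \<and> j < dim_col A \<and> i \<noteq> j}"
    by (rule finite_subset) simp
  then show ?thesis
    unfolding coherence_def using assms by (intro Max_ge) auto
qed

lemma col_coherence_commute:
  assumes "A \<in> carrier_mat m N" "i < N" "j < N"
  shows "col_coherence A i j = col_coherence A j i"
  using col_coherence_eq[OF assms] col_coherence_eq[OF assms(1,3,2)] by (simp add: gram_commute)

text \<open>In the coherence-invariant case all rows carry the same multiset of coherences, so every
  row sum equals their mean; multiplicities are essential for this. Otherwise the maximum bounds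
  each column sum, and symmetry turns columns into rows.\<close>

lemma row_sum_le_theta:
  assumes A: "A \<in> carrier_mat m N" and "2 \<le> N" "i < N"
  shows "(\<Sum>j\<in>{..<N} - {i}. (col_coherence A i j)\<^sup>2) \<le> theta A * (real N - 1)"
proof (cases "coherence_invariant A")
  case True
  then obtain S where S: "\<And>i. i < N \<Longrightarrow> image_mset (col_coherence A i) (mset_set ({..<N} - {i})) = S"
    using A by (auto simp: coherence_invariant_def)
  define q where "q = (\<Sum>x\<in>#S. x\<^sup>2)"
  have row: "(\<Sum>j\<in>{..<N} - {i}. (col_coherence A i j)\<^sup>2) = q" if "i < N" for i
    unfolding q_def S[OF that, symmetric] by (simp add: sum_unfold_sum_mset multiset.map_comp comp_def)
  have "theta A = (\<Sum>i<N. q) / (real N * (real N - 1))"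
    using True A row by (simp add: theta_def mean_square_coherence_def)
  also have "\<dots> * (real N - 1) = q"
    using \<open>2 \<le> N\<close> by simp
  finally show ?thesis
    using row[OF \<open>i < N\<close>] by simp
next
  case False
  have "(\<Sum>j\<in>{..<N} - {i}. (col_coherence A i j)\<^sup>2) = (\<Sum>j\<in>{..<N} - {i}. (col_coherence A j i)\<^sup>2)"
    using col_coherence_commute[OF A] \<open>i < N\<close> by (intro sum.cong) auto
  moreover have "(\<Sum>j\<in>{..<N} - {i}. (col_coherence A j i)\<^sup>2) / (real N - 1) \<le> theta A"
    using False A \<open>i < N\<close> by (auto simp: theta_def max_average_square_coherence_def intro!: Max_ge)
  ultimately show ?thesis
    using \<open>2 \<le> N\<close> by (simp add: divide_le_eq)
qed

text \<open>D, \<kappa> and Q stay fixed while L grows. The condition with Q is met because the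
  logarithm is unbounded, so Q may be as large as the hypotheses make it; the others are comparisons
  of powers or exponentials.\<close>

lemma eventually_failure_conditions:
  fixes C3 D \<kappa> Q :: real
  assumes "0 < D"
  shows "\<forall>\<^sub>F L in at_top. 10 ^ 4 * D / L ^ 3 \<le> 1 / 4 \<and> 2 * D / L ^ 2 \<le> 1 / 10 ^ 7 \<and>
    2 * C3 / L ^ 3 \<le> 1 \<and> 3 \<le> L \<and> 2 * 10 ^ 8 * D\<^sup>2 * \<kappa>\<^sup>2 / L ^ 5 \<le> 1 / (40000 * L) \<and>
    2 * 10 ^ 8 * D\<^sup>2 / L ^ 6 \<le> 1 / L\<^sup>2 \<and> 1 \<le> L\<^sup>2 / (20000 * D) \<and>
    60000 * Q \<le> ln (L\<^sup>2 / (20000 * D)) - 1 \<and> (5 + 4 * L) * exp (- (2 * L)) \<le> 1"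
proof (intro eventually_conj)
  have small: "\<forall>\<^sub>F L in at_top. c / L ^ n \<le> b" if "0 < b" "0 < n" for c b :: real and n
  proof -
    have "((\<lambda>L. c / L ^ n) \<longlongrightarrow> 0) at_top"
      using that by (intro tendsto_divide_0[OF tendsto_const] filterlim_at_top_imp_at_infinity
          filterlim_pow_at_top filterlim_ident)
    then have "\<forall>\<^sub>F L in at_top. c / L ^ n < b"
      using that by (intro order_tendstoD)
    then show ?thesis
      by eventually_elim simp
  qed
  show "\<forall>\<^sub>F L in at_top. 10 ^ 4 * D / L ^ 3 \<le> 1 / 4" "\<forall>\<^sub>F L in at_top. 2 * D / L ^ 2 \<le> 1 / 10 ^ 7"
    "\<forall>\<^sub>F L in at_top. 2 * C3 / L ^ 3 \<le> 1"
    by (rule small; simp)+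
  show "\<forall>\<^sub>F L in at_top. 3 \<le> (L :: real)"
    by (rule eventually_ge_at_top)
  have "\<forall>\<^sub>F L in at_top. 2 * 10 ^ 8 * D\<^sup>2 * \<kappa>\<^sup>2 / L ^ 4 \<le> 1 / 40000"
    by (rule small) simp_all
  then show "\<forall>\<^sub>F L in at_top. 2 * 10 ^ 8 * D\<^sup>2 * \<kappa>\<^sup>2 / L ^ 5 \<le> 1 / (40000 * L)"
    using eventually_gt_at_top[of 0]
  proof eventually_elim
    case (elim L)
    then have "2 * 10 ^ 8 * D\<^sup>2 * \<kappa>\<^sup>2 / L ^ 4 / L \<le> 1 / 40000 / L"
      by (intro divide_right_mono) auto
    then show ?case
      by (simp add: eval_nat_numeral mult_ac)
  qed
  have "\<forall>\<^sub>F L in at_top. 2 * 10 ^ 8 * D\<^sup>2 / L ^ 4 \<le> 1"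
    by (rule small) simp_all
  then show "\<forall>\<^sub>F L in at_top. 2 * 10 ^ 8 * D\<^sup>2 / L ^ 6 \<le> 1 / L\<^sup>2"
  proof eventually_elim
    case (elim L)
    then have "2 * 10 ^ 8 * D\<^sup>2 / L ^ 4 / L\<^sup>2 \<le> 1 / L\<^sup>2"
      by (intro divide_right_mono) auto
    then show ?case
      by (simp add: eval_nat_numeral mult_ac)
  qed
  have top: "filterlim (\<lambda>L. L\<^sup>2 / (20000 * D)) at_top at_top"
    using assms by real_asymp
  then show "\<forall>\<^sub>F L in at_top. 1 \<le> L\<^sup>2 / (20000 * D)"
    by (simp add: filterlim_at_top)
  have "\<forall>\<^sub>F L in at_top. 60000 * Q + 1 \<le> ln (L\<^sup>2 / (20000 * D))"
    using filterlim_compose[OF ln_at_top top] by (simp add: filterlim_at_top)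
  then show "\<forall>\<^sub>F L in at_top. 60000 * Q \<le> ln (L\<^sup>2 / (20000 * D)) - 1"
    by eventually_elim simp
  show "\<forall>\<^sub>F L in at_top. (5 + 4 * L) * exp (- (2 * L)) \<le> (1 :: real)"
    by real_asymp
qed

theorem proposition5p1:
  fixes \<Phi> :: "nat \<Rightarrow> real mat"
    and m N k :: "nat \<Rightarrow> nat"
    and \<epsilon> :: "nat \<Rightarrow> real"
  assumes dims: "\<And>n. \<Phi> n \<in> carrier_mat (m n) (N n)"
    and sampling: "\<And>n. m n \<le> N n"
    and unit: "\<And>n. unit_norm_columns (\<Phi> n)"
    and k_range: "\<And>n. 1 \<le> k n \<and> k n \<le> N n"
    and eps_range: "\<And>n. 0 < \<epsilon> n \<and> \<epsilon> n < 1"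
    and growth: "filterlim N at_top sequentially"
    and coh: "(\<lambda>n. coherence (\<Phi> n)) \<in> O(\<lambda>n. real (m n) powr (- 1 / 4))"
    and th: "(\<lambda>n. theta (\<Phi> n)) \<in> O(\<lambda>n. 1 / real (m n))"
    and norm: "(\<lambda>n. spectral_norm (\<Phi> n)) \<in> O(\<lambda>n. sqrt (real (N n) / real (k n)))"
    and rate: "(\<lambda>n. real (m n)) \<in> \<Theta>(\<lambda>n. real (k n) * ln (real (N n) / \<epsilon> n) ^ 3)"
  shows "\<forall>\<^sub>F n in sequentially. \<forall>(M :: 'w measure) X.
           generic_signal M (N n) (k n) X \<and> (AE \<omega> in M. sparse_vec (k n) (X \<omega>)) \<longrightarrow>
             \<P>(\<omega> in M. bp_recovers (\<Phi> n) (X \<omega>)) \<ge> 1 - \<epsilon> n"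
proof -
  let ?L = "\<lambda>n. ln (real (N n) / \<epsilon> n)"
  obtain C1 where C1: "0 < C1"
    "\<forall>\<^sub>F n in sequentially. norm (coherence (\<Phi> n)) \<le> C1 * norm (real (m n) powr (- 1 / 4))"
    using landau_o.bigE[OF coh] by blast
  obtain C2 where C2: "0 < C2" "\<forall>\<^sub>F n in sequentially. norm (theta (\<Phi> n)) \<le> C2 * norm (1 / real (m n))"
    using landau_o.bigE[OF th] by blast
  have "(\<lambda>n. real (k n) * ?L n ^ 3) \<in> O(\<lambda>n. real (m n))"
    using rate by (simp add: bigtheta_def bigomega_iff_bigo)
  then obtain C3 where C3: "0 < C3"
    "\<forall>\<^sub>F n in sequentially. norm (real (k n) * ?L n ^ 3) \<le> C3 * norm (real (m n))"
    using landau_o.bigE by blast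
  have N_top: "filterlim (\<lambda>n. real (N n)) at_top sequentially"
    by (rule filterlim_compose[OF filterlim_real_sequentially growth])
  have N2: "\<forall>\<^sub>F n in sequentially. 2 \<le> N n"
    using growth by (simp add: filterlim_at_top)
  \<comment> \<open>\<epsilon> < 1 gives L \<ge> ln N, so N tending to infinity suffices, however
    \<epsilon> behaves.\<close>
  have L_top: "filterlim ?L at_top sequentially"
  proof (rule filterlim_at_top_mono[OF filterlim_compose[OF ln_at_top N_top]])
    show "\<forall>\<^sub>F n in sequentially. ln (real (N n)) \<le> ?L n"
      using N2
    proof eventually_elim
      case (elim n)
      have "real (N n) * \<epsilon> n \<le> real (N n) * 1"
        using eps_range[of n] by (intro mult_left_mono) auto
      then have "real (N n) \<le> real (N n) / \<epsilon> n"
        using eps_range[of n] by (simp add: le_divide_eq)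
      then show ?case
        using elim by (intro ln_mono) auto
    qed
  qed
  define D where "D = (1 + C2) * C3"
  have "0 < D" using C2 C3 by (simp add: D_def)
  \<comment> \<open>The terms after C3 are the \<kappa> and Q of the counting bound, written out so
    that its premises match literally.\<close>
  note cond = eventually_compose_filterlim[OF eventually_failure_conditions[OF \<open>0 < D\<close>,
        of C3 "1 / (80000 * (C1\<^sup>2 * sqrt C3 + 1))" "2 * (C1\<^sup>2 * sqrt C3) / (1 / (80000 * (C1\<^sup>2 * sqrt C3 + 1))) + 1"] L_top]
  show ?thesis
    using C1(2) C2(2) C3(2) N2 cond
  proof eventually_elim
    case (elim n)
    let ?\<phi> = "\<lambda>r i. \<Phi> n $$ (r, i)"
    have A: "\<Phi> n \<in> carrier_mat (m n) (N n)" by (rule dims)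
    have off: "\<bar>gram (m n) ?\<phi> i j\<bar> \<le> C1 * real (m n) powr (- 1 / 4)" if "i < N n" "j < N n" "i \<noteq> j" for i j
      using col_coherence_le_coherence[of i "\<Phi> n" j] col_coherence_eq[OF A that(1,2)] A that elim(1) by auto
    have row: "(\<Sum>j\<in>{..<N n} - {i}. (gram (m n) ?\<phi> i j)\<^sup>2) \<le> C2 * real (N n) / real (m n)" if "i < N n" for i
    proof -
      have "(\<Sum>j\<in>{..<N n} - {i}. (gram (m n) ?\<phi> i j)\<^sup>2) = (\<Sum>j\<in>{..<N n} - {i}. (col_coherence (\<Phi> n) i j)\<^sup>2)"
        using col_coherence_eq[OF A that] by (intro sum.cong) auto
      also have "\<dots> \<le> theta (\<Phi> n) * (real (N n) - 1)"
        by (rule row_sum_le_theta[OF A elim(4) that])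
      also have "\<dots> \<le> C2 * (1 / real (m n)) * (real (N n) - 1)"
        using elim(2,4) by (intro mult_right_mono) auto
      also have "\<dots> \<le> C2 * (1 / real (m n)) * real (N n)"
        using C2(1) by (intro mult_left_mono) auto
      finally show ?thesis by simp
    qed
    have "0 \<le> ?L n" using elim(5) by linarith
    then have kL: "real (k n) * ?L n ^ 3 \<le> C3 * real (m n)"
      using elim(3) by simp
    \<comment> \<open>The count concerns \<Phi> n alone, so the same n serves all probability spaces
      M and signals X.\<close>
    have count: "real (card (SIGMA I:ksubsets {..<N n} (k n). {\<sigma> \<in> sign_patterns I. fails (m n) (N n) ?\<phi> I \<sigma>}))
      \<le> real (N n choose k n) * 2 ^ k n * \<epsilon> n"
      using elim(5) eps_range[of n] k_range[of n]
      by (intro card_failures_le[OF C1(1) C2(1) C3(1) _ sampling _ _ gram_eq_1_if_unit_norm[OF A unit] off row kL])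
        (auto simp: D_def)
    show ?case
      using prob_bp_recovers_ge[OF A _ _ _ count] k_range[of n] by blast
  qed
qed

end
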